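(* Let $n \ge 2$ and let $\Omega \subset \mathbb{R}^n$ be a bounded open domain with $C^{1,\gamma}$ boundary for some $\gamma \in (0,1)$. Put $\beta_n = (n-1)\left(\frac{\omega_{n-1}}{2}\right)^{\frac{1}{n-1}}$. Then for every $\alpha > \beta_n$ there exists a sequence $\{u_k\} \subset C^1(\overline{\Omega}) \cap C(\partial\Omega)$ satisfying $\int_{\Omega} u_k \, dx = 0$ and $\|\nabla u_k\|_{L^n(\Omega)} \le 1$ for all $k$, such that $$\int_{\partial\Omega} e^{\alpha |u_k|^{\frac{n}{n-1}}} \, d\mathcal{H}_{n-1} \to \infty \quad \text{as } k \to \infty.$$
   Context: Functions are real-valued. A domain is a connected open set. $\omega_{n-1}$ denotes the $(n-1)$-dimensional Hausdorff (surface) measure of the unit sphere $\mathbb{S}^{n-1} \subset \mathbb{R}^n$, and $\mathcal{H}_{n-1}$ denotes $(n-1)$-dimensional Hausdorff measure (surface measure on $\partial\Omega$). $\|\nabla u\|_{L^n(\Omega)} = \left(\int_\Omega |\nabla u|^n dx\right)^{1/n}$. *)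

theory Defs
  imports "HOL-Analysis.Analysis"
begin

section \<open>Hausdorff measure\<close>

text \<open>
  The normalisation is the usual one, in which the $m$-dimensional Hausdorff measure on an
  $m$-dimensional Euclidean space is Lebesgue measure: a set of diameter $d$ counts as a ball of
  diameter $d$. The empty set gets weight 0 separately since \<open>0 ^ 0 = 1\<close>.
\<close>

definition hausdorff_weight :: "nat \<Rightarrow> 'a::metric_space set \<Rightarrow> ennreal" where
  "hausdorff_weight m C =
     (if C = {} then 0 else ennreal (unit_ball_vol (real m) * (diameter C / 2) ^ m))"

text \<open>
  Boundedness of the covering sets is required explicitly because \<^const>\<open>diameter\<close> is
  a real number and has no meaningful value on unbounded sets.
\<close>

definition hausdorff_pre :: "nat \<Rightarrow> real \<Rightarrow> 'a::metric_space set \<Rightarrow> ennreal" where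
  "hausdorff_pre m \<delta> A =
     (INF C \<in> {C :: nat \<Rightarrow> 'a set. A \<subseteq> (\<Union>i. C i) \<and> (\<forall>i. bounded (C i) \<and> diameter (C i) \<le> \<delta>)}.
        \<Sum>i. hausdorff_weight m (C i))"

definition hausdorff_outer :: "nat \<Rightarrow> 'a::metric_space set \<Rightarrow> ennreal" where
  "hausdorff_outer m A = (SUP \<delta>\<in>{0<..}. hausdorff_pre m \<delta> A)"

text \<open>
  \<^const>\<open>measure_of\<close> yields the zero measure unless its argument is countably additive
  on the given sets; lemma \<open>emeasure_hausdorff_measure\<close> below shows that it is.
\<close>

definition hausdorff_measure :: "nat \<Rightarrow> 'a::metric_space measure" where
  "hausdorff_measure m = measure_of UNIV (sets borel) (hausdorff_outer m)"

lemma sets_hausdorff_measure [simp, measurable_cong]: "sets (hausdorff_measure m) = sets borel"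
  unfolding hausdorff_measure_def
  by (metis sets.sets_measure_of_eq space_borel)

lemma space_hausdorff_measure [simp]: "space (hausdorff_measure m) = UNIV"
  unfolding hausdorff_measure_def by (simp add: space_measure_of_conv)

lemma hausdorff_pre_mono: "A \<subseteq> B \<Longrightarrow> hausdorff_pre m \<delta> A \<le> hausdorff_pre m \<delta> B"
  unfolding hausdorff_pre_def by (intro INF_superset_mono) auto

lemma hausdorff_pre_antimono: "\<delta> \<le> \<epsilon> \<Longrightarrow> hausdorff_pre m \<epsilon> A \<le> hausdorff_pre m \<delta> A"
  unfolding hausdorff_pre_def by (intro INF_superset_mono) (auto intro: order_trans)

lemma hausdorff_pre_le_outer: "0 < \<delta> \<Longrightarrow> hausdorff_pre m \<delta> A \<le> hausdorff_outer m A"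
  unfolding hausdorff_outer_def by (intro SUP_upper) auto

lemma hausdorff_outer_mono: "A \<subseteq> B \<Longrightarrow> hausdorff_outer m A \<le> hausdorff_outer m B"
  unfolding hausdorff_outer_def by (intro SUP_mono) (auto intro: hausdorff_pre_mono)

lemma hausdorff_outer_empty [simp]: "hausdorff_outer m {} = 0"
proof -
  have "hausdorff_pre m \<delta> ({} :: 'a set) \<le> 0" if "0 < \<delta>" for \<delta>
    unfolding hausdorff_pre_def
    by (rule INF_lower2[of "\<lambda>_. {}"]) (use that in \<open>auto simp: hausdorff_weight_def\<close>)
  then show ?thesis
    unfolding hausdorff_outer_def by (intro antisym SUP_least) auto
qed

lemma hausdorff_pre_UN_le:
  fixes A :: "nat \<Rightarrow> 'a::metric_space set"
  shows "hausdorff_pre m \<delta> (\<Union>i. A i) \<le> (\<Sum>i. hausdorff_pre m \<delta> (A i))"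
proof (rule ennreal_le_epsilon)
  fix e :: real assume fin: "(\<Sum>i. hausdorff_pre m \<delta> (A i)) < top" and e: "0 < e"
  define ee where "ee i = e * (1/2)^Suc i" for i
  have ee0: "ee i > 0" for i using e by (simp add: ee_def)
  have "\<exists>C. A i \<subseteq> (\<Union>j. C j) \<and> (\<forall>j. bounded (C j) \<and> diameter (C j) \<le> \<delta>) \<and>
          (\<Sum>j. hausdorff_weight m (C j)) \<le> hausdorff_pre m \<delta> (A i) + ennreal (ee i)" for i
  proof -
    have "hausdorff_pre m \<delta> (A i) < top"
      using fin by (metis ennreal_suminf_lessD)
    then have "hausdorff_pre m \<delta> (A i) < hausdorff_pre m \<delta> (A i) + ennreal (ee i)"
      using ee0[of i] by (simp add: ennreal_add_left_cancel_less)
    then obtain C where "C \<in> {C. A i \<subseteq> (\<Union>j. C j) \<and> (\<forall>j. bounded (C j) \<and> diameter (C j) \<le> \<delta>)}"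
        "(\<Sum>j. hausdorff_weight m (C j)) < hausdorff_pre m \<delta> (A i) + ennreal (ee i)"
      by (subst (asm) (1) hausdorff_pre_def) (auto simp only: INF_less_iff)
    then show ?thesis by (intro exI[of _ C]) (auto intro: less_imp_le)
  qed
  then obtain C where C: "\<And>i. A i \<subseteq> (\<Union>j. C i j)"
      "\<And>i j. bounded (C i j) \<and> diameter (C i j) \<le> \<delta>"
      "\<And>i. (\<Sum>j. hausdorff_weight m (C i j)) \<le> hausdorff_pre m \<delta> (A i) + ennreal (ee i)"
    by metis
  define D where "D = (\<lambda>k. case prod_decode k of (i, j) \<Rightarrow> C i j)"
  have sub: "(\<Union>i. A i) \<subseteq> (\<Union>k. D k)"
  proof
    fix x assume "x \<in> (\<Union>i. A i)"
    then obtain i j where "x \<in> C i j" using C(1) by blast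
    then have "x \<in> D (prod_encode (i, j))" by (simp add: D_def)
    then show "x \<in> (\<Union>k. D k)" by blast
  qed
  have "hausdorff_pre m \<delta> (\<Union>i. A i) \<le> (\<Sum>k. hausdorff_weight m (D k))"
    unfolding hausdorff_pre_def using sub C(2)
    by (intro INF_lower) (auto simp: D_def split: prod.split)
  also have "\<dots> = (\<Sum>i. \<Sum>j. hausdorff_weight m (C i j))"
  proof -
    have "(\<Sum>k. (\<lambda>(i, j). hausdorff_weight m (C i j)) (prod_decode k)) =
        (\<Sum>i. \<Sum>j. hausdorff_weight m (C i j))"
      by (subst suminf_ennreal_2dimen[of "\<lambda>i. \<Sum>j. hausdorff_weight m (C i j)"
            "\<lambda>(i, j). hausdorff_weight m (C i j)"]) (auto simp: comp_def)
    then show ?thesis by (simp add: D_def case_prod_unfold)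
  qed
  also have "\<dots> \<le> (\<Sum>i. hausdorff_pre m \<delta> (A i) + ennreal (ee i))"
    using C(3) by (intro suminf_le) auto
  also have "\<dots> = (\<Sum>i. hausdorff_pre m \<delta> (A i)) + (\<Sum>i. ennreal (ee i))"
    by (intro suminf_add[symmetric]) auto
  also have "(\<Sum>i. ennreal (ee i)) = ennreal e"
  proof -
    have "(\<lambda>i. ee i) sums (e * 1)"
      unfolding ee_def by (intro sums_mult power_half_series)
    then show ?thesis using ee0 by (subst suminf_ennreal_eq[of _ e]) (auto intro: less_imp_le)
  qed
  finally show "hausdorff_pre m \<delta> (\<Union>i. A i) \<le> (\<Sum>i. hausdorff_pre m \<delta> (A i)) + ennreal e" .
qed

lemma hausdorff_outer_UN_le:
  fixes A :: "nat \<Rightarrow> 'a::metric_space set"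
  shows "hausdorff_outer m (\<Union>i. A i) \<le> (\<Sum>i. hausdorff_outer m (A i))"
  unfolding hausdorff_outer_def[of m "\<Union>i. A i"]
proof (rule SUP_least)
  fix \<delta> :: real assume "\<delta> \<in> {0<..}"
  then have "(\<Sum>i. hausdorff_pre m \<delta> (A i)) \<le> (\<Sum>i. hausdorff_outer m (A i))"
    by (intro suminf_le hausdorff_pre_le_outer) auto
  then show "hausdorff_pre m \<delta> (\<Union>i. A i) \<le> (\<Sum>i. hausdorff_outer m (A i))"
    using hausdorff_pre_UN_le order_trans by blast
qed

lemma outer_measure_space_hausdorff: "outer_measure_space UNIV (hausdorff_outer m)"
  by (auto simp: outer_measure_space_def positive_def increasing_def countably_subadditive_def
      hausdorff_outer_mono hausdorff_outer_UN_le)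

lemma hausdorff_outer_Un_le:
  "hausdorff_outer m (A \<union> B) \<le> hausdorff_outer m A + hausdorff_outer m B"
  using hausdorff_outer_UN_le[of m "binaryset A B"]
  by (simp add: UN_binaryset_eq suminf_binaryset_eq)

lemma hausdorff_pre_separated:
  fixes A B :: "'a::metric_space set"
  assumes "\<And>x y. x \<in> A \<Longrightarrow> y \<in> B \<Longrightarrow> d \<le> dist x y" "\<delta> < d"
  shows "hausdorff_pre m \<delta> A + hausdorff_pre m \<delta> B \<le> hausdorff_pre m \<delta> (A \<union> B)"
  unfolding hausdorff_pre_def[of m \<delta> "A \<union> B"]
proof (rule INF_greatest, safe)
  fix C :: "nat \<Rightarrow> 'a set"
  assume cov: "A \<union> B \<subseteq> (\<Union>i. C i)" and C: "\<forall>i. bounded (C i) \<and> diameter (C i) \<le> \<delta>"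
  define P where "P X i = (if C i \<inter> X = {} then {} else C i)" for X i
  have P: "bounded (P X i) \<and> diameter (P X i) \<le> \<delta>" for X i
    using C diameter_ge_0[of "C i"] by (auto simp: P_def intro: order_trans)
  have pre: "hausdorff_pre m \<delta> X \<le> (\<Sum>i. hausdorff_weight m (P X i))" if "X \<subseteq> A \<union> B" for X
    unfolding hausdorff_pre_def using that cov P
    by (intro INF_lower) (fastforce simp: P_def)
  have disj: "P A i = {} \<or> P B i = {}" for i
  proof (rule ccontr)
    assume "\<not> ?thesis"
    then obtain x y where "x \<in> A" "y \<in> B" "x \<in> C i" "y \<in> C i"
      by (auto simp: P_def split: if_splits)
    then show False
      using assms C diameter_bounded_bound[of "C i" x y] by (smt (verit))
  qed
  have "hausdorff_weight m (P A i) + hausdorff_weight m (P B i) \<le> hausdorff_weight m (C i)" for i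
    using disj[of i] by (auto simp: P_def hausdorff_weight_def split: if_splits)
  then have "(\<Sum>i. hausdorff_weight m (P A i) + hausdorff_weight m (P B i))
      \<le> (\<Sum>i. hausdorff_weight m (C i))"
    by (intro suminf_le) auto
  moreover have "(\<Sum>i. hausdorff_weight m (P A i) + hausdorff_weight m (P B i)) =
      (\<Sum>i. hausdorff_weight m (P A i)) + (\<Sum>i. hausdorff_weight m (P B i))"
    by (intro suminf_add[symmetric]) auto
  ultimately show "hausdorff_pre m \<delta> A + hausdorff_pre m \<delta> B \<le> (\<Sum>i. hausdorff_weight m (C i))"
    using add_mono[OF pre[of A] pre[of B]] by simp
qed

lemma hausdorff_outer_separated:
  fixes A B :: "'a::metric_space set"
  assumes sep: "\<And>x y. x \<in> A \<Longrightarrow> y \<in> B \<Longrightarrow> d \<le> dist x y" and "0 < d"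
  shows "hausdorff_outer m A + hausdorff_outer m B \<le> hausdorff_outer m (A \<union> B)"
proof -
  have "hausdorff_pre m \<delta> A + hausdorff_pre m \<epsilon> B \<le> hausdorff_outer m (A \<union> B)"
    if "0 < \<delta>" "0 < \<epsilon>" for \<delta> \<epsilon>
  proof -
    define \<eta> where "\<eta> = min (min \<delta> \<epsilon>) (d / 2)"
    have \<eta>: "0 < \<eta>" "\<eta> \<le> \<delta>" "\<eta> \<le> \<epsilon>" "\<eta> < d" using that \<open>0 < d\<close> by (auto simp: \<eta>_def)
    have "hausdorff_pre m \<delta> A + hausdorff_pre m \<epsilon> B \<le> hausdorff_pre m \<eta> A + hausdorff_pre m \<eta> B"
      by (intro add_mono hausdorff_pre_antimono \<eta>)
    also have "\<dots> \<le> hausdorff_pre m \<eta> (A \<union> B)"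
      using sep \<eta>(4) by (rule hausdorff_pre_separated)
    also have "\<dots> \<le> hausdorff_outer m (A \<union> B)"
      using \<eta>(1) by (rule hausdorff_pre_le_outer)
    finally show ?thesis .
  qed
  then have "hausdorff_pre m \<delta> A + hausdorff_outer m B \<le> hausdorff_outer m (A \<union> B)"
    if "0 < \<delta>" for \<delta>
    unfolding hausdorff_outer_def[of m B] using that
    by (subst ennreal_SUP_add_right) (auto intro!: SUP_least)
  then show ?thesis
    unfolding hausdorff_outer_def[of m A]
    by (subst ennreal_SUP_add_left[symmetric]) (auto intro!: SUP_least)
qed

lemma hausdorff_outer_sum_separated:
  fixes R :: "nat \<Rightarrow> 'a::metric_space set"
  assumes sep: "\<And>N. \<exists>d>0. \<forall>x\<in>(\<Union>i<N. R i). \<forall>y\<in>R N. d \<le> dist x y" and sub: "\<And>i. R i \<subseteq> T"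
  shows "(\<Sum>i. hausdorff_outer m (R i)) \<le> hausdorff_outer m T"
proof -
  have fin: "(\<Sum>i<N. hausdorff_outer m (R i)) \<le> hausdorff_outer m (\<Union>i<N. R i)" for N
  proof (induction N)
    case (Suc N)
    obtain d where d: "d > 0" "\<And>x y. x \<in> (\<Union>i<N. R i) \<Longrightarrow> y \<in> R N \<Longrightarrow> d \<le> dist x y"
      using sep[of N] by blast
    have "(\<Sum>i<Suc N. hausdorff_outer m (R i))
        \<le> hausdorff_outer m (\<Union>i<N. R i) + hausdorff_outer m (R N)"
      using Suc by (simp add: add_right_mono)
    also have "\<dots> \<le> hausdorff_outer m ((\<Union>i<N. R i) \<union> R N)"
      using d(2,1) by (rule hausdorff_outer_separated)
    also have "(\<Union>i<N. R i) \<union> R N = (\<Union>i<Suc N. R i)"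
      by (auto simp: less_Suc_eq)
    finally show ?case .
  qed simp
  have "(\<Sum>i<N. hausdorff_outer m (R i)) \<le> hausdorff_outer m T" for N
    using fin[of N] sub by (meson UN_least hausdorff_outer_mono order_trans)
  then show ?thesis
    by (intro suminf_le_const summableI) auto
qed

lemma closed_in_lambda_system_hausdorff:
  fixes F :: "'a::metric_space set"
  assumes "closed F"
  shows "F \<in> lambda_system UNIV UNIV (hausdorff_outer m)"
proof -
  let ?H = "hausdorff_outer m"
  have "?H (F \<inter> T) + ?H (- F \<inter> T) \<le> ?H T" for T
  proof (cases "F = {} \<or> ?H T = top")
    case False
    then have ne: "F \<noteq> {}" and fin: "?H T < top" by (auto simp: less_top)
    define g where "g k = 1 / (real k + 1)" for k
    define A where "A k = {x \<in> T. g k \<le> infdist x F}" for k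
    define R where "R k = A (Suc k) - A k" for k
    have g: "g (Suc k) < g k" "0 < g k" for k by (auto simp: g_def field_simps)
    have g_anti: "g j \<le> g i" if "i \<le> j" for i j
      using that by (auto simp: g_def intro!: divide_left_mono)
    have sep: "s - t \<le> dist x y" if "s \<le> infdist x F" "infdist y F \<le> t" for x y s t
      using that infdist_triangle[of x F y] by linarith
    have Rlo: "g (Suc k) \<le> infdist x F" and Rhi: "infdist x F \<le> g k" if "x \<in> R k" for x k
      using that by (auto simp: R_def A_def)
    have step: "(\<Sum>i. ?H (R (2 * i + c))) \<le> ?H T" for c
    proof (rule hausdorff_outer_sum_separated)
      fix N
      show "\<exists>d>0. \<forall>x\<in>(\<Union>i<N. R (2 * i + c)). \<forall>y\<in>R (2 * N + c). d \<le> dist x y"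
      proof (cases N)
        case (Suc M)
        let ?k = "2 * M + c"
        have "g (Suc ?k) - g (Suc (Suc ?k)) \<le> dist x y"
          if "i < N" "x \<in> R (2 * i + c)" "y \<in> R (2 * N + c)" for x y i
        proof (rule sep)
          have "g (Suc ?k) \<le> g (Suc (2 * i + c))" using that Suc by (intro g_anti) auto
          then show "g (Suc ?k) \<le> infdist x F" using Rlo[OF that(2)] by simp
          show "infdist y F \<le> g (Suc (Suc ?k))" using Rhi[OF that(3)] Suc by simp
        qed
        then show ?thesis using g(1)[of "Suc ?k"]
          by (intro exI[of _ "g (Suc ?k) - g (Suc (Suc ?k))"]) auto
      qed (auto intro: exI[of _ 1])
    qed (auto simp: R_def A_def)
    have summ: "(\<Sum>i. ?H (R i)) < top"
    proof -
      have "(\<Sum>i<N. ?H (R i)) \<le> ?H T + ?H T" for N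
      proof -
        have "(\<Sum>i<N. ?H (R i)) \<le> (\<Sum>i<2*N. ?H (R i))"
          by (intro sum_mono2) auto
        also have "\<dots> = (\<Sum>i<N. ?H (R (2 * i))) + (\<Sum>i<N. ?H (R (2 * i + 1)))"
          by (induction N) (auto simp: algebra_simps)
        also have "\<dots> \<le> ?H T + ?H T"
          using step[of 0] step[of 1] sum_le_suminf[OF summableI, of "{..<N}" "\<lambda>i. ?H (R (2 * i))"]
            sum_le_suminf[OF summableI, of "{..<N}" "\<lambda>i. ?H (R (2 * i + 1))"]
          by (intro add_mono) (auto intro: order_trans)
        finally show ?thesis .
      qed
      then have "(\<Sum>i. ?H (R i)) \<le> ?H T + ?H T" by (intro suminf_le_const summableI) auto
      then show ?thesis using fin by (meson ennreal_add_less_top le_less_trans)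
    qed
    have cover: "- F \<inter> T \<subseteq> A k \<union> (\<Union>i. R (i + k))" for k
    proof
      fix x assume x: "x \<in> - F \<inter> T"
      then have "0 < infdist x F"
        using assms ne by (simp add: infdist_pos_not_in_closed)
      then obtain j where "inverse (real (Suc j)) < infdist x F" using reals_Archimedean by blast
      then have "x \<in> A j" using x by (auto simp: A_def g_def field_simps)
      then obtain l where l: "x \<in> A l" "\<And>i. i < l \<Longrightarrow> x \<notin> A i"
        using LeastI[of "\<lambda>l. x \<in> A l"] not_less_Least by metis
      show "x \<in> A k \<union> (\<Union>i. R (i + k))"
      proof (cases "l \<le> k")
        case True
        then show ?thesis using l(1) g_anti[of l k] by (auto simp: A_def)
      next
        case False
        then have "x \<in> R ((l - 1 - k) + k)" using l by (auto simp: R_def)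
        then show ?thesis by blast
      qed
    qed
    have bound: "?H (F \<inter> T) + ?H (- F \<inter> T) \<le> ?H T + (\<Sum>i. ?H (R (i + k)))" for k
    proof -
      have "?H (- F \<inter> T) \<le> ?H (A k) + ?H (\<Union>i. R (i + k))"
        using hausdorff_outer_mono[OF cover[of k]] hausdorff_outer_Un_le order_trans by blast
      also have "\<dots> \<le> ?H (A k) + (\<Sum>i. ?H (R (i + k)))"
        by (intro add_left_mono hausdorff_outer_UN_le)
      finally have 1: "?H (F \<inter> T) + ?H (- F \<inter> T) \<le> ?H (F \<inter> T) + ?H (A k) + (\<Sum>i. ?H (R (i + k)))"
        by (simp add: add.assoc add_left_mono)
      have "?H (A k) + ?H (F \<inter> T) \<le> ?H (A k \<union> (F \<inter> T))"
      proof (rule hausdorff_outer_separated)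
        fix x y assume "x \<in> A k" "y \<in> F \<inter> T"
        then show "g k \<le> dist x y" using sep[of "g k" x y 0] by (simp add: A_def)
      qed (rule g)
      also have "\<dots> \<le> ?H T" by (intro hausdorff_outer_mono) (auto simp: A_def)
      finally have "?H (F \<inter> T) + ?H (A k) \<le> ?H T" by (simp add: add.commute)
      then show ?thesis using 1 by (meson add_right_mono order_trans)
    qed
    have "(\<lambda>k. \<Sum>i. ?H (R (i + k))) \<longlonglongrightarrow> 0"
    proof -
      define f where "f i = enn2real (?H (R i))" for i
      have "?H (R i) < top" for i using summ by (metis ennreal_suminf_lessD)
      then have f: "?H (R i) = ennreal (f i)" for i by (simp add: f_def)
      have f0: "0 \<le> f i" for i by (simp add: f_def)
      have sf: "summable f"
        using summ f0 unfolding f by (intro summable_suminf_not_top) auto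
      have "(\<lambda>k. ennreal (\<Sum>i. f (i + k))) \<longlonglongrightarrow> ennreal 0"
        using suminf_exist_split2[OF sf] by (rule tendsto_ennrealI)
      then show ?thesis
        unfolding f using f0 sf
        by (subst suminf_ennreal2) (auto simp: summable_iff_shift)
    qed
    then have "(\<lambda>k. ?H T + (\<Sum>i. ?H (R (i + k)))) \<longlonglongrightarrow> ?H T + 0"
      by (intro tendsto_add tendsto_const)
    then show ?thesis
      using bound by (intro LIMSEQ_le_const[of _ "?H T"]) auto
  qed auto
  moreover have "?H T \<le> ?H (F \<inter> T) + ?H (- F \<inter> T)" for T
  proof -
    have "(F \<inter> T) \<union> (- F \<inter> T) = T" by blast
    then show ?thesis by (metis hausdorff_outer_Un_le)
  qed
  ultimately show ?thesis
    by (auto simp: lambda_system_def Compl_eq_Diff_UNIV[symmetric] intro: antisym)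
qed

lemma emeasure_hausdorff_measure:
  assumes "A \<in> sets borel"
  shows "emeasure (hausdorff_measure m) A = hausdorff_outer m A"
proof -
  let ?L = "lambda_system UNIV UNIV (hausdorff_outer m) :: 'a set set"
  interpret sigma_algebra UNIV "UNIV :: 'a set set" by (metis Pow_UNIV sigma_algebra_Pow)
  have L: "measure_space UNIV ?L (hausdorff_outer m)"
    using outer_measure_space_hausdorff by (rule caratheodory_lemma)
  then have sL: "sigma_algebra UNIV ?L" by (simp add: measure_space_def)
  have "sigma_sets UNIV (Collect closed) \<subseteq> ?L"
    using closed_in_lambda_system_hausdorff by (intro sigma_algebra.sigma_sets_subset[OF sL]) auto
  then have sub: "sets borel \<subseteq> ?L"
    by (simp add: borel_eq_closed)
  have "countably_additive (sets borel) (hausdorff_outer m :: 'a set \<Rightarrow> ennreal)"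
    using L sub unfolding measure_space_def countably_additive_def by blast
  moreover have "positive (sets borel) (hausdorff_outer m :: 'a set \<Rightarrow> ennreal)"
    by (simp add: positive_def)
  ultimately show ?thesis
    using assms sets.sigma_algebra_axioms[of "borel :: 'a measure"]
    unfolding hausdorff_measure_def
    by (intro emeasure_measure_of_sigma) auto
qed


section \<open>Domains with Hoelder continuously differentiable boundary\<close>

definition C1_holder_on :: "real \<Rightarrow> 'a::real_inner set \<Rightarrow> ('a \<Rightarrow> real) \<Rightarrow> bool" where
  "C1_holder_on \<gamma> S f \<longleftrightarrow>
     (\<exists>G L. (\<forall>x\<in>S. (f has_derivative (\<lambda>h. h \<bullet> G x)) (at x within S)) \<and>
            (\<forall>x\<in>S. \<forall>y\<in>S. norm (G x - G y) \<le> L * dist x y powr \<gamma>))"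

text \<open>
  Near each boundary point, after choosing a unit vector \<open>e\<close> as the last coordinate
  direction, the domain is the part of a ball lying above the graph of a $C^{1,\gamma}$ function
  \<open>\<phi>\<close> of the remaining $n-1$ coordinates. The hyperplane orthogonal to \<open>e\<close> plays
  the role of $\mathbb{R}^{n-1}$, and \<open>x - (x \<bullet> e) *\<^sub>R e\<close> is the projection of
  \<open>x\<close> to it.
\<close>

definition C1_holder_boundary :: "real \<Rightarrow> 'a::euclidean_space set \<Rightarrow> bool" where
  "C1_holder_boundary \<gamma> \<Omega> \<longleftrightarrow>
     (\<forall>p\<in>frontier \<Omega>. \<exists>r>0. \<exists>e \<phi>. norm e = 1 \<and> C1_holder_on \<gamma> {y. y \<bullet> e = 0} \<phi> \<and>
        \<Omega> \<inter> ball p r = {x \<in> ball p r. \<phi> (x - (x \<bullet> e) *\<^sub>R e) < x \<bullet> e})"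


section \<open>Gradients and functions that are $C^1$ up to the boundary\<close>

definition grad :: "('a::real_inner \<Rightarrow> real) \<Rightarrow> 'a \<Rightarrow> 'a" where
  "grad f x = (THE D. GDERIV f x :> D)"

text \<open>
  $C^1(\overline\Omega)$ for open $\Omega$: \<open>u\<close> is continuous on the closure and
  differentiable in $\Omega$, and its gradient extends continuously to the closure.
\<close>

definition C1_on_closure :: "'a::real_inner set \<Rightarrow> ('a \<Rightarrow> real) \<Rightarrow> bool" where
  "C1_on_closure \<Omega> u \<longleftrightarrow> continuous_on (closure \<Omega>) u \<and>
     (\<exists>G. continuous_on (closure \<Omega>) G \<and> (\<forall>x\<in>\<Omega>. GDERIV u x :> G x))"

end

theory Submission
  imports Defs
begin

text \<open>
  Let \<open>K = n * unit_ball_vol n\<close> be the classical area of the unit sphere. The functions that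
  defeat a constant \<open>\<alpha>\<close> above the threshold are truncated fundamental solutions centred at a
  boundary point \<open>p\<close>, namely \<open>log_bump p d x = - ln (|x - p|^2 + d^2) / 2\<close> for \<open>d \<rightarrow> 0\<close>.
  Put \<open>L = ln (1 / d)\<close>. Three facts about them are needed.

  \<^item> Their energy is at most \<open>A * L\<close> for any prescribed \<open>A > K / 2\<close>
    (\<open>log_bump_energy_sequence\<close>). The gradient has length at most \<open>1 / |x - p|\<close>, and
    \<open>|x - p|^(-n)\<close> has integral \<open>K * ln (b / a)\<close> over a full shell of radii \<open>a < b\<close>. Near \<open>p\<close>
    the domain lies in a cone that is only slightly wider than a half-space
    (\<open>C1_boundary_cone\<close>), so it sees little more than half of each shell.

  \<^item> Their mean over the domain is at most \<open>o(L)\<close> (\<open>log_bump_mean_le\<close>), as they are at most \<open>L\<close> everywhere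
    and bounded above, uniformly in \<open>d\<close>, at a fixed distance from \<open>p\<close>.

  \<^item> On the boundary inside the ball of radius \<open>d\<close> about \<open>p\<close> they equal \<open>L + O(1)\<close>, and this
    piece of boundary has area at least \<open>c * d^(n-1)\<close> (\<open>C1_boundary_hausdorff_lower\<close>).

  Subtract the mean and divide by \<open>(A * L)^(1/n)\<close>. On that piece of boundary the exponent
  \<open>\<alpha> * |u|^(n/(n-1))\<close> is then at least \<open>\<theta> * L\<close>, with \<open>\<theta>\<close> as close to \<open>\<alpha> / A^(1/(n-1))\<close> as
  desired, and the exponential integral is at least \<open>c * d^(n-1) * exp (\<theta> * L) = c * d^(n-1-\<theta>)\<close>.
  It tends to infinity as soon as \<open>\<theta> > n - 1\<close>, which \<open>\<alpha> > (n-1) * (K/2)^(1/(n-1))\<close> permits.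

  The threshold is stated through the Hausdorff measure of the sphere, so it remains to see that
  this measure is finite and at least \<open>K\<close> (\<open>measure_hausdorff_sphere_ge\<close>). The lower bound with
  the sharp constant is an isodiametric statement: to leading order, a set of small diameter \<open>\<delta>\<close> on
  the sphere must not have more area than the \<open>(n-1)\<close>-ball of diameter \<open>\<delta>\<close>. It is obtained by thickening the set
  radially by a small height \<open>h\<close>. By the Brunn-Minkowski inequality the thickened set has at most
  the volume of half its difference body (\<open>measure_le_symmetrization\<close>), which fits into a
  cylinder of radius about \<open>\<delta> / 2\<close> and height about \<open>h\<close>.
\<close>

section \<open>The Brunn-Minkowski inequality and difference bodies\<close>

definition minkowski_sum :: "'a::real_normed_vector set \<Rightarrow> 'a set \<Rightarrow> 'a set" where
  "minkowski_sum A B = (\<Union>x\<in>A. \<Union>y\<in>B. {x + y})"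

lemma minkowski_sum_iff: "z \<in> minkowski_sum A B \<longleftrightarrow> (\<exists>x\<in>A. \<exists>y\<in>B. z = x + y)"
  by (auto simp: minkowski_sum_def)

lemma minkowski_sum_commute: "minkowski_sum A B = minkowski_sum B A"
  by (force simp: minkowski_sum_iff add.commute)

lemma minkowski_sum_mono: "A \<subseteq> A' \<Longrightarrow> B \<subseteq> B' \<Longrightarrow> minkowski_sum A B \<subseteq> minkowski_sum A' B'"
  unfolding minkowski_sum_def by blast

lemma lmeasurable_minkowski_sum:
  fixes A B :: "'a::euclidean_space set"
  assumes "open A" "bounded A" "bounded B"
  shows "minkowski_sum A B \<in> lmeasurable"
  unfolding minkowski_sum_def
  using assms by (intro lmeasurable_open bounded_sums open_sums) auto

text \<open>
  Finite disjoint unions of boxes are the sets for which the inequality is proved by counting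
  boxes. Open boxes are used because Minkowski sums of open sets are open, hence measurable.
\<close>

definition box_family :: "'a::euclidean_space set set \<Rightarrow> bool" where
  "box_family \<A> \<longleftrightarrow> finite \<A> \<and> disjoint \<A> \<and> (\<forall>X\<in>\<A>. X \<noteq> {} \<and> (\<exists>a b. X = box a b))"

lemma box_familyD:
  assumes "box_family \<A>" "X \<in> \<A>"
  shows "X \<noteq> {}" "\<exists>a b. X = box a b"
  using assms by (auto simp: box_family_def)

lemma box_family_open_bounded:
  assumes "box_family \<A>" shows "open (\<Union>\<A>)" "bounded (\<Union>\<A>)"
  using assms unfolding box_family_def by (auto intro!: open_Union bounded_Union)

lemma box_family_lmeasurable: "box_family \<A> \<Longrightarrow> \<Union>\<A> \<in> lmeasurable"
  using box_family_open_bounded by (intro lmeasurable_open) auto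

text \<open>
  The opposite half-space is \<open>halfspace_above (- i) (- c)\<close>, so that one family of lemmas serves
  both sides of a cut.
\<close>

definition halfspace_above :: "'a::euclidean_space \<Rightarrow> real \<Rightarrow> 'a set" where
  "halfspace_above i c = {x. c < x \<bullet> i}"

lemma box_Int_halfspace:
  fixes a b :: "'a::euclidean_space"
  assumes "i \<in> Basis \<or> - i \<in> Basis"
  shows "\<exists>a' b'. box a b \<inter> halfspace_above i c = box a' b'"
  using assms
proof
  assume i: "i \<in> Basis"
  have "box a b \<inter> halfspace_above i c = box (\<Sum>j\<in>Basis. (if j = i then max (a \<bullet> j) c else a \<bullet> j) *\<^sub>R j) b"
    using i by (auto simp: mem_box halfspace_above_def) (smt (verit) i)+
  then show ?thesis by blast
next
  assume i: "- i \<in> Basis"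
  define j where "j = - i"
  have j: "j \<in> Basis" "i = - j" using i by (auto simp: j_def)
  have "box a b \<inter> halfspace_above i c = box a (\<Sum>k\<in>Basis. (if k = j then min (b \<bullet> k) (- c) else b \<bullet> k) *\<^sub>R k)"
    using j(1) unfolding j(2)
    by (auto simp: mem_box halfspace_above_def) (smt (verit))+
  then show ?thesis by blast
qed

definition cut_family :: "'a::euclidean_space \<Rightarrow> real \<Rightarrow> 'a set set \<Rightarrow> 'a set set" where
  "cut_family i c \<A> = (\<lambda>X. X \<inter> halfspace_above i c) ` \<A> - {{}}"

lemma Union_cut_family: "\<Union>(cut_family i c \<A>) = \<Union>\<A> \<inter> halfspace_above i c"
  by (auto simp: cut_family_def)

lemma box_family_cut:
  assumes "box_family \<A>" "i \<in> Basis \<or> - i \<in> Basis"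
  shows "box_family (cut_family i c \<A>)"
  unfolding box_family_def
proof (intro conjI ballI)
  show "finite (cut_family i c \<A>)" using assms by (auto simp: box_family_def cut_family_def)
  show "disjoint (cut_family i c \<A>)"
    using assms(1) unfolding box_family_def cut_family_def disjoint_def by blast
next
  fix X assume X: "X \<in> cut_family i c \<A>"
  then show "X \<noteq> {}" by (auto simp: cut_family_def)
  obtain Y where Y: "Y \<in> \<A>" "X = Y \<inter> halfspace_above i c" using X by (auto simp: cut_family_def)
  then obtain a b where "Y = box a b" using assms(1) unfolding box_family_def by blast
  then show "\<exists>a b. X = box a b" using Y(2) box_Int_halfspace[OF assms(2)] by metis
qed

lemma card_cut_family_le: "finite \<A> \<Longrightarrow> card (cut_family i c \<A>) \<le> card \<A>"
  unfolding cut_family_def by (meson card_Diff1_le card_image_le dual_order.trans finite_imageI)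

text \<open>
  This makes the induction terminate: a cut along a hyperplane that has a whole box of the
  family on either side lowers the number of boxes on both sides.
\<close>

lemma card_cut_family_less:
  assumes "finite \<A>" "X \<in> \<A>" "X \<inter> halfspace_above i c = {}"
  shows "card (cut_family i c \<A>) < card \<A>"
proof -
  have "cut_family i c \<A> \<subseteq> (\<lambda>X. X \<inter> halfspace_above i c) ` (\<A> - {X})"
    using assms(3) by (auto simp: cut_family_def)
  then have "card (cut_family i c \<A>) \<le> card (\<A> - {X})"
    using assms(1) by (meson card_image_le card_mono finite_Diff finite_imageI le_trans)
  also have "\<dots> < card \<A>" using assms by (meson card_Diff1_less)
  finally show ?thesis .
qed

lemma measure_halfspaces:
  fixes A :: "'a::euclidean_space set"
  assumes "A \<in> lmeasurable" "i \<noteq> 0"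
  shows "measure lebesgue (A \<inter> halfspace_above i c) + measure lebesgue (A \<inter> halfspace_above (- i) (- c))
     = measure lebesgue A"
proof -
  have op: "open (halfspace_above j d)" for j :: 'a and d
    unfolding halfspace_above_def by (intro open_Collect_less continuous_intros)
  have m: "A \<inter> halfspace_above j d \<in> lmeasurable" for j d
    using assms(1) op by (intro fmeasurable_Int_fmeasurable) (auto intro: borel_open)
  have "measure lebesgue (A \<inter> halfspace_above i c \<union> A \<inter> halfspace_above (- i) (- c))
     = measure lebesgue A"
  proof (rule measure_negligible_symdiff[OF assms(1)])
    have "negligible {x. i \<bullet> x = c}" using assms(2) negligible_hyperplane by blast
    then show "negligible (A - (A \<inter> halfspace_above i c \<union> A \<inter> halfspace_above (- i) (- c)) \<union>
        (A \<inter> halfspace_above i c \<union> A \<inter> halfspace_above (- i) (- c) - A))"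
      by (rule negligible_subset) (auto simp: halfspace_above_def inner_commute)
  qed
  moreover have "measure lebesgue (A \<inter> halfspace_above i c \<union> A \<inter> halfspace_above (- i) (- c)) =
     measure lebesgue (A \<inter> halfspace_above i c) + measure lebesgue (A \<inter> halfspace_above (- i) (- c))"
  proof (rule measure_Un_AE)
    show "AE x in lebesgue. x \<notin> A \<inter> halfspace_above i c \<or> x \<notin> A \<inter> halfspace_above (- i) (- c)"
      by (rule AE_I2) (auto simp: halfspace_above_def)
  qed (rule m)+
  ultimately show ?thesis by simp
qed

text \<open>
  The nontrivial inclusion splits a point of the large box in the same proportion in each
  coordinate.
\<close>

lemma minkowski_sum_boxes:
  fixes a b c d :: "'a::euclidean_space"
  assumes "box a b \<noteq> {}" "box c d \<noteq> {}"
  shows "minkowski_sum (box a b) (box c d) = box (a + c) (b + d)"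
proof (intro equalityI subsetI)
  fix z assume "z \<in> minkowski_sum (box a b) (box c d)"
  then show "z \<in> box (a + c) (b + d)"
    by (fastforce simp: minkowski_sum_iff mem_box inner_add_left)
next
  fix z assume z: "z \<in> box (a + c) (b + d)"
  have lt: "a \<bullet> i < b \<bullet> i" "c \<bullet> i < d \<bullet> i" if "i \<in> Basis" for i
    using assms that by (auto simp: box_ne_empty)
  define t where "t i = ((z - a - c) \<bullet> i) / ((b - a + d - c) \<bullet> i)" for i
  have t: "0 < t i" "t i < 1" if "i \<in> Basis" for i
  proof -
    have "0 < (b - a + d - c) \<bullet> i" using lt[OF that] by (simp add: algebra_simps)
    then show "0 < t i" "t i < 1" using z that
      by (auto simp: t_def mem_box inner_diff_left inner_add_left)
  qed
  define x where "x = (\<Sum>i\<in>Basis. (a \<bullet> i + t i * ((b - a) \<bullet> i)) *\<^sub>R i)"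
  define y where "y = (\<Sum>i\<in>Basis. (c \<bullet> i + t i * ((d - c) \<bullet> i)) *\<^sub>R i)"
  have mid: "p < p + s * (q - p)" "p + s * (q - p) < q" if "p < q" "0 < s" "s < 1" for p q s :: real
  proof -
    show "p < p + s * (q - p)" using that by simp
    have "s * (q - p) < 1 * (q - p)" using that by (intro mult_strict_right_mono) auto
    then show "p + s * (q - p) < q" by simp
  qed
  have "x \<in> box a b" "y \<in> box c d"
    using lt t mid by (auto simp: mem_box x_def y_def inner_diff_left)
  moreover have "z = x + y"
  proof (rule euclidean_eqI)
    fix i :: 'a assume i: "i \<in> Basis"
    have ne: "(b - a + d - c) \<bullet> i \<noteq> 0" using lt[OF i] by (simp add: algebra_simps)
    have "x \<bullet> i = a \<bullet> i + t i * ((b - a) \<bullet> i)" "y \<bullet> i = c \<bullet> i + t i * ((d - c) \<bullet> i)"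
      using i by (simp_all add: x_def y_def)
    then have "(x + y) \<bullet> i = a \<bullet> i + c \<bullet> i + t i * ((b - a + d - c) \<bullet> i)"
      by (simp add: inner_add_left inner_diff_left algebra_simps)
    also have "\<dots> = z \<bullet> i" using ne by (simp add: t_def inner_diff_left)
    finally show "z \<bullet> i = (x + y) \<bullet> i" by simp
  qed
  ultimately show "z \<in> minkowski_sum (box a b) (box c d)" by (auto simp: minkowski_sum_iff)
qed

text \<open>
  Coordinatewise this is the inequality \<open>(u + v)^2 \<ge> 4 * u * v\<close> between the side lengths.
\<close>

lemma brunn_minkowski_boxes:
  fixes a b c d :: "'a::euclidean_space"
  assumes "box a b \<noteq> {}" "box c d \<noteq> {}"
  shows "2 ^ DIM('a) * sqrt (measure lebesgue (box a b) * measure lebesgue (box c d))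
    \<le> measure lebesgue (minkowski_sum (box a b) (box c d))"
proof -
  have lt: "a \<bullet> i < b \<bullet> i" "c \<bullet> i < d \<bullet> i" if "i \<in> Basis" for i
    using assms that by (auto simp: box_ne_empty)
  have m: "measure lebesgue (box a b) = (\<Prod>i\<in>Basis. (b - a) \<bullet> i)"
       "measure lebesgue (box c d) = (\<Prod>i\<in>Basis. (d - c) \<bullet> i)"
       "measure lebesgue (minkowski_sum (box a b) (box c d)) = (\<Prod>i\<in>Basis. (b + d - (a + c)) \<bullet> i)"
    unfolding minkowski_sum_boxes[OF assms]
    using lt by (auto simp: measure_lborel_box_eq inner_add_left less_imp_le add_mono)
  have "(2 ^ DIM('a) * sqrt (measure lebesgue (box a b) * measure lebesgue (box c d)))\<^sup>2
     = (\<Prod>i\<in>Basis. 4 * ((b - a) \<bullet> i) * ((d - c) \<bullet> i))"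
  proof -
    have nn: "0 \<le> (\<Prod>i\<in>Basis. (b - a) \<bullet> i) * (\<Prod>i\<in>Basis. (d - c) \<bullet> i)"
      using lt by (intro mult_nonneg_nonneg prod_nonneg) (auto simp: inner_diff_left less_imp_le)
    have "((2::real) ^ DIM('a))\<^sup>2 = 4 ^ DIM('a)"
      by (simp add: power2_eq_square flip: power_mult_distrib)
    then show ?thesis using nn by (simp add: m power_mult_distrib prod.distrib)
  qed
  also have "\<dots> \<le> (\<Prod>i\<in>Basis. ((b + d - (a + c)) \<bullet> i)\<^sup>2)"
  proof (rule prod_mono, intro conjI)
    fix i :: 'a assume i: "i \<in> Basis"
    show "0 \<le> 4 * ((b - a) \<bullet> i) * ((d - c) \<bullet> i)" using lt[OF i] by (simp add: inner_diff_left)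
    have "0 \<le> ((b - a) \<bullet> i - (d - c) \<bullet> i)\<^sup>2" by simp
    then show "4 * ((b - a) \<bullet> i) * ((d - c) \<bullet> i) \<le> ((b + d - (a + c)) \<bullet> i)\<^sup>2"
      by (simp add: inner_diff_left inner_add_left power2_eq_square algebra_simps)
  qed
  also have "\<dots> = (measure lebesgue (minkowski_sum (box a b) (box c d)))\<^sup>2"
    by (simp add: m prod_power_distrib)
  finally show ?thesis by (rule power2_le_imp_le) simp
qed

text \<open>
  The measure cut off is a Lipschitz function of the position of the hyperplane, because a slab
  of a bounded set has measure at most a constant times its width.
\<close>

lemma halfspace_measure_attains:
  fixes A :: "'a::euclidean_space set"
  assumes A: "A \<in> lmeasurable" "bounded A" and i: "i \<in> Basis" and \<theta>: "0 \<le> \<theta>" "\<theta> \<le> 1"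
  obtains c where "measure lebesgue (A \<inter> halfspace_above i c) = \<theta> * measure lebesgue A"
proof -
  define f where "f c = measure lebesgue (A \<inter> halfspace_above i c)" for c
  obtain M where M: "M > 0" "\<And>x. x \<in> A \<Longrightarrow> norm x \<le> M"
    using A(2) bounded_pos by blast
  have op: "open (halfspace_above j d)" for j :: 'a and d
    unfolding halfspace_above_def by (intro open_Collect_less continuous_intros)
  have m: "A \<inter> halfspace_above j d \<in> lmeasurable" for j d
    using A(1) op by (intro fmeasurable_Int_fmeasurable) (auto intro: borel_open)
  define K where "K = (\<Prod>j\<in>Basis - {i}. 2 * M)"
  have lip: "f c \<le> f c' + K * (c' - c)" if "c \<le> c'" for c c'
  proof -
    define l :: 'a where "l = (\<Sum>j\<in>Basis. (if j = i then c else - M) *\<^sub>R j)"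
    define u :: 'a where "u = (\<Sum>j\<in>Basis. (if j = i then c' else M) *\<^sub>R j)"
    have "A \<inter> halfspace_above i c \<subseteq> (A \<inter> halfspace_above i c') \<union> cbox l u"
    proof
      fix x assume x: "x \<in> A \<inter> halfspace_above i c"
      have "- M \<le> x \<bullet> j" "x \<bullet> j \<le> M" if "j \<in> Basis" for j
        using Basis_le_norm[OF that, of x] M(2)[of x] x by auto
      then show "x \<in> (A \<inter> halfspace_above i c') \<union> cbox l u"
        using x by (auto simp: halfspace_above_def mem_box l_def u_def)
    qed
    then have "f c \<le> measure lebesgue ((A \<inter> halfspace_above i c') \<union> cbox l u)"
      unfolding f_def by (intro measure_mono_fmeasurable fmeasurable.Un m) (auto intro: fmeasurableD m)
    also have "\<dots> \<le> f c' + measure lebesgue (cbox l u)"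
      unfolding f_def by (intro measure_Un_le) (auto intro: fmeasurableD m)
    also have "measure lebesgue (cbox l u) = (\<Prod>j\<in>Basis. if j = i then c' - c else 2 * M)"
      using that M(1) by (auto simp: measure_lborel_cbox_eq l_def u_def inner_diff_left intro!: prod.cong)
    also have "\<dots> = K * (c' - c)"
      using i by (subst prod.remove[of _ i]) (auto simp: K_def intro!: prod.cong)
    finally show ?thesis .
  qed
  have mono: "f c' \<le> f c" if "c \<le> c'" for c c'
    unfolding f_def using that
    by (intro measure_mono_fmeasurable m fmeasurableD[OF m]) (auto simp: halfspace_above_def)
  have lip2: "\<bar>f c - f c'\<bar> \<le> K * \<bar>c - c'\<bar>" for c c'
    using lip[of c c'] lip[of c' c] mono[of c c'] mono[of c' c] by (cases "c \<le> c'") auto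
  have K: "0 \<le> K" using M(1) by (auto simp: K_def intro: prod_nonneg)
  have "K-lipschitz_on UNIV f"
    using lip2 K by (intro lipschitz_onI) (auto simp: dist_real_def)
  then have cont: "continuous_on {-M-1..M+1} f"
    using lipschitz_on_continuous_on continuous_on_subset by blast
  have bd: "\<bar>x \<bullet> i\<bar> \<le> M" if "x \<in> A" for x
    using Basis_le_norm[OF i, of x] M(2)[OF that] by auto
  have "A \<inter> halfspace_above i (-M-1) = A" "A \<inter> halfspace_above i (M+1) = {}"
    using bd by (fastforce simp: halfspace_above_def)+
  then have "f (-M-1) = measure lebesgue A" "f (M+1) = 0" by (auto simp: f_def)
  then have "f (M+1) \<le> \<theta> * measure lebesgue A" "\<theta> * measure lebesgue A \<le> f (-M-1)"
    using \<theta> by (auto intro: mult_left_le_one_le)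
  then have "\<exists>x\<ge>-M-1. x \<le> M+1 \<and> f x = \<theta> * measure lebesgue A"
    using cont M(1) by (intro IVT2') auto
  then show ?thesis using that by (auto simp: f_def)
qed

text \<open>
  The multiplicative form of the Brunn-Minkowski inequality, by the cutting argument of Hadwiger
  and Ohmann. If \<open>\<A>\<close> has two boxes, a coordinate hyperplane separates them; cut \<open>\<B>\<close> by a
  parallel hyperplane so that both unions are divided in the same ratio \<open>\<theta> : 1 - \<theta>\<close>. The sums
  of the corresponding halves lie on different sides of a third hyperplane, so their measures
  add, and by induction they are at least \<open>\<theta>\<close> and \<open>1 - \<theta>\<close> times the desired bound.
\<close>

lemma brunn_minkowski_box_families:
  fixes \<A> \<B> :: "'a::euclidean_space set set"
  assumes "box_family \<A>" "box_family \<B>" "\<A> \<noteq> {}" "\<B> \<noteq> {}"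
  shows "2 ^ DIM('a) * sqrt (measure lebesgue (\<Union>\<A>) * measure lebesgue (\<Union>\<B>))
    \<le> measure lebesgue (minkowski_sum (\<Union>\<A>) (\<Union>\<B>))"
  using assms
proof (induction "card \<A> + card \<B>" arbitrary: \<A> \<B> rule: less_induct)
  case less
  have step: "2 ^ DIM('a) * sqrt (measure lebesgue (\<Union>\<A>') * measure lebesgue (\<Union>\<B>'))
    \<le> measure lebesgue (minkowski_sum (\<Union>\<A>') (\<Union>\<B>'))"
    if fam: "box_family \<A>'" "box_family \<B>'" "\<A>' \<noteq> {}" "\<B>' \<noteq> {}"
      and c2: "2 \<le> card \<A>'" and sum: "card \<A>' + card \<B>' = card \<A> + card \<B>"
    for \<A>' \<B>' :: "'a set set"
  proof -
    have finA: "finite \<A>'" and finB: "finite \<B>'" using fam by (auto simp: box_family_def)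
    obtain X Y where XY: "X \<in> \<A>'" "Y \<in> \<A>'" "X \<noteq> Y"
      using c2 card_le_Suc0_iff_eq[OF finA] by (metis not_less_eq_eq numeral_2_eq_2)
    then have disj: "X \<inter> Y = {}" "X \<noteq> {}" "Y \<noteq> {}"
      using fam(1) by (auto simp: box_family_def disjoint_def)
    obtain a b a' b' where ab: "X = box a b" "Y = box a' b'"
      using box_familyD(2)[OF fam(1) XY(1)] box_familyD(2)[OF fam(1) XY(2)] by blast
    have "\<exists>j\<in>Basis. b \<bullet> j \<le> a' \<bullet> j \<or> b' \<bullet> j \<le> a \<bullet> j"
      using disj unfolding ab disjoint_interval(4) by (meson box_ne_empty(2) not_le)
    then obtain Z W i c where ZW: "i \<in> Basis" "Z \<in> \<A>'" "W \<in> \<A>'"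
        "Z \<inter> halfspace_above i c = {}" "W \<inter> halfspace_above (- i) (- c) = {}" "Z \<noteq> {}" "W \<noteq> {}"
    proof (clarify, elim disjE)
      fix j assume "j \<in> Basis" "b \<bullet> j \<le> a' \<bullet> j"
      then show thesis using XY disj(2,3) unfolding ab
        by (intro that[of j X Y "b \<bullet> j"]) (fastforce simp: ab halfspace_above_def mem_box)+
    next
      fix j assume "j \<in> Basis" "b' \<bullet> j \<le> a \<bullet> j"
      then show thesis using XY disj(2,3) unfolding ab
        by (intro that[of j Y X "b' \<bullet> j"]) (fastforce simp: ab halfspace_above_def mem_box)+
    qed
    have i0: "i \<noteq> 0" using ZW(1) nonzero_Basis by blast
    have mA: "\<Union>\<A>' \<in> lmeasurable" and mB: "\<Union>\<B>' \<in> lmeasurable"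
      using fam box_family_lmeasurable by auto
    define H K where "H = halfspace_above i c" and "K = halfspace_above (- i) (- c)"
    have posbox: "0 < measure lebesgue V" if VC: "V \<in> \<C>" "box_family \<C>" for V and \<C> :: "'a set set"
    proof -
      obtain a b where "V = box a b" using box_familyD(2)[OF VC(2,1)] by blast
      moreover have "V \<noteq> {}" using box_familyD(1)[OF VC(2,1)] .
      ultimately show ?thesis by (auto simp: measure_lborel_box_eq box_ne_empty inner_diff_left less_imp_le intro!: prod_pos)
    qed
    have posfam: "0 < measure lebesgue (\<Union>\<C>)" if bf: "box_family \<C>" "\<C> \<noteq> {}" for \<C> :: "'a set set"
    proof -
      obtain V where V: "V \<in> \<C>" using bf(2) by blast
      obtain a b where "V = box a b" using box_familyD(2)[OF bf(1) V] by blast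
      then have "measure lebesgue V \<le> measure lebesgue (\<Union>\<C>)"
        using V box_family_lmeasurable[OF bf(1)] by (intro measure_mono_fmeasurable) auto
      then show ?thesis using posbox[OF V bf(1)] by simp
    qed
    define \<alpha> where "\<alpha> = measure lebesgue (\<Union>\<A>')"
    define \<beta> where "\<beta> = measure lebesgue (\<Union>\<B>')"
    have ab0: "0 < \<alpha>" "0 < \<beta>" using posfam[OF fam(1,3)] posfam[OF fam(2,4)] by (simp_all add: \<alpha>_def \<beta>_def)
    define \<theta> where "\<theta> = measure lebesgue (\<Union>\<A>' \<inter> H) / \<alpha>"
    have fA: "measure lebesgue (\<Union>\<A>' \<inter> H) = \<theta> * \<alpha>" using ab0 by (simp add: \<theta>_def)
    have "measure lebesgue (\<Union>\<A>' \<inter> H) + measure lebesgue (\<Union>\<A>' \<inter> K) = \<alpha>"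
      unfolding H_def K_def \<alpha>_def by (rule measure_halfspaces[OF mA i0])
    then have fA': "measure lebesgue (\<Union>\<A>' \<inter> K) = (1 - \<theta>) * \<alpha>" using fA by (simp add: algebra_simps)
    have bfA: "box_family (cut_family i c \<A>')" "box_family (cut_family (- i) (- c) \<A>')"
      using fam ZW(1) by (auto intro: box_family_cut)
    have sub: "W \<subseteq> halfspace_above i c \<union> {x. x \<bullet> i = c}" "Z \<subseteq> halfspace_above (- i) (- c) \<union> {x. x \<bullet> i = c}"
      using ZW(4,5) by (auto simp: halfspace_above_def disjoint_iff)
    have neA: "cut_family i c \<A>' \<noteq> {}" "cut_family (- i) (- c) \<A>' \<noteq> {}"
    proof -
      have hyp: "\<not> V \<subseteq> {x. x \<bullet> i = c}" if "V \<in> \<A>'" for V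
      proof
        assume "V \<subseteq> {x. x \<bullet> i = c}"
        moreover have "negligible {x. x \<bullet> i = c}" using ZW(1) negligible_standard_hyperplane by blast
        ultimately have "measure lebesgue V = 0"
          using negligible_subset negligible_imp_measure0 by blast
        then show False using posbox[OF that fam(1)] by simp
      qed
      have "W \<inter> halfspace_above i c \<noteq> {}" "Z \<inter> halfspace_above (- i) (- c) \<noteq> {}"
        using hyp[OF ZW(3)] hyp[OF ZW(2)] sub by blast+
      then show "cut_family i c \<A>' \<noteq> {}" "cut_family (- i) (- c) \<A>' \<noteq> {}"
        using ZW(2,3) unfolding cut_family_def by blast+
    qed
    have \<theta>: "0 < \<theta>" "\<theta> < 1"
      using posfam[OF bfA(1) neA(1)] posfam[OF bfA(2) neA(2)] fA fA' ab0
      unfolding Union_cut_family H_def[symmetric] K_def[symmetric] by (auto simp: zero_less_mult_iff)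
    obtain c' where c': "measure lebesgue (\<Union>\<B>' \<inter> halfspace_above i c') = \<theta> * \<beta>"
      using halfspace_measure_attains[OF mB box_family_open_bounded(2)[OF fam(2)] ZW(1), of \<theta>] \<theta>
      unfolding \<beta>_def by auto
    \<comment> \<open>This cut divides the second union in the same ratio, hence the factors \<open>\<theta>\<close> and \<open>1 - \<theta>\<close>
        come out of the square roots below.\<close>
    define H' K' where "H' = halfspace_above i c'" and "K' = halfspace_above (- i) (- c')"
    have fB: "measure lebesgue (\<Union>\<B>' \<inter> H') = \<theta> * \<beta>" using c' by (simp add: H'_def)
    have "measure lebesgue (\<Union>\<B>' \<inter> H') + measure lebesgue (\<Union>\<B>' \<inter> K') = \<beta>"
      unfolding H'_def K'_def \<beta>_def by (rule measure_halfspaces[OF mB i0])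
    then have fB': "measure lebesgue (\<Union>\<B>' \<inter> K') = (1 - \<theta>) * \<beta>" using fB by (simp add: algebra_simps)
    have bfB: "box_family (cut_family i c' \<B>')" "box_family (cut_family (- i) (- c') \<B>')"
      using fam ZW(1) by (auto intro: box_family_cut)
    have neB: "cut_family i c' \<B>' \<noteq> {}" "cut_family (- i) (- c') \<B>' \<noteq> {}"
    proof -
      have "\<Union>(cut_family i c' \<B>') \<noteq> {}" "\<Union>(cut_family (- i) (- c') \<B>') \<noteq> {}"
        unfolding Union_cut_family H'_def[symmetric] K'_def[symmetric]
        using fB fB' \<theta> ab0 by (auto simp: measure_empty)
      then show "cut_family i c' \<B>' \<noteq> {}" "cut_family (- i) (- c') \<B>' \<noteq> {}" by auto
    qed
    have I1: "2 ^ DIM('a) * sqrt (\<theta> * \<alpha> * (\<theta> * \<beta>))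
        \<le> measure lebesgue (minkowski_sum (\<Union>\<A>' \<inter> H) (\<Union>\<B>' \<inter> H'))"
      using less.hyps[OF _ bfA(1) bfB(1) neA(1) neB(1)] sum
        card_cut_family_less[OF finA ZW(2) ZW(4)] card_cut_family_le[OF finB, of i c']
      unfolding Union_cut_family H_def[symmetric] H'_def[symmetric] fA fB by linarith
    have I2: "2 ^ DIM('a) * sqrt ((1 - \<theta>) * \<alpha> * ((1 - \<theta>) * \<beta>))
        \<le> measure lebesgue (minkowski_sum (\<Union>\<A>' \<inter> K) (\<Union>\<B>' \<inter> K'))"
      using less.hyps[OF _ bfA(2) bfB(2) neA(2) neB(2)] sum
        card_cut_family_less[OF finA ZW(3) ZW(5)] card_cut_family_le[OF finB, of "- i" "- c'"]
      unfolding Union_cut_family K_def[symmetric] K'_def[symmetric] fA' fB' by linarith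
    have sq: "sqrt (t * \<alpha> * (t * \<beta>)) = t * sqrt (\<alpha> * \<beta>)" if "0 \<le> t" for t
    proof -
      have "t * \<alpha> * (t * \<beta>) = t\<^sup>2 * (\<alpha> * \<beta>)" by (simp add: power2_eq_square)
      then show ?thesis using that by (simp only: real_sqrt_mult real_sqrt_abs)
    qed
    have opb: "open (\<Union>\<A>' \<inter> H)" "bounded (\<Union>\<A>' \<inter> H)" "open (\<Union>\<A>' \<inter> K)" "bounded (\<Union>\<A>' \<inter> K)"
       "bounded (\<Union>\<B>' \<inter> H')" "bounded (\<Union>\<B>' \<inter> K')"
      using box_family_open_bounded bfA bfB
      unfolding Union_cut_family[symmetric] H_def K_def H'_def K'_def by blast+
    have m1: "minkowski_sum (\<Union>\<A>' \<inter> H) (\<Union>\<B>' \<inter> H') \<in> lmeasurable"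
      and m2: "minkowski_sum (\<Union>\<A>' \<inter> K) (\<Union>\<B>' \<inter> K') \<in> lmeasurable"
      using opb by (auto intro: lmeasurable_minkowski_sum)
    have mAB: "minkowski_sum (\<Union>\<A>') (\<Union>\<B>') \<in> lmeasurable"
      using box_family_open_bounded fam by (intro lmeasurable_minkowski_sum) auto
    have "2 ^ DIM('a) * sqrt (\<alpha> * \<beta>) =
        2 ^ DIM('a) * (\<theta> * sqrt (\<alpha> * \<beta>)) + 2 ^ DIM('a) * ((1 - \<theta>) * sqrt (\<alpha> * \<beta>))"
      by (simp add: algebra_simps)
    also have "\<dots> \<le> measure lebesgue (minkowski_sum (\<Union>\<A>' \<inter> H) (\<Union>\<B>' \<inter> H')) +
        measure lebesgue (minkowski_sum (\<Union>\<A>' \<inter> K) (\<Union>\<B>' \<inter> K'))"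
      using I1 I2 sq[of \<theta>] sq[of "1 - \<theta>"] \<theta> by simp
    also have "\<dots> = measure lebesgue (minkowski_sum (\<Union>\<A>' \<inter> H) (\<Union>\<B>' \<inter> H') \<union>
        minkowski_sum (\<Union>\<A>' \<inter> K) (\<Union>\<B>' \<inter> K'))"
    proof (rule measure_Un_AE[symmetric])
      have "minkowski_sum (\<Union>\<A>' \<inter> H) (\<Union>\<B>' \<inter> H') \<inter> minkowski_sum (\<Union>\<A>' \<inter> K) (\<Union>\<B>' \<inter> K') = {}"
      proof -
        have "c + c' < x \<bullet> i" if "x \<in> minkowski_sum (\<Union>\<A>' \<inter> H) (\<Union>\<B>' \<inter> H')" for x
          using that by (auto simp: minkowski_sum_iff H_def H'_def halfspace_above_def inner_add_left)
        moreover have "x \<bullet> i < c + c'" if "x \<in> minkowski_sum (\<Union>\<A>' \<inter> K) (\<Union>\<B>' \<inter> K')" for x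
          using that by (auto simp: minkowski_sum_iff K_def K'_def halfspace_above_def inner_add_left)
        ultimately show ?thesis by fastforce
      qed
      then show "AE x in lebesgue. x \<notin> minkowski_sum (\<Union>\<A>' \<inter> H) (\<Union>\<B>' \<inter> H') \<or>
          x \<notin> minkowski_sum (\<Union>\<A>' \<inter> K) (\<Union>\<B>' \<inter> K')" by (intro AE_I2) blast
    qed (use m1 m2 in auto)
    also have "\<dots> \<le> measure lebesgue (minkowski_sum (\<Union>\<A>') (\<Union>\<B>'))"
      using m1 m2 mAB by (intro measure_mono_fmeasurable Un_least minkowski_sum_mono) auto
    finally show ?thesis by (simp add: \<alpha>_def \<beta>_def)
  qed
  have fin: "finite \<A>" "finite \<B>" using less.prems by (auto simp: box_family_def)
  consider "2 \<le> card \<A>" | "2 \<le> card \<B>" | "card \<A> = 1" "card \<B> = 1"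
    using fin less.prems(3,4) by (metis One_nat_def card_0_eq le_neq_implies_less less_one nat_le_linear not_less_eq_eq numeral_2_eq_2)
  then show ?case
  proof cases
    case 1
    then show ?thesis using step[of \<A> \<B>] less.prems by blast
  next
    case 2
    then show ?thesis using step[of \<B> \<A>] less.prems
      by (simp add: minkowski_sum_commute mult.commute add.commute)
  next
    case 3
    then obtain X Y where XY: "\<A> = {X}" "\<B> = {Y}" by (meson card_1_singletonE)
    obtain a b c d where ab: "X = box a b" "Y = box c d"
      using box_familyD(2)[OF less.prems(1), of X] box_familyD(2)[OF less.prems(2), of Y] XY by blast
    moreover have "X \<noteq> {}" "Y \<noteq> {}"
      using box_familyD(1)[OF less.prems(1), of X] box_familyD(1)[OF less.prems(2), of Y] XY by auto
    ultimately show ?thesis using brunn_minkowski_boxes[of a b c d] by (simp add: XY)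
  qed
qed

text \<open>
  A finite cover of the compact set by boxes inside the open set is refined to a division; the
  interiors of its cells form the family, and only a null set is lost.
\<close>

lemma box_family_between:
  fixes K U :: "'a::euclidean_space set"
  assumes "compact K" "open U" "K \<subseteq> U" "K \<noteq> {}"
  obtains \<A> where "box_family \<A>" "\<Union>\<A> \<subseteq> U" "measure lebesgue K \<le> measure lebesgue (\<Union>\<A>)"
proof -
  have "\<exists>a b. x \<in> box a b \<and> cbox a b \<subseteq> U" if "x \<in> K" for x
  proof -
    have "x \<in> U" using assms(3) that by blast
    from open_contains_cbox[OF assms(2) this] show ?thesis by metis
  qed
  then have "\<forall>x\<in>K. \<exists>p. x \<in> box (fst p) (snd p) \<and> cbox (fst p) (snd p) \<subseteq> U" by simp
  then obtain f where f: "\<forall>x\<in>K. x \<in> box (fst (f x)) (snd (f x)) \<and> cbox (fst (f x)) (snd (f x)) \<subseteq> U"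
    using bchoice[of K "\<lambda>x p. x \<in> box (fst p) (snd p) \<and> cbox (fst p) (snd p) \<subseteq> U"] by blast
  define a b where "a x = fst (f x)" and "b x = snd (f x)" for x
  have ab: "x \<in> box (a x) (b x)" "cbox (a x) (b x) \<subseteq> U" if "x \<in> K" for x
    using f that by (auto simp: a_def b_def)
  have cov: "K \<subseteq> (\<Union>x\<in>K. box (a x) (b x))" using ab(1) by blast
  obtain C where C: "C \<subseteq> K" "finite C" "K \<subseteq> (\<Union>x\<in>C. box (a x) (b x))"
    by (rule compactE_image[OF assms(1) open_box cov])
  define F where "F = (\<lambda>x. cbox (a x) (b x)) ` C"
  obtain p where p: "p division_of (\<Union>F)"
    using elementary_unions_intervals[of F] C(2) by (auto simp: F_def)
  define \<A> where "\<A> = interior ` p - {{}}"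
  have fp: "finite p" using p by blast
  have int: "\<exists>a b. X = cbox a b \<and> interior X = box a b" if "X \<in> p" for X
    using p that by (metis division_ofD(4) interior_cbox)
  have bf: "box_family \<A>"
    unfolding box_family_def
  proof (intro conjI)
    show "finite \<A>" using fp by (simp add: \<A>_def)
    show "disjoint \<A>"
      using division_ofD(5)[OF p] unfolding \<A>_def disjoint_def by blast
    show "\<forall>X\<in>\<A>. X \<noteq> {} \<and> (\<exists>a b. X = box a b)" using int by (auto simp: \<A>_def)
  qed
  have UA: "\<Union>\<A> = \<Union>(interior ` p)" by (auto simp: \<A>_def)
  have UF: "\<Union>F = \<Union>p" using division_ofD(6)[OF p] by simp
  have sub: "\<Union>\<A> \<subseteq> \<Union>F" unfolding UA UF using interior_subset by blast
  have "\<Union>F \<subseteq> U" using ab C(1) by (auto simp: F_def)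
  have neg: "negligible (\<Union>p - \<Union>(interior ` p))"
  proof (rule negligible_subset)
    show "negligible (\<Union>X\<in>p. X - interior X)"
    proof (rule negligible_Union[OF finite_imageI[OF fp]], clarify)
      fix X assume "X \<in> p"
      then show "negligible (X - interior X)"
        using int negligible_frontier_interval by metis
    qed
  qed blast
  have mF: "\<Union>F \<in> lmeasurable" unfolding F_def using C(2) by (intro fmeasurable.finite_UN) auto
  have "measure lebesgue K \<le> measure lebesgue (\<Union>F)"
  proof (intro measure_mono_fmeasurable mF)
    show "K \<subseteq> \<Union>F" using C(3) box_subset_cbox unfolding F_def by blast
  qed (use assms(1) lmeasurable_compact in blast)
  also have "\<dots> = measure lebesgue (\<Union>\<A>)"
  proof (rule measure_negligible_symdiff[OF box_family_lmeasurable[OF bf]])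
    show "negligible (\<Union>\<A> - \<Union>F \<union> (\<Union>F - \<Union>\<A>))"
      using neg sub unfolding UA UF by (metis Diff_eq_empty_iff Un_empty_left)
  qed
  finally show ?thesis using that[OF bf] sub \<open>\<Union>F \<subseteq> U\<close> by blast
qed

lemma box_family_uminus:
  assumes "box_family \<A>" shows "box_family ((`) uminus ` \<A>)"
  unfolding box_family_def
proof (intro conjI ballI)
  show "finite ((`) uminus ` \<A>)" using assms by (auto simp: box_family_def)
  show "disjoint ((`) uminus ` \<A>)"
    using assms by (intro disjoint_image) (auto simp: box_family_def inj_on_def)
next
  fix X assume "X \<in> (`) uminus ` \<A>"
  then obtain Y where Y: "Y \<in> \<A>" "X = uminus ` Y" by blast
  show "X \<noteq> {}" using Y box_familyD(1)[OF assms Y(1)] by simp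
  obtain a b where ab: "Y = box a b" using box_familyD(2)[OF assms Y(1)] by blast
  have "X = {x. - x \<in> box a b}" unfolding Y(2) ab(1) by force
  also have "\<dots> = box (- b) (- a)" by (auto simp: mem_box minus_less_iff less_minus_iff)
  finally have "X = box (- b) (- a)" .
  then show "\<exists>a b. X = box a b" by blast
qed

text \<open>
  The Brunn-Minkowski inequality for a set and its reflection, which have equal measure: no set
  has more volume than half its difference body. The thickening by \<open>\<delta>\<close> leaves room for replacing the
  compact set by a family of open boxes.
\<close>

lemma measure_le_symmetrization:
  fixes K T :: "'a::euclidean_space set"
  assumes "compact K" "T \<in> lmeasurable" "0 < \<delta>"
    and T: "\<And>x y z. x \<in> K \<Longrightarrow> y \<in> K \<Longrightarrow> norm z < \<delta> \<Longrightarrow> (1/2) *\<^sub>R (x - y) + z \<in> T"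
  shows "measure lebesgue K \<le> measure lebesgue T"
proof (cases "measure lebesgue K = 0")
  case False
  then have K0: "0 < measure lebesgue K" "K \<noteq> {}"
    using measure_nonneg[of lebesgue K] by (auto simp: less_le)
  define U where "U = (\<Union>x\<in>K. ball x \<delta>)"
  have "open U" "K \<subseteq> U" using assms(3) by (auto simp: U_def)
  then obtain \<A> where \<A>: "box_family \<A>" "\<Union>\<A> \<subseteq> U" "measure lebesgue K \<le> measure lebesgue (\<Union>\<A>)"
    using box_family_between assms(1) K0(2) by metis
  have ne: "\<A> \<noteq> {}" using \<A>(3) K0(1) by auto
  define \<B> where "\<B> = (`) uminus ` \<A>"
  have \<B>: "box_family \<B>" "\<B> \<noteq> {}" using box_family_uminus[OF \<A>(1)] ne by (auto simp: \<B>_def)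
  have UB: "\<Union>\<B> = uminus ` (\<Union>\<A>)" by (auto simp: \<B>_def)
  have mUB: "measure lebesgue (\<Union>\<B>) = measure lebesgue (\<Union>\<A>)"
    unfolding UB using measure_lebesgue_affine[of "-1" 0 "\<Union>\<A>"] by simp
  define S where "S = (\<lambda>x. (1/2) *\<^sub>R x) ` minkowski_sum (\<Union>\<A>) (\<Union>\<B>)"
  have mS: "measure lebesgue S = (1/2) ^ DIM('a) * measure lebesgue (minkowski_sum (\<Union>\<A>) (\<Union>\<B>))"
    using measure_lebesgue_affine[of "1/2" 0 "minkowski_sum (\<Union>\<A>) (\<Union>\<B>)"] by (simp add: S_def)
  have "open S"
    unfolding S_def minkowski_sum_def using box_family_open_bounded(1)[OF \<A>(1)]
    by (intro open_scaling open_sums) auto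
  have "S \<subseteq> T"
  proof
    fix z assume "z \<in> S"
    then obtain v where v: "v \<in> minkowski_sum (\<Union>\<A>) (\<Union>\<B>)" "z = (1/2) *\<^sub>R v"
      unfolding S_def by (rule imageE)
    obtain x y' where "x \<in> \<Union>\<A>" "y' \<in> \<Union>\<B>" "v = x + y'"
      using v(1) unfolding minkowski_sum_iff by (elim bexE)
    moreover obtain y where "y \<in> \<Union>\<A>" "y' = - y"
      using \<open>y' \<in> \<Union>\<B>\<close> unfolding UB by (rule imageE)
    ultimately have xy: "x \<in> \<Union>\<A>" "y \<in> \<Union>\<A>" "z = (1/2) *\<^sub>R (x - y)"
      using v(2) by simp_all
    obtain x' where x': "x' \<in> K" "norm (x - x') < \<delta>"
      using subsetD[OF \<A>(2) xy(1)] unfolding U_def UN_iff mem_ball dist_norm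
      by (metis norm_minus_commute)
    obtain y' where y': "y' \<in> K" "norm (y - y') < \<delta>"
      using subsetD[OF \<A>(2) xy(2)] unfolding U_def UN_iff mem_ball dist_norm
      by (metis norm_minus_commute)
    define w where "w = (1/2) *\<^sub>R ((x - x') - (y - y'))"
    have "norm w < \<delta>"
      using norm_triangle_ineq4[of "x - x'" "y - y'"] x' y' by (simp add: w_def)
    then have "(1/2) *\<^sub>R (x' - y') + w \<in> T" using T x' y' by blast
    moreover have "z = (1/2) *\<^sub>R (x' - y') + w" unfolding xy(3) w_def
      by (simp add: algebra_simps)
    ultimately show "z \<in> T" by simp
  qed
  then have "measure lebesgue S \<le> measure lebesgue T"
    using assms(2) \<open>open S\<close> by (intro measure_mono_fmeasurable) (auto intro: borel_open)
  moreover have "2 ^ DIM('a) * sqrt (measure lebesgue (\<Union>\<A>) * measure lebesgue (\<Union>\<B>))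
    \<le> measure lebesgue (minkowski_sum (\<Union>\<A>) (\<Union>\<B>))"
    using brunn_minkowski_box_families \<A>(1) \<B> ne by blast
  ultimately have "(1/2) ^ DIM('a) * (2 ^ DIM('a) * measure lebesgue (\<Union>\<A>)) \<le> measure lebesgue T"
    unfolding mUB mS by (smt (verit) mult_left_mono real_sqrt_abs2 abs_of_nonneg measure_nonneg zero_le_power divide_nonneg_nonneg)
  then have "measure lebesgue (\<Union>\<A>) \<le> measure lebesgue T"
    by (simp add: power_one_over)
  then show ?thesis using \<A>(3) by simp
qed simp

section \<open>Volumes of cylinders\<close>

text \<open>
  For a unit vector \<open>e\<close>: the axis is spanned by \<open>e\<close>, the radius is \<open>r\<close> and the height is
  \<open>2 * h\<close>.
\<close>

definition cylinder :: "'a::euclidean_space \<Rightarrow> real \<Rightarrow> real \<Rightarrow> 'a set" where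
  "cylinder e r h = {x. norm (x - (x \<bullet> e) *\<^sub>R e) \<le> r \<and> \<bar>x \<bullet> e\<bar> \<le> h}"

lemma norm_perp_sq:
  fixes x e :: "'a::real_inner" assumes "norm e = 1"
  shows "(norm (x - (x \<bullet> e) *\<^sub>R e))\<^sup>2 = (norm x)\<^sup>2 - (x \<bullet> e)\<^sup>2"
proof -
  have "e \<bullet> e = 1" using assms by (simp add: norm_eq_1)
  then show ?thesis
    unfolding power2_norm_eq_inner
    by (simp add: inner_diff_left inner_diff_right inner_commute power2_eq_square)
qed

lemma norm_perp_le:
  fixes x e :: "'a::real_inner" assumes "norm e = 1"
  shows "norm (x - (x \<bullet> e) *\<^sub>R e) \<le> norm x"
proof (rule power2_le_imp_le)
  show "(norm (x - (x \<bullet> e) *\<^sub>R e))\<^sup>2 \<le> (norm x)\<^sup>2" unfolding norm_perp_sq[OF assms] by simp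
qed simp

lemma closed_cylinder: "closed (cylinder e r h)"
  unfolding cylinder_def
  by (intro closed_Collect_conj closed_Collect_le continuous_intros)

lemma compact_cylinder:
  fixes e :: "'a::euclidean_space"
  assumes "norm e = 1" shows "compact (cylinder e r h)"
proof -
  have "norm x \<le> r + h" if "x \<in> cylinder e r h" for x
  proof -
    have "norm x \<le> norm (x - (x \<bullet> e) *\<^sub>R e) + norm ((x \<bullet> e) *\<^sub>R e)"
      by (metis diff_add_cancel norm_triangle_ineq)
    then show ?thesis using that assms by (simp add: cylinder_def)
  qed
  then show ?thesis using closed_cylinder by (auto simp: compact_eq_bounded_closed bounded_iff)
qed

lemma lmeasurable_cylinder:
  fixes e :: "'a::euclidean_space"
  assumes "norm e = 1" shows "cylinder e r h \<in> lmeasurable"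
  using assms compact_cylinder lmeasurable_compact by blast

text \<open>
  Along a coordinate axis the cylinder is the product of a ball in the remaining coordinates
  and an interval, so Fubini applies.
\<close>

lemma measure_cylinder_Basis:
  fixes e :: "'a::euclidean_space"
  assumes e: "e \<in> Basis" and rh: "0 < r" "0 \<le> h"
  shows "measure lebesgue (cylinder e r h) = unit_ball_vol (real (DIM('a) - 1)) * r ^ (DIM('a) - 1) * (2 * h)"
proof -
  define B :: "'a set" where "B = Basis - {e}"
  have B: "finite B" "e \<notin> B" "Basis = insert e B" "card B = DIM('a) - 1"
    using e by (auto simp: B_def card_Diff_singleton)
  interpret product_sigma_finite "\<lambda>_::'a. lborel :: real measure" by standard
  define g :: "('a \<Rightarrow> real) \<Rightarrow> 'a" where "g f = (\<Sum>b\<in>Basis. f b *\<^sub>R b)" for f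
  have g_meas: "g \<in> (\<Pi>\<^sub>M b\<in>Basis. lborel) \<rightarrow>\<^sub>M borel" unfolding g_def by simp
  have ge: "g f \<bullet> b = f b" if "b \<in> Basis" for f b using that by (simp add: g_def)
  have perp: "norm (g f - (g f \<bullet> e) *\<^sub>R e) = sqrt (\<Sum>b\<in>B. (f b)\<^sup>2)" for f
  proof -
    have "(norm (g f - (g f \<bullet> e) *\<^sub>R e))\<^sup>2 = (norm (g f))\<^sup>2 - (g f \<bullet> e)\<^sup>2"
      using e by (intro norm_perp_sq) simp
    also have "(norm (g f))\<^sup>2 = (\<Sum>b\<in>Basis. (f b)\<^sup>2)"
      unfolding power2_norm_eq_inner by (subst euclidean_inner) (simp add: ge power2_eq_square)
    also have "\<dots> = (f e)\<^sup>2 + (\<Sum>b\<in>B. (f b)\<^sup>2)" unfolding B(3) using B(1,2) by simp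
    finally show ?thesis using e by (simp add: ge real_sqrt_unique)
  qed
  have cyl_sets: "cylinder e r h \<in> sets borel" by (rule borel_closed[OF closed_cylinder])
  let ?PB = "\<Pi>\<^sub>M b\<in>B. (lborel :: real measure)"
  let ?S = "{f. sqrt (\<Sum>b\<in>B. (f b)\<^sup>2) \<le> r} \<inter> space ?PB"
  have "emeasure lebesgue (cylinder e r h) = emeasure lborel (cylinder e r h)"
    using cyl_sets by simp
  also have "\<dots> = emeasure (\<Pi>\<^sub>M b\<in>Basis. lborel) (g -` cylinder e r h \<inter> space (\<Pi>\<^sub>M b\<in>Basis. lborel))"
    using g_meas cyl_sets by (subst lborel_eq) (simp add: emeasure_distr g_def[abs_def])
  also have "\<dots> = (\<integral>\<^sup>+f. indicator (g -` cylinder e r h \<inter> space (\<Pi>\<^sub>M b\<in>Basis. lborel)) f \<partial>(\<Pi>\<^sub>M b\<in>Basis. lborel))"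
    using g_meas cyl_sets by (intro nn_integral_indicator[symmetric]) (auto intro: measurable_sets)
  also have "\<dots> = (\<integral>\<^sup>+f. indicator (cylinder e r h) (g f) \<partial>(\<Pi>\<^sub>M b\<in>Basis. lborel))"
    by (intro nn_integral_cong) (auto simp: indicator_def)
  also have "\<dots> = (\<integral>\<^sup>+f. (\<integral>\<^sup>+y. indicator (cylinder e r h) (g (f(e := y))) \<partial>lborel) \<partial>?PB)"
    unfolding B(3) using B(1,2) g_meas cyl_sets
    by (intro product_nn_integral_insert) (auto simp: B(3))
  also have "\<dots> = (\<integral>\<^sup>+f. indicator ?S f * ennreal (2 * h) \<partial>?PB)"
  proof (intro nn_integral_cong)
    fix f assume f: "f \<in> space ?PB"
    have ip: "g (f(e := y)) \<bullet> e = y" for y using e by (simp add: ge)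
    have key: "norm (g (f(e := y)) - y *\<^sub>R e) = sqrt (\<Sum>b\<in>B. (f b)\<^sup>2)" for y
    proof -
      have eq: "(\<Sum>b\<in>B. ((f(e := y)) b)\<^sup>2) = (\<Sum>b\<in>B. (f b)\<^sup>2)" using B(2) by (intro sum.cong) auto
      show ?thesis using perp[of "f(e := y)"] unfolding ip eq .
    qed
    have "indicator (cylinder e r h) (g (f(e := y))) = indicator ?S f * (indicator {-h..h} y :: ennreal)" for y
      unfolding cylinder_def indicator_def mem_Collect_eq key ip using f by auto
    then show "(\<integral>\<^sup>+y. indicator (cylinder e r h) (g (f(e := y))) \<partial>lborel) = indicator ?S f * ennreal (2 * h)"
      using rh by (simp add: nn_integral_cmult)
  qed
  also have "\<dots> = emeasure ?PB ?S * ennreal (2 * h)"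
  proof (subst nn_integral_multc)
    have "?S = {f \<in> space ?PB. sqrt (\<Sum>b\<in>B. (f b)\<^sup>2) \<le> r}" by auto
    then have "?S \<in> sets ?PB" by simp
    then show "(\<lambda>x. indicator ?S x :: ennreal) \<in> borel_measurable ?PB"
      and "integral\<^sup>N ?PB (indicator ?S) * ennreal (2 * h) = emeasure ?PB ?S * ennreal (2 * h)"
      by auto
  qed
  also have "emeasure ?PB ?S = ennreal (unit_ball_vol (real (card B)) * r ^ card B)"
    by (rule emeasure_cball_aux[OF B(1) rh(1)])
  finally have "emeasure lebesgue (cylinder e r h) =
     ennreal (unit_ball_vol (real (DIM('a) - 1)) * r ^ (DIM('a) - 1) * (2 * h))"
    using rh by (simp add: B(4) ennreal_mult[symmetric])
  then show ?thesis using rh by (simp add: measure_def)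
qed

text \<open>
  Invariance of Lebesgue measure under orthogonal maps, in every Euclidean space. Both
  Lebesgue measure and its image under \<open>f\<close> are translation invariant, so integrating
  \<open>A (f x) * B (f x - y)\<close>, with sets written as indicator functions, in both orders shows that
  they are proportional. The unit ball \<open>B\<close>, which \<open>f\<close> preserves, shows that the factor is 1.
\<close>

lemma emeasure_orthogonal_vimage:
  fixes f :: "'a::euclidean_space \<Rightarrow> 'a"
  assumes f: "orthogonal_transformation f" and A: "A \<in> sets borel"
  shows "emeasure lborel (f -` A) = emeasure lborel A"
proof -
  have lin: "linear f" and nf: "\<And>x. norm (f x) = norm x"
    using f by (auto simp: orthogonal_transformation)
  have "continuous_on UNIV f" by (simp add: lin linear_continuous_on linear_linear)
  then have [measurable]: "f \<in> borel_measurable borel" by (rule borel_measurable_continuous_onI)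
  note [measurable] = A
  obtain g where g: "\<And>y. f (g y) = y"
    using orthogonal_transformation_surj[OF f] by (metis surj_f_inv_f)
  define B :: "'a set" where "B = ball 0 1"
  have [measurable]: "B \<in> sets borel" by (simp add: B_def)
  have shift: "(\<integral>\<^sup>+x. h (c + x) \<partial>lborel) = (\<integral>\<^sup>+x. h x \<partial>lborel)"
    if "h \<in> borel_measurable borel" for c :: 'a and h :: "'a \<Rightarrow> ennreal"
    using that by (subst (2) lborel_distr_plus[of c, symmetric]) (simp add: nn_integral_distr)
  have ind: "(\<integral>\<^sup>+x. indicator D (f x) \<partial>lborel) = emeasure lborel (f -` D)" if "D \<in> sets borel" for D
  proof -
    have "f -` D \<in> sets lborel" using that measurable_sets[of f borel borel D] by simp
    moreover have "indicator D (f x) = (indicator (f -` D) x :: ennreal)" for x by (auto simp: indicator_def)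
    ultimately show ?thesis by simp
  qed
  have dist_sym: "indicator B (f x - y) = (indicator (ball (f x) 1) y :: ennreal)" for x y
    by (auto simp: B_def indicator_def dist_norm norm_minus_commute)
  have ball_f: "emeasure lborel (ball (f x) 1) = emeasure lborel B" for x
    unfolding B_def by (simp add: emeasure_ball)
  have "emeasure lborel (f -` A) * emeasure lborel B
      = (\<integral>\<^sup>+x. \<integral>\<^sup>+y. indicator A (f x) * indicator B (f x - y) \<partial>lborel \<partial>lborel)"
  proof -
    have "(\<integral>\<^sup>+y. indicator A (f x) * indicator B (f x - y) \<partial>lborel) = indicator A (f x) * emeasure lborel B" for x
      unfolding dist_sym by (subst nn_integral_cmult) (auto simp: ball_f intro!: borel_measurable_indicator)
    then show ?thesis using ind[OF A] by (simp add: nn_integral_multc)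
  qed
  also have "\<dots> = (\<integral>\<^sup>+y. \<integral>\<^sup>+x. indicator A (f x) * indicator B (f x - y) \<partial>lborel \<partial>lborel)"
    by (rule lborel_pair.Fubini'[symmetric]) measurable
  also have "\<dots> = (\<integral>\<^sup>+y. \<integral>\<^sup>+x. indicator A (f (g y + x)) * indicator B (f (g y + x) - y) \<partial>lborel \<partial>lborel)"
    by (intro nn_integral_cong shift[symmetric]) measurable
  also have "\<dots> = (\<integral>\<^sup>+y. \<integral>\<^sup>+x. indicator A (f x + y) * indicator B (f x) \<partial>lborel \<partial>lborel)"
    by (simp add: linear_add[OF lin] g add.commute)
  also have "\<dots> = (\<integral>\<^sup>+x. \<integral>\<^sup>+y. indicator A (f x + y) * indicator B (f x) \<partial>lborel \<partial>lborel)"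
    by (rule lborel_pair.Fubini') measurable
  also have "\<dots> = (\<integral>\<^sup>+x. emeasure lborel A * indicator B (f x) \<partial>lborel)"
    using shift[of "indicator A"] by (intro nn_integral_cong) (simp add: nn_integral_multc A)
  also have "\<dots> = emeasure lborel A * emeasure lborel B"
  proof -
    have "f -` B = B" by (auto simp: B_def nf)
    then show ?thesis using ind[of B] by (simp add: nn_integral_cmult)
  qed
  finally have eq: "emeasure lborel (f -` A) * emeasure lborel B = emeasure lborel A * emeasure lborel B" .
  have "emeasure lborel B < top" "emeasure lborel B \<noteq> 0"
    unfolding B_def by (auto simp: emeasure_ball less_imp_neq[OF unit_ball_vol_pos, symmetric])
  then show ?thesis using eq by (auto simp: ennreal_mult_cancel_left mult.commute[of _ "emeasure lborel B"])
qed

lemma measure_cylinder: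
  fixes e :: "real ^ 'n"
  assumes e: "norm e = 1" and rh: "0 < r" "0 \<le> h"
  shows "measure lebesgue (cylinder e r h) = unit_ball_vol (real (CARD('n) - 1)) * r ^ (CARD('n) - 1) * (2 * h)"
proof -
  obtain b :: "real ^ 'n" where b: "b \<in> Basis" using nonempty_Basis by blast
  obtain f where f: "orthogonal_transformation f" "f b = e"
    using orthogonal_transformation_exists[of b e] e b by auto
  have inner: "f x \<bullet> f y = x \<bullet> y" for x y using f by (simp add: orthogonal_transformation_def)
  have lin: "linear f" using f by (simp add: orthogonal_transformation_def)
  have nf: "norm (f x) = norm x" for x by (simp add: norm_eq_sqrt_inner inner)
  have eq: "f x - (f x \<bullet> e) *\<^sub>R e = f (x - (x \<bullet> b) *\<^sub>R b)" for x
    using inner[of x b] by (simp add: f(2) linear_diff[OF lin] linear_scale[OF lin])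
  have "f x \<in> cylinder e r h \<longleftrightarrow> x \<in> cylinder b r h" for x
    unfolding cylinder_def mem_Collect_eq eq nf using inner[of x b] by (simp add: f(2))
  then have "f -` cylinder e r h = cylinder b r h" by auto
  then have "emeasure lborel (cylinder e r h) = emeasure lborel (cylinder b r h)"
    using emeasure_orthogonal_vimage[OF f(1) borel_closed[OF closed_cylinder], of e r h] by simp
  then have "measure lebesgue (cylinder e r h) = measure lebesgue (cylinder b r h)"
    using borel_closed[OF closed_cylinder, of e r h] borel_closed[OF closed_cylinder, of b r h]
    by (simp add: measure_def)
  then show ?thesis using measure_cylinder_Basis[OF b rh] by simp
qed

section \<open>The Hausdorff measure of the unit sphere\<close>

text \<open>
  The part of \<open>closure C\<close> on the unit sphere, thickened radially to height \<open>h\<close>. Closing \<open>C\<close>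
  makes the result compact without changing the diameter.
\<close>

definition cone_shell :: "real \<Rightarrow> 'a::euclidean_space set \<Rightarrow> 'a set" where
  "cone_shell h C = (\<lambda>(t, x). t *\<^sub>R x) ` ({1..1 + h} \<times> (closure C \<inter> sphere 0 1))"

lemma cone_shell_iff:
  "p \<in> cone_shell h C \<longleftrightarrow> (\<exists>t x. x \<in> closure C \<and> norm x = 1 \<and> 1 \<le> t \<and> t \<le> 1 + h \<and> p = t *\<^sub>R x)"
proof
  assume "p \<in> cone_shell h C"
  then obtain q where "p = fst q *\<^sub>R snd q" "q \<in> {1..1 + h} \<times> (closure C \<inter> sphere 0 1)"
    unfolding cone_shell_def case_prod_beta by (rule imageE)
  then show "\<exists>t x. x \<in> closure C \<and> norm x = 1 \<and> 1 \<le> t \<and> t \<le> 1 + h \<and> p = t *\<^sub>R x"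
    by (intro exI[of _ "fst q"] exI[of _ "snd q"]) auto
next
  assume "\<exists>t x. x \<in> closure C \<and> norm x = 1 \<and> 1 \<le> t \<and> t \<le> 1 + h \<and> p = t *\<^sub>R x"
  then obtain t x where "x \<in> closure C" "norm x = 1" "1 \<le> t" "t \<le> 1 + h" "p = t *\<^sub>R x"
    by (elim exE conjE)
  then show "p \<in> cone_shell h C"
    unfolding cone_shell_def by (intro image_eqI[of _ _ "(t, x)"]) auto
qed

lemma compact_cone_shell: "bounded C \<Longrightarrow> compact (cone_shell h C)"
  unfolding cone_shell_def case_prod_beta
  by (intro compact_continuous_image compact_Times compact_Int_closed continuous_intros) auto

text \<open>
  Fix a point \<open>e\<close> of the set as axis. The difference of two points of the shell has a component
  orthogonal to \<open>e\<close> of length at most \<open>d * (1 + 2 * h)\<close>, since the two directions differ by at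
  most \<open>d\<close> and each is within \<open>d\<close> of \<open>e\<close>; its component along \<open>e\<close> is at most \<open>h + d^2 / 2\<close>,
  since a unit vector within \<open>d\<close> of \<open>e\<close> has inner product at least \<open>1 - d^2 / 2\<close> with it. So half
  the difference body fits into a cylinder of radius \<open>d / 2 * (1 + 2 * h)\<close> and total height
  \<open>h + d^2 / 2\<close>.
\<close>

lemma measure_cone_shell_le:
  fixes C :: "(real ^ 'n) set"
  assumes C: "bounded C" "diameter C \<le> 1" "C \<noteq> {}" and h: "0 < h"
  shows "measure lebesgue (cone_shell h C) \<le>
    unit_ball_vol (real (CARD('n) - 1)) * (diameter C / 2 * (1 + 2 * h)) ^ (CARD('n) - 1) * (h + (diameter C)\<^sup>2 / 2)"
proof (cases "closure C \<inter> sphere 0 1 = {}")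
  case True
  then have "cone_shell h C = {}" by (simp add: cone_shell_def)
  then show ?thesis using h by (simp add: diameter_ge_0 C(1))
next
  case False
  then obtain e where e: "e \<in> closure C" "norm e = 1" by auto
  define d where "d = diameter C"
  have d0: "0 \<le> d" "d \<le> 1" using C by (auto simp: d_def diameter_ge_0)
  have dist: "norm (x - y) \<le> d" if "x \<in> closure C" "y \<in> closure C" for x y
    using diameter_bounded_bound[of "closure C" x y] that bounded_closure[OF C(1)] C(1) by (simp add: d_def diameter_closure dist_norm)
  define P where "P x = x - (x \<bullet> e) *\<^sub>R e" for x
  have P_le: "norm (P x) \<le> norm x" for x unfolding P_def using e(2) by (rule norm_perp_le)
  have ee: "e \<bullet> e = 1" using e(2) by (simp add: norm_eq_1)
  have P_e: "P e = 0" by (simp add: P_def ee)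
  have P_add: "P (x + y) = P x + P y" for x y by (simp add: P_def inner_add_left scaleR_add_left)
  have P_diff: "P (x - y) = P x - P y" for x y by (simp add: P_def inner_diff_left scaleR_diff_left)
  have P_scale: "P (c *\<^sub>R x) = c *\<^sub>R P x" for c x by (simp add: P_def scaleR_diff_right)
  have main: "(1/2) *\<^sub>R (p - q) + z \<in> cylinder e (d / 2 * (1 + 2 * h) + \<delta>) ((h + d\<^sup>2 / 2) / 2 + \<delta>)"
    if pq: "p \<in> cone_shell h C" "q \<in> cone_shell h C" "norm z < \<delta>" for p q z \<delta>
  proof -
    obtain t x where x: "x \<in> closure C" "norm x = 1" "1 \<le> t" "t \<le> 1 + h" "p = t *\<^sub>R x"
      using pq(1) unfolding cone_shell_iff by (elim exE conjE)
    obtain s y where y: "y \<in> closure C" "norm y = 1" "1 \<le> s" "s \<le> 1 + h" "q = s *\<^sub>R y"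
      using pq(2) unfolding cone_shell_iff by (elim exE conjE)
    have Px: "norm (P v) \<le> d" if "v \<in> closure C" for v
      using P_le[of "v - e"] dist[OF that e(1)] by (simp add: P_diff P_e)
    have dec: "P (p - q) = P (x - y) + (t - 1) *\<^sub>R P x - (s - 1) *\<^sub>R P y"
      by (simp add: x(5) y(5) P_diff P_scale algebra_simps)
    have "norm (P (p - q)) \<le> norm (P (x - y)) + norm ((t - 1) *\<^sub>R P x) + norm ((s - 1) *\<^sub>R P y)"
      unfolding dec by (meson add_mono norm_triangle_ineq norm_triangle_ineq4 order_refl order_trans)
    also have "\<dots> \<le> d + h * d + h * d"
    proof (intro add_mono)
      show "norm (P (x - y)) \<le> d" using P_le[of "x - y"] dist[OF x(1) y(1)] by linarith
      show "norm ((t - 1) *\<^sub>R P x) \<le> h * d" "norm ((s - 1) *\<^sub>R P y) \<le> h * d"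
        using x y Px[OF x(1)] Px[OF y(1)] h by (auto intro!: mult_mono)
    qed
    finally have 1: "norm (P (p - q)) \<le> d * (1 + 2 * h)" by (simp add: algebra_simps)
    have ip: "1 - d\<^sup>2 / 2 \<le> v \<bullet> e" "v \<bullet> e \<le> 1" if "v \<in> closure C" "norm v = 1" for v
    proof -
      have "v \<bullet> v = 1" using that(2) by (simp add: norm_eq_1)
      then have "(norm (v - e))\<^sup>2 = 2 - 2 * (v \<bullet> e)"
        unfolding power2_norm_eq_inner using ee by (simp add: inner_diff_left inner_diff_right inner_commute)
      moreover have "(norm (v - e))\<^sup>2 \<le> d\<^sup>2" using dist[OF that(1) e(1)] by (intro power_mono) auto
      ultimately show "1 - d\<^sup>2 / 2 \<le> v \<bullet> e" by simp
      show "v \<bullet> e \<le> 1" using Cauchy_Schwarz_ineq2[of v e] that(2) e(2) by simp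
    qed
    have d2: "d\<^sup>2 \<le> 1" using d0 by (simp add: power_le_one)
    have pr: "1 - d\<^sup>2 / 2 \<le> t * (v \<bullet> e)" "t * (v \<bullet> e) \<le> 1 + h"
      if "v \<in> closure C" "norm v = 1" "1 \<le> t" "t \<le> 1 + h" for v t
    proof -
      have "1 * (v \<bullet> e) \<le> t * (v \<bullet> e)" using ip[OF that(1,2)] d2 that(3) by (intro mult_right_mono) auto
      then show "1 - d\<^sup>2 / 2 \<le> t * (v \<bullet> e)" using ip[OF that(1,2)] by simp
      have "t * (v \<bullet> e) \<le> t * 1" using ip[OF that(1,2)] that(3) by (intro mult_left_mono) auto
      then show "t * (v \<bullet> e) \<le> 1 + h" using that(4) by simp
    qed
    have 2: "\<bar>(p - q) \<bullet> e\<bar> \<le> h + d\<^sup>2 / 2"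
      using pr[OF x(1-4)] pr[OF y(1-4)] by (simp add: x(5) y(5) inner_diff_left)
    have "norm (P ((1/2) *\<^sub>R (p - q) + z)) \<le> norm (P ((1/2) *\<^sub>R (p - q))) + norm (P z)"
      unfolding P_add by (rule norm_triangle_ineq)
    also have "norm (P ((1/2) *\<^sub>R (p - q))) = norm (P (p - q)) / 2" by (simp add: P_scale)
    also have "norm (P (p - q)) / 2 + norm (P z) \<le> d / 2 * (1 + 2 * h) + \<delta>"
      using 1 P_le[of z] pq(3) by simp
    finally have 3: "norm (P ((1/2) *\<^sub>R (p - q) + z)) \<le> d / 2 * (1 + 2 * h) + \<delta>" .
    have "\<bar>z \<bullet> e\<bar> \<le> \<delta>" using Cauchy_Schwarz_ineq2[of z e] pq(3) e(2) by simp
    moreover have halves: "\<bar>w\<bar> \<le> D / 2 + \<delta>" if "w = u / 2 + v" "\<bar>u\<bar> \<le> D" "\<bar>v\<bar> \<le> \<delta>" for u v w D :: real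
      using that by linarith
    moreover have "((1/2) *\<^sub>R (p - q) + z) \<bullet> e = ((p - q) \<bullet> e) / 2 + z \<bullet> e" by (simp add: inner_add_left)
    ultimately have "\<bar>((1/2) *\<^sub>R (p - q) + z) \<bullet> e\<bar> \<le> (h + d\<^sup>2 / 2) / 2 + \<delta>" using 2 by blast
    then show ?thesis using 3 by (simp add: cylinder_def P_def)
  qed
  let ?\<kappa> = "unit_ball_vol (real (CARD('n) - 1))"
  let ?g = "\<lambda>\<delta>. ?\<kappa> * (d / 2 * (1 + 2 * h) + \<delta>) ^ (CARD('n) - 1) * (2 * ((h + d\<^sup>2 / 2) / 2 + \<delta>))"
  have bound: "measure lebesgue (cone_shell h C) \<le> ?g \<delta>" if "0 < \<delta>" for \<delta>
  proof -
    have r: "0 < d / 2 * (1 + 2 * h) + \<delta>" and l: "0 \<le> (h + d\<^sup>2 / 2) / 2 + \<delta>"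
      using d0(1) h that by (auto intro!: add_nonneg_pos add_nonneg_nonneg mult_nonneg_nonneg)
    have "measure lebesgue (cone_shell h C) \<le>
        measure lebesgue (cylinder e (d / 2 * (1 + 2 * h) + \<delta>) ((h + d\<^sup>2 / 2) / 2 + \<delta>))"
      by (rule measure_le_symmetrization[OF compact_cone_shell[OF C(1)] lmeasurable_cylinder[OF e(2)] that])
        (rule main)
    then show ?thesis unfolding measure_cylinder[OF e(2) r l] .
  qed
  \<comment> \<open>The slack \<open>\<delta>\<close> of the symmetrization is removed in the limit.\<close>
  have "(?g \<longlongrightarrow> ?g 0) (at_right 0)" by (intro tendsto_intros)
  moreover have "eventually (\<lambda>\<delta>. measure lebesgue (cone_shell h C) \<le> ?g \<delta>) (at_right 0)"
    by (rule eventually_mono[OF eventually_at_right_less]) (rule bound)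
  ultimately have "measure lebesgue (cone_shell h C) \<le> ?g 0"
    by (rule tendsto_lowerbound) simp
  then show ?thesis by (simp add: d_def algebra_simps)
qed

lemma measure_shell:
  assumes "0 \<le> a" "a \<le> b"
  shows "measure lebesgue (cball (0 :: 'a::euclidean_space) b - ball 0 a) =
    unit_ball_vol (real DIM('a)) * (b ^ DIM('a) - a ^ DIM('a))"
proof -
  have "ball (0 :: 'a) a \<subseteq> cball 0 b" using assms by auto
  then have "measure lebesgue (cball (0 :: 'a) b - ball 0 a) = measure lebesgue (cball (0 :: 'a) b) - measure lebesgue (ball (0::'a) a)"
    by (intro measurable_measure_Diff) auto
  then show ?thesis using assms by (simp add: content_cball content_ball algebra_simps)
qed

text \<open>
  If sets of diameter at most \<open>h\<close> cover the sphere, their thickenings cover the shell of radii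
  \<open>1\<close> and \<open>1 + h\<close>, whose volume is at least \<open>n * h\<close> times that of the ball. Each thickening has
  at most \<open>h\<close> times the Hausdorff weight of its set, up to a factor that tends to 1 with \<open>h\<close>.
\<close>

lemma sphere_hausdorff_pre_ge:
  fixes h :: real
  assumes h: "0 < h" "h \<le> 1"
  shows "ennreal (real CARD('n) * unit_ball_vol (real CARD('n))) \<le>
    hausdorff_pre (CARD('n) - 1) h (sphere (0 :: real ^ 'n) 1) * ennreal ((1 + 2 * h) ^ (CARD('n) - 1) * (1 + h))"
proof -
  let ?n = "CARD('n)" and ?S = "sphere (0 :: real ^ 'n) 1"
  define K where "K = (1 + 2 * h) ^ (?n - 1) * (1 + h)"
  have K: "0 < K" using h by (simp add: K_def)
  have key: "ennreal (real ?n * unit_ball_vol (real ?n) / K) \<le> (\<Sum>i. hausdorff_weight (?n - 1) (C i))"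
    if C: "?S \<subseteq> (\<Union>i. C i)" "\<And>i. bounded (C i)" "\<And>i. diameter (C i) \<le> h" for C :: "nat \<Rightarrow> (real ^ 'n) set"
  proof -
    have piece: "emeasure lebesgue (cone_shell h (C i)) \<le> ennreal (K * h) * hausdorff_weight (?n - 1) (C i)" for i
    proof (cases "C i = {}")
      case True
      then show ?thesis by (simp add: cone_shell_def hausdorff_weight_def)
    next
      case False
      define d where "d = diameter (C i)"
      have d: "0 \<le> d" "d \<le> h" using C by (auto simp: d_def diameter_ge_0)
      have "measure lebesgue (cone_shell h (C i)) \<le>
          unit_ball_vol (real (?n - 1)) * (d / 2 * (1 + 2 * h)) ^ (?n - 1) * (h + d\<^sup>2 / 2)"
        unfolding d_def using C h False
        by (intro measure_cone_shell_le) (auto intro: order_trans)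
      also have "\<dots> \<le> unit_ball_vol (real (?n - 1)) * (d / 2 * (1 + 2 * h)) ^ (?n - 1) * (h * (1 + h))"
      proof (intro mult_left_mono)
        have "d\<^sup>2 \<le> h\<^sup>2" using d by (intro power_mono) auto
        moreover have "0 \<le> h\<^sup>2" by simp
        ultimately have "h + d\<^sup>2 / 2 \<le> h + h\<^sup>2" by linarith
        then show "h + d\<^sup>2 / 2 \<le> h * (1 + h)" by (simp add: power2_eq_square algebra_simps)
        show "0 \<le> unit_ball_vol (real (?n - 1)) * (d / 2 * (1 + 2 * h)) ^ (?n - 1)"
          using d h by (intro mult_nonneg_nonneg zero_le_power) auto
      qed
      also have "\<dots> = K * h * (unit_ball_vol (real (?n - 1)) * (d / 2) ^ (?n - 1))"
        unfolding K_def power_mult_distrib[of "d / 2" "1 + 2 * h"] by (simp only: mult_ac)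
      finally have "measure lebesgue (cone_shell h (C i)) \<le> K * h * (unit_ball_vol (real (?n - 1)) * (d / 2) ^ (?n - 1))" .
      moreover have "emeasure lebesgue (cone_shell h (C i)) = ennreal (measure lebesgue (cone_shell h (C i)))"
        using lmeasurable_compact[OF compact_cone_shell[OF C(2)]] by (simp add: emeasure_eq_measure2 fmeasurableD2)
      moreover have "ennreal (K * h * (unit_ball_vol (real (?n - 1)) * (d / 2) ^ (?n - 1)))
          = ennreal (K * h) * hausdorff_weight (?n - 1) (C i)"
        using False K h d(1) by (simp add: hausdorff_weight_def d_def[symmetric] ennreal_mult[symmetric])
      ultimately show ?thesis using ennreal_leI by metis
    qed
    have sub: "cball (0 :: real ^ 'n) (1 + h) - ball 0 1 \<subseteq> (\<Union>i. cone_shell h (C i))"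
    proof
      fix x :: "real ^ 'n" assume x: "x \<in> cball 0 (1 + h) - ball 0 1"
      then have nx: "1 \<le> norm x" "norm x \<le> 1 + h" by auto
      define y where "y = (1 / norm x) *\<^sub>R x"
      have y: "norm y = 1" "x = norm x *\<^sub>R y" using nx by (auto simp: y_def)
      then obtain i where "y \<in> C i" using C(1) by fastforce
      then have "y \<in> closure (C i)" using closure_subset by blast
      then have "x \<in> cone_shell h (C i)" unfolding cone_shell_def
        using nx y by (intro image_eqI[of _ _ "(norm x, y)"]) auto
      then show "x \<in> (\<Union>i. cone_shell h (C i))" by blast
    qed
    have "real ?n * h \<le> (1 + h) ^ ?n - 1 ^ ?n" using Bernoulli_inequality[of h ?n] h by simp
    then have "unit_ball_vol (real ?n) * (real ?n * h) \<le> measure lebesgue (cball (0 :: real ^ 'n) (1 + h) - ball 0 1)"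
      using h by (subst measure_shell) (auto intro!: mult_left_mono)
    then have "ennreal (unit_ball_vol (real ?n) * (real ?n * h)) \<le> emeasure lebesgue (cball (0 :: real ^ 'n) (1 + h) - ball 0 1)"
      by (subst emeasure_eq_measure2) (auto intro!: ennreal_leI fmeasurable_Diff)
    also have "\<dots> \<le> emeasure lebesgue (\<Union>i. cone_shell h (C i))"
      by (intro emeasure_mono sub sets.countable_UN) (use lmeasurable_compact[OF compact_cone_shell[OF C(2)]] in auto)
    also have "\<dots> \<le> (\<Sum>i. emeasure lebesgue (cone_shell h (C i)))"
      by (intro emeasure_subadditive_countably) (use lmeasurable_compact[OF compact_cone_shell[OF C(2)]] in auto)
    also have "\<dots> \<le> (\<Sum>i. ennreal (K * h) * hausdorff_weight (?n - 1) (C i))"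
      by (intro suminf_le piece) auto
    also have "\<dots> = ennreal (K * h) * (\<Sum>i. hausdorff_weight (?n - 1) (C i))"
      by simp
    finally have *: "ennreal (unit_ball_vol (real ?n) * (real ?n * h))
      \<le> ennreal (K * h) * (\<Sum>i. hausdorff_weight (?n - 1) (C i))" .
    have "ennreal (1 / (K * h)) * ennreal (unit_ball_vol (real ?n) * (real ?n * h)) \<le>
        ennreal (1 / (K * h)) * (ennreal (K * h) * (\<Sum>i. hausdorff_weight (?n - 1) (C i)))"
      using * by (rule mult_left_mono) simp
    moreover have "ennreal (1 / (K * h)) * ennreal (K * h) = 1"
      using K h by (simp add: ennreal_mult[symmetric])
    moreover have "ennreal (1 / (K * h)) * ennreal (unit_ball_vol (real ?n) * (real ?n * h)) = ennreal (real ?n * unit_ball_vol (real ?n) / K)"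
      using K h by (subst ennreal_mult[symmetric]) (auto simp: field_simps)
    ultimately show ?thesis by (simp add: mult.assoc[symmetric])
  qed
  have "ennreal (real ?n * unit_ball_vol (real ?n) / K) \<le> hausdorff_pre (?n - 1) h ?S"
    unfolding hausdorff_pre_def
  proof (rule INF_greatest)
    fix C :: "nat \<Rightarrow> (real ^ 'n) set"
    assume "C \<in> {C. ?S \<subseteq> (\<Union>i. C i) \<and> (\<forall>i. bounded (C i) \<and> diameter (C i) \<le> h)}"
    then show "ennreal (real ?n * unit_ball_vol (real ?n) / K) \<le> (\<Sum>i. hausdorff_weight (?n - 1) (C i))"
      using key[of C] by blast
  qed
  then have "ennreal (real ?n * unit_ball_vol (real ?n) / K) * ennreal K \<le> hausdorff_pre (?n - 1) h ?S * ennreal K"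
    by (rule mult_right_mono) simp
  moreover have "ennreal (real ?n * unit_ball_vol (real ?n) / K) * ennreal K = ennreal (real ?n * unit_ball_vol (real ?n))"
    using K by (subst ennreal_mult[symmetric]) auto
  ultimately show ?thesis by (simp add: K_def)
qed

text \<open>
  Packing: the disjoint balls of radius \<open>\<delta> / 2\<close> around the points lie in a shell of width \<open>\<delta>\<close>,
  whose volume is of order \<open>\<delta>\<close>.
\<close>

lemma sphere_separated_card_le:
  fixes T :: "'a::euclidean_space set"
  assumes T: "finite T" "T \<subseteq> sphere 0 1" "\<And>x y. x \<in> T \<Longrightarrow> y \<in> T \<Longrightarrow> x \<noteq> y \<Longrightarrow> \<delta> \<le> dist x y"
    and \<delta>: "0 < \<delta>" "\<delta> \<le> 1"
  shows "real (card T) * \<delta> ^ (DIM('a) - 1) \<le> real DIM('a) * 4 ^ DIM('a)"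
proof -
  let ?n = "DIM('a)" and ?\<kappa> = "unit_ball_vol (real DIM('a))"
  have "real (card T) * (?\<kappa> * (\<delta> / 2) ^ ?n) = (\<Sum>x\<in>T. measure lebesgue (ball x (\<delta> / 2)))"
    using \<delta> by (simp add: content_ball)
  also have "\<dots> = measure lebesgue (\<Union>x\<in>T. ball x (\<delta> / 2))"
  proof (rule measure_finite_Union[symmetric, OF T(1)])
    show "disjoint_family_on (\<lambda>x. ball x (\<delta> / 2)) T"
      unfolding disjoint_family_on_def
    proof (intro ballI impI, rule ccontr)
      fix x y assume xy: "x \<in> T" "y \<in> T" "x \<noteq> y" "ball x (\<delta> / 2) \<inter> ball y (\<delta> / 2) \<noteq> {}"
      then obtain z where "dist x z < \<delta> / 2" "dist y z < \<delta> / 2" by auto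
      then have "dist x y < \<delta>" using dist_triangle2[of x y z] by simp
      then show False using T(3)[OF xy(1-3)] by simp
    qed
  qed (use \<delta> in \<open>auto simp: emeasure_ball\<close>)
  also have "\<dots> \<le> measure lebesgue (cball (0 :: 'a) (1 + \<delta> / 2) - ball 0 (1 - \<delta> / 2))"
  proof (rule measure_mono_fmeasurable)
    show "(\<Union>x\<in>T. ball x (\<delta> / 2)) \<subseteq> cball 0 (1 + \<delta> / 2) - ball 0 (1 - \<delta> / 2)"
    proof clarify
      fix x y assume "x \<in> T" and y: "y \<in> ball x (\<delta> / 2)"
      then have "norm x = 1" using T(2) by auto
      then show "y \<in> cball 0 (1 + \<delta> / 2) - ball 0 (1 - \<delta> / 2)"
        using y norm_triangle_ineq3[of x y] by (auto simp: dist_norm abs_le_iff)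
    qed
  qed (use T(1) in \<open>auto intro!: fmeasurable_Diff sets.finite_UN\<close>)
  also have "\<dots> = ?\<kappa> * ((1 + \<delta> / 2) ^ ?n - (1 - \<delta> / 2) ^ ?n)"
    using \<delta> by (intro measure_shell) auto
  finally have 1: "?\<kappa> * (real (card T) * (\<delta> / 2) ^ ?n) \<le> ?\<kappa> * ((1 + \<delta> / 2) ^ ?n - (1 - \<delta> / 2) ^ ?n)"
    by (simp add: algebra_simps)
  have "(1 + \<delta> / 2) ^ ?n - (1 - \<delta> / 2) ^ ?n =
      ((1 + \<delta> / 2) - (1 - \<delta> / 2)) * (\<Sum>i<?n. (1 - \<delta> / 2) ^ (?n - Suc i) * (1 + \<delta> / 2) ^ i)"
    by (rule power_diff_sumr2)
  also have "\<dots> \<le> \<delta> * (\<Sum>i<?n. 2 ^ ?n)"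
  proof -
    have "(1 - \<delta> / 2) ^ (?n - Suc i) * (1 + \<delta> / 2) ^ i \<le> 1 * 2 ^ ?n" if "i < ?n" for i
    proof (rule mult_mono)
      show "(1 - \<delta> / 2) ^ (?n - Suc i) \<le> 1" using \<delta> by (intro power_le_one) auto
      have "(1 + \<delta> / 2) ^ i \<le> 2 ^ i" using \<delta> by (intro power_mono) auto
      also have "\<dots> \<le> (2::real) ^ ?n" using that by (intro power_increasing) auto
      finally show "(1 + \<delta> / 2) ^ i \<le> 2 ^ ?n" .
    qed (use \<delta> in auto)
    then have "(\<Sum>i<?n. (1 - \<delta> / 2) ^ (?n - Suc i) * (1 + \<delta> / 2) ^ i) \<le> (\<Sum>i<?n. 2 ^ ?n)"
      by (intro sum_mono) auto
    then show ?thesis using \<delta> by (auto intro!: mult_mono sum_nonneg)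
  qed
  finally have 2: "(1 + \<delta> / 2) ^ ?n - (1 - \<delta> / 2) ^ ?n \<le> \<delta> * (real ?n * 2 ^ ?n)" by simp
  have \<kappa>: "0 < ?\<kappa>" by simp
  have "real (card T) * (\<delta> / 2) ^ ?n \<le> (1 + \<delta> / 2) ^ ?n - (1 - \<delta> / 2) ^ ?n"
    using 1 \<kappa> mult_le_cancel_left_pos by blast
  then have 3: "real (card T) * (\<delta> / 2) ^ ?n \<le> \<delta> * (real ?n * 2 ^ ?n)" using 2 by linarith
  have "\<delta> ^ ?n = \<delta> * \<delta> ^ (?n - 1)" by (metis DIM_positive power_eq_if less_numeral_extra(3))
  then have "\<delta> * (real (card T) * \<delta> ^ (?n - 1)) = real (card T) * (\<delta> / 2) ^ ?n * 2 ^ ?n"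
    by (simp add: power_divide)
  also have "\<dots> \<le> \<delta> * (real ?n * 2 ^ ?n) * 2 ^ ?n" using 3 by (intro mult_right_mono) auto
  also have "\<dots> = \<delta> * (real ?n * 4 ^ ?n)" by (simp flip: power_mult_distrib)
  finally show ?thesis using \<delta>(1) by simp
qed

text \<open>
  A maximal \<open>\<delta>\<close>-separated set yields a cover by balls of radius \<open>\<delta>\<close>, and the packing bound
  makes the total weight independent of \<open>\<delta>\<close>.
\<close>

lemma sphere_hausdorff_pre_le:
  fixes \<delta> :: real
  assumes \<delta>: "0 < \<delta>" "\<delta> \<le> 1"
  shows "hausdorff_pre (DIM('a) - 1) (2 * \<delta>) (sphere (0 :: 'a::euclidean_space) 1) \<le>
    ennreal (unit_ball_vol (real (DIM('a) - 1)) * (real DIM('a) * 4 ^ DIM('a)))"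
proof -
  let ?n = "DIM('a)" and ?S = "sphere (0 :: 'a) 1"
  define sep where "sep T \<longleftrightarrow> finite T \<and> T \<subseteq> ?S \<and> (\<forall>x\<in>T. \<forall>y\<in>T. x \<noteq> y \<longrightarrow> \<delta> \<le> dist x y)" for T
  have card_le: "real (card T) * \<delta> ^ (?n - 1) \<le> real ?n * 4 ^ ?n" if "sep T" for T
    using that \<delta> by (intro sphere_separated_card_le) (auto simp: sep_def)
  define N where "N = nat \<lceil>real ?n * 4 ^ ?n / \<delta> ^ (?n - 1)\<rceil>"
  have bdd: "card T \<le> N" if "sep T" for T
  proof -
    have "real (card T) \<le> real ?n * 4 ^ ?n / \<delta> ^ (?n - 1)"
      using card_le[OF that] \<delta> by (simp add: field_simps)
    then show ?thesis unfolding N_def by linarith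
  qed
  have "sep {}" by (simp add: sep_def)
  then have "\<exists>T. sep T \<and> (\<forall>T'. sep T' \<longrightarrow> card T' \<le> card T)"
    by (rule ex_has_greatest_nat[of sep "{}" card "Suc N"]) (use bdd in \<open>auto simp: less_Suc_eq_le\<close>)
  then obtain T where T: "sep T" "\<And>T'. sep T' \<Longrightarrow> card T' \<le> card T" by blast
  have fin: "finite T" using T(1) by (simp add: sep_def)
  have cov: "\<exists>y\<in>T. dist y x \<le> \<delta>" if x: "x \<in> ?S" for x
  proof (rule ccontr)
    assume "\<not> ?thesis"
    then have far: "\<And>y. y \<in> T \<Longrightarrow> \<delta> < dist y x" by force
    then have "x \<notin> T" using \<delta>(1) by force
    have "sep (insert x T)" unfolding sep_def
    proof (intro conjI ballI impI)
      fix a b assume "a \<in> insert x T" "b \<in> insert x T" "a \<noteq> b"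
      then show "\<delta> \<le> dist a b"
        using far T(1) by (auto simp: sep_def dist_commute less_imp_le)
    qed (use fin T(1) x in \<open>auto simp: sep_def\<close>)
    then show False using T(2)[of "insert x T"] fin \<open>x \<notin> T\<close> by simp
  qed
  obtain f where f: "bij_betw f {..<card T} T" using ex_bij_betw_nat_finite[OF fin] by (metis atLeast0LessThan)
  define C where "C i = (if i < card T then cball (f i) \<delta> else {})" for i
  have "hausdorff_pre (?n - 1) (2 * \<delta>) ?S \<le> (\<Sum>i. hausdorff_weight (?n - 1) (C i))"
    unfolding hausdorff_pre_def
  proof (rule INF_lower, intro CollectI conjI allI)
    show "?S \<subseteq> (\<Union>i. C i)"
    proof
      fix x :: 'a assume "x \<in> ?S"
      then obtain y where y: "y \<in> T" "dist y x \<le> \<delta>" using cov by blast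
      have "y \<in> f ` {..<card T}" using f y(1) by (simp add: bij_betw_def)
      then obtain i where "y = f i" "i \<in> {..<card T}" by (rule imageE)
      then have "x \<in> C i" using y by (simp add: C_def)
      then show "x \<in> (\<Union>i. C i)" by blast
    qed
  qed (use \<delta> in \<open>auto simp: C_def\<close>)
  also have "\<dots> = (\<Sum>i<card T. hausdorff_weight (?n - 1) (C i))"
    by (intro suminf_finite) (auto simp: C_def hausdorff_weight_def)
  also have "\<dots> = (\<Sum>i<card T. ennreal (unit_ball_vol (real (?n - 1)) * \<delta> ^ (?n - 1)))"
    using \<delta> by (intro sum.cong) (auto simp: C_def hausdorff_weight_def)
  also have "\<dots> = ennreal (unit_ball_vol (real (?n - 1)) * (real (card T) * \<delta> ^ (?n - 1)))"
    using \<delta> by (subst sum_ennreal) (auto simp: algebra_simps)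
  also have "\<dots> \<le> ennreal (unit_ball_vol (real (?n - 1)) * (real ?n * 4 ^ ?n))"
    using card_le[OF T(1)] by (intro ennreal_leI mult_left_mono) auto
  finally show ?thesis .
qed

text \<open>
  The function \<open>measure\<close> assigns 0 to sets of infinite measure; finiteness is therefore what
  turns the lower bound on the outer measure into one on \<open>measure\<close>.
\<close>

lemma hausdorff_sphere_finite:
  "hausdorff_outer (DIM('a) - 1) (sphere (0 :: 'a::euclidean_space) 1) < top"
proof -
  let ?B = "ennreal (unit_ball_vol (real (DIM('a) - 1)) * (real DIM('a) * 4 ^ DIM('a)))"
  have "hausdorff_pre (DIM('a) - 1) \<delta> (sphere (0 :: 'a) 1) \<le> ?B" if "0 < \<delta>" for \<delta>
  proof -
    have "hausdorff_pre (DIM('a) - 1) \<delta> (sphere (0 :: 'a) 1) \<le>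
       hausdorff_pre (DIM('a) - 1) (2 * min (\<delta> / 2) 1) (sphere (0 :: 'a) 1)"
      by (intro hausdorff_pre_antimono) auto
    also have "\<dots> \<le> ?B" using that by (intro sphere_hausdorff_pre_le) auto
    finally show ?thesis .
  qed
  then have "hausdorff_outer (DIM('a) - 1) (sphere (0 :: 'a) 1) \<le> ?B"
    unfolding hausdorff_outer_def by (intro SUP_least) auto
  also have "\<dots> < top" by simp
  finally show ?thesis .
qed

lemma measure_hausdorff_sphere_ge:
  "real CARD('n) * unit_ball_vol (real CARD('n))
    \<le> measure (hausdorff_measure (CARD('n) - 1)) (sphere (0 :: real ^ 'n) 1)"
proof -
  let ?n = "CARD('n)" and ?S = "sphere (0 :: real ^ 'n) 1"
  define H where "H = measure (hausdorff_measure (?n - 1)) ?S"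
  have em: "emeasure (hausdorff_measure (?n - 1)) ?S = hausdorff_outer (?n - 1) ?S"
    by (intro emeasure_hausdorff_measure) auto
  have fin: "hausdorff_outer (?n - 1) ?S < top" using hausdorff_sphere_finite[where 'a = "real ^ 'n"] by simp
  have H: "hausdorff_outer (?n - 1) ?S = ennreal H" "0 \<le> H"
    using emeasure_eq_ennreal_measure[of "hausdorff_measure (?n - 1)" ?S] fin unfolding em H_def by simp_all
  have "real ?n * unit_ball_vol (real ?n) \<le> H * ((1 + 2 * h) ^ (?n - 1) * (1 + h))" if "0 < h" "h < 1" for h
  proof -
    have "ennreal (real ?n * unit_ball_vol (real ?n)) \<le>
        hausdorff_pre (?n - 1) h ?S * ennreal ((1 + 2 * h) ^ (?n - 1) * (1 + h))"
      using that by (intro sphere_hausdorff_pre_ge) auto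
    also have "\<dots> \<le> ennreal H * ennreal ((1 + 2 * h) ^ (?n - 1) * (1 + h))"
      using hausdorff_pre_le_outer[OF that(1), of "?n - 1" ?S] unfolding H(1) by (rule mult_right_mono) simp
    also have "\<dots> = ennreal (H * ((1 + 2 * h) ^ (?n - 1) * (1 + h)))"
      using H(2) that by (simp add: ennreal_mult)
    finally show ?thesis using H(2) that by (subst (asm) ennreal_le_iff) auto
  qed
  then have ev: "eventually (\<lambda>h. real ?n * unit_ball_vol (real ?n) \<le> H * ((1 + 2 * h) ^ (?n - 1) * (1 + h))) (at_right 0)"
    by (auto simp: eventually_at_right_field intro: exI[of _ 1])
  have lim: "((\<lambda>h. H * ((1 + 2 * h) ^ (?n - 1) * (1 + h))) \<longlongrightarrow> H * ((1 + 2 * 0) ^ (?n - 1) * (1 + 0))) (at_right 0)"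
    by (intro tendsto_intros)
  have "real ?n * unit_ball_vol (real ?n) \<le> H * ((1 + 2 * 0) ^ (?n - 1) * (1 + 0))"
    by (rule tendsto_lowerbound[OF lim ev]) simp
  then show ?thesis by (simp add: H_def)
qed

section \<open>The boundary near one of its points\<close>

text \<open>
  The case of radius 0 is included; it is reached as a limit of positive radii.
\<close>

lemma measure_cylinder_le:
  fixes e :: "real ^ 'n"
  assumes e: "norm e = 1" and rh: "0 \<le> r" "0 \<le> h"
  shows "measure lebesgue (cylinder e r h) \<le> unit_ball_vol (real (CARD('n) - 1)) * r ^ (CARD('n) - 1) * (2 * h)"
proof -
  let ?g = "\<lambda>\<delta>. unit_ball_vol (real (CARD('n) - 1)) * (r + \<delta>) ^ (CARD('n) - 1) * (2 * h)"
  have bound: "measure lebesgue (cylinder e r h) \<le> ?g \<delta>" if "0 < \<delta>" for \<delta>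
  proof -
    have "measure lebesgue (cylinder e r h) \<le> measure lebesgue (cylinder e (r + \<delta>) h)"
      using that by (intro measure_mono_fmeasurable lmeasurable_cylinder[OF e] fmeasurableD[OF lmeasurable_cylinder[OF e]])
        (auto simp: cylinder_def)
    then show ?thesis using measure_cylinder[OF e, of "r + \<delta>" h] rh that by simp
  qed
  have lim: "(?g \<longlongrightarrow> ?g 0) (at_right 0)" by (intro tendsto_intros)
  have "eventually (\<lambda>\<delta>. measure lebesgue (cylinder e r h) \<le> ?g \<delta>) (at_right 0)"
    by (rule eventually_mono[OF eventually_at_right_less]) (rule bound)
  from tendsto_lowerbound[OF lim this] show ?thesis by simp
qed

text \<open>
  If the orthogonal projection of \<open>S\<close> covers a disc of radius \<open>\<rho>\<close>, then \<open>S\<close> has Hausdorff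
  measure of order at least \<open>\<rho>^(n-1)\<close>. A set of diameter \<open>\<delta>\<close> projects into a disc of radius
  \<open>\<delta>\<close>, and comparing the volumes of unit-height cylinders over these discs turns the cover into
  an inequality. The factor \<open>2^(n-1)\<close> lost here is harmless.
\<close>

lemma hausdorff_outer_ge_projection:
  fixes S :: "(real ^ 'n) set" and e q :: "real ^ 'n"
  assumes e: "norm e = 1" and q: "q \<bullet> e = 0" and \<rho>: "0 < \<rho>"
    and S: "\<And>y. y \<bullet> e = 0 \<Longrightarrow> norm (y - q) \<le> \<rho> \<Longrightarrow> \<exists>x\<in>S. x - (x \<bullet> e) *\<^sub>R e = y"
  shows "ennreal (unit_ball_vol (real (CARD('n) - 1)) * (\<rho> / 2) ^ (CARD('n) - 1)) \<le> hausdorff_outer (CARD('n) - 1) S"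
proof -
  let ?m = "CARD('n) - 1" and ?\<kappa> = "unit_ball_vol (real (CARD('n) - 1))"
  define P where "P x = x - (x \<bullet> e) *\<^sub>R e" for x
  have ee: "e \<bullet> e = 1" using e by (simp add: norm_eq_1)
  have P_le: "norm (P x) \<le> norm x" for x unfolding P_def using e by (rule norm_perp_le)
  have P_diff: "P (x - y) = P x - P y" for x y by (simp add: P_def inner_diff_left scaleR_diff_left)
  have P_e: "P x \<bullet> e = 0" for x by (simp add: P_def inner_diff_left ee)
  have key: "ennreal (?\<kappa> * (\<rho> / 2) ^ ?m) \<le> (\<Sum>i. hausdorff_weight ?m (C i))"
    if C: "S \<subseteq> (\<Union>i. C i)" "\<And>i. bounded (C i)" for C :: "nat \<Rightarrow> (real ^ 'n) set"
  proof -
    define c where "c i = (SOME x. x \<in> C i)" for i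
    have c: "c i \<in> C i" if "x \<in> C i" for i x unfolding c_def using that by (rule someI)
    define K where "K i = (if C i = {} then {} else (+) (P (c i) - q) ` cylinder e (diameter (C i)) (1 / 2))" for i
    have K_lm: "K i \<in> lmeasurable" for i
      unfolding K_def using compact_cylinder[OF e] by (auto intro!: lmeasurable_compact compact_translation)
    have piece: "emeasure lebesgue (K i) \<le> ennreal (2 ^ ?m) * hausdorff_weight ?m (C i)" for i
    proof (cases "C i = {}")
      case False
      have "measure lebesgue (K i) \<le> ?\<kappa> * diameter (C i) ^ ?m * (2 * (1 / 2))"
        unfolding K_def using False C(2) measure_cylinder_le[OF e, of "diameter (C i)" "1/2"]
        by (simp add: measure_translation diameter_ge_0)
      also have "\<dots> = 2 ^ ?m * (?\<kappa> * (diameter (C i) / 2) ^ ?m)" by (simp add: power_divide)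
      finally have "ennreal (measure lebesgue (K i)) \<le> ennreal (2 ^ ?m) * hausdorff_weight ?m (C i)"
        using False C(2) by (simp add: hausdorff_weight_def ennreal_mult[symmetric] diameter_ge_0 ennreal_leI)
      then show ?thesis using K_lm[of i] by (simp add: emeasure_eq_measure2)
    qed (simp add: K_def)
    have sub: "cylinder e \<rho> (1 / 2) \<subseteq> (\<Union>i. K i)"
    proof
      fix z assume z: "z \<in> cylinder e \<rho> (1 / 2)"
      have "(q + P z) \<bullet> e = 0" using P_e q by (simp add: inner_add_left)
      moreover have "norm ((q + P z) - q) \<le> \<rho>" using z by (simp add: cylinder_def P_def)
      ultimately obtain x where x: "x \<in> S" "P x = q + P z" using S unfolding P_def by blast
      then obtain i where i: "x \<in> C i" using C(1) by blast
      have "norm (P (x - c i)) \<le> diameter (C i)"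
        using P_le[of "x - c i"] diameter_bounded_bound[OF C(2) i c[OF i]] by (simp add: dist_norm)
      moreover have "P (z - (P (c i) - q)) = P (x - c i)"
      proof -
        have "P (P (c i)) = P (c i)" "P q = q"
          unfolding P_def[of "P (c i)"] P_def[of q] using P_e q by simp_all
        then show ?thesis unfolding P_diff x(2) by simp
      qed
      moreover have "(z - (P (c i) - q)) \<bullet> e = z \<bullet> e" using P_e q by (simp add: inner_diff_left)
      moreover have "\<bar>z \<bullet> e\<bar> \<le> 1 / 2" using z by (simp add: cylinder_def)
      ultimately have "z - (P (c i) - q) \<in> cylinder e (diameter (C i)) (1 / 2)"
        unfolding cylinder_def P_def[symmetric] by simp
      then have "z \<in> K i" using i unfolding K_def
        by (auto intro!: image_eqI[of _ _ "z - (P (c i) - q)"])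
      then show "z \<in> (\<Union>i. K i)" by blast
    qed
    have "ennreal (?\<kappa> * \<rho> ^ ?m) = emeasure lebesgue (cylinder e \<rho> (1 / 2))"
      using measure_cylinder[OF e \<rho>, of "1/2"] lmeasurable_cylinder[OF e, of \<rho> "1/2"]
      by (simp add: emeasure_eq_measure2)
    also have "\<dots> \<le> emeasure lebesgue (\<Union>i. K i)"
      by (intro emeasure_mono sub sets.countable_UN) (use K_lm in auto)
    also have "\<dots> \<le> (\<Sum>i. emeasure lebesgue (K i))"
      by (intro emeasure_subadditive_countably) (use K_lm in auto)
    also have "\<dots> \<le> (\<Sum>i. ennreal (2 ^ ?m) * hausdorff_weight ?m (C i))"
      by (intro suminf_le piece) auto
    also have "\<dots> = ennreal (2 ^ ?m) * (\<Sum>i. hausdorff_weight ?m (C i))" by simp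
    finally have *: "ennreal (?\<kappa> * \<rho> ^ ?m) \<le> ennreal (2 ^ ?m) * (\<Sum>i. hausdorff_weight ?m (C i))" .
    have "ennreal (1 / 2 ^ ?m) * ennreal (?\<kappa> * \<rho> ^ ?m)
        \<le> ennreal (1 / 2 ^ ?m) * (ennreal (2 ^ ?m) * (\<Sum>i. hausdorff_weight ?m (C i)))"
      using * by (rule mult_left_mono) simp
    moreover have "ennreal (1 / 2 ^ ?m) * ennreal (2 ^ ?m) = 1"
      by (subst ennreal_mult[symmetric]) auto
    moreover have "ennreal (1 / 2 ^ ?m) * ennreal (?\<kappa> * \<rho> ^ ?m) = ennreal (?\<kappa> * (\<rho> / 2) ^ ?m)"
      using \<rho> by (subst ennreal_mult[symmetric]) (auto simp: power_divide)
    ultimately show ?thesis by (simp add: mult.assoc[symmetric])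
  qed
  have "ennreal (?\<kappa> * (\<rho> / 2) ^ ?m) \<le> hausdorff_pre ?m 1 S"
    unfolding hausdorff_pre_def
  proof (rule INF_greatest)
    fix C :: "nat \<Rightarrow> (real ^ 'n) set"
    assume "C \<in> {C. S \<subseteq> (\<Union>i. C i) \<and> (\<forall>i. bounded (C i) \<and> diameter (C i) \<le> 1)}"
    then show "ennreal (?\<kappa> * (\<rho> / 2) ^ ?m) \<le> (\<Sum>i. hausdorff_weight ?m (C i))"
      using key[of C] by blast
  qed
  also have "\<dots> \<le> hausdorff_outer ?m S" by (rule hausdorff_pre_le_outer) simp
  finally show ?thesis .
qed

text \<open>
  The representation as a graph at a single boundary point. The point lies on the graph itself:
  it is not in the open set, but it is a limit of points above the graph.
\<close>

lemma C1_boundary_graph: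
  fixes \<Omega> :: "'a::euclidean_space set"
  assumes "open \<Omega>" "C1_holder_boundary \<gamma> \<Omega>" "p \<in> frontier \<Omega>"
  shows "\<exists>r e \<phi> G. 0 < r \<and> norm e = 1 \<and> \<phi> (p - (p \<bullet> e) *\<^sub>R e) = p \<bullet> e \<and>
    (\<forall>x\<in>ball p r. x \<in> \<Omega> \<longleftrightarrow> \<phi> (x - (x \<bullet> e) *\<^sub>R e) < x \<bullet> e) \<and>
    (\<phi> has_derivative (\<lambda>h. h \<bullet> G)) (at (p - (p \<bullet> e) *\<^sub>R e) within {y. y \<bullet> e = 0})"
proof -
  obtain r e \<phi> where re: "0 < r" "norm e = 1" "C1_holder_on \<gamma> {y. y \<bullet> e = 0} \<phi>"
      "\<Omega> \<inter> ball p r = {x \<in> ball p r. \<phi> (x - (x \<bullet> e) *\<^sub>R e) < x \<bullet> e}"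
    using bspec[OF assms(2)[unfolded C1_holder_boundary_def] assms(3)] by (elim exE conjE)
  define P where "P x = x - (x \<bullet> e) *\<^sub>R e" for x
  have iff: "x \<in> \<Omega> \<longleftrightarrow> \<phi> (P x) < x \<bullet> e" if "x \<in> ball p r" for x
    using re(4) that unfolding P_def by blast
  have ee: "e \<bullet> e = 1" using re(2) by (simp add: norm_eq_1)
  have P_e: "P x \<bullet> e = 0" for x by (simp add: P_def inner_diff_left ee)
  obtain G where G: "\<And>y. y \<bullet> e = 0 \<Longrightarrow> (\<phi> has_derivative (\<lambda>h. h \<bullet> G y)) (at y within {y. y \<bullet> e = 0})"
    using re(3) unfolding C1_holder_on_def by blast
  have cont: "continuous_on {y. y \<bullet> e = 0} \<phi>"
    unfolding continuous_on_eq_continuous_within using G has_derivative_continuous by blast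
  have contP: "continuous_on UNIV P" unfolding P_def by (intro continuous_intros)
  have "continuous_on UNIV (\<lambda>x. \<phi> (P x))"
    using P_e by (intro continuous_on_compose2[OF cont contP]) auto
  then have g: "continuous_on UNIV (\<lambda>x. x \<bullet> e - \<phi> (P x))" by (intro continuous_intros)
  have "p \<notin> \<Omega>" using assms(1,3) by (simp add: frontier_def interior_open)
  then have le: "p \<bullet> e - \<phi> (P p) \<le> 0" using iff[of p] re(1) by simp
  moreover have "\<not> p \<bullet> e - \<phi> (P p) < 0"
  proof
    assume neg: "p \<bullet> e - \<phi> (P p) < 0"
    define U where "U = {x. x \<bullet> e - \<phi> (P x) < 0} \<inter> ball p r"
    have "open U" unfolding U_def
      by (rule open_Int[OF open_Collect_less[OF g continuous_on_const] open_ball])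
    moreover have "p \<in> U" using neg re(1) by (simp add: U_def)
    moreover have "p \<in> closure \<Omega>" using assms(3) by (simp add: frontier_def)
    ultimately obtain x where "x \<in> U" "x \<in> \<Omega>" using open_Int_closure_eq_empty[of U \<Omega>] by blast
    then show False using iff[of x] by (simp add: U_def)
  qed
  ultimately have "\<phi> (P p) = p \<bullet> e" by simp
  then show ?thesis using re(1,2) iff G[OF P_e, of p] unfolding P_def
    by (intro exI[of _ r] exI[of _ e] exI[of _ \<phi>] exI[of _ "G (p - (p \<bullet> e) *\<^sub>R e)"] conjI ballI)
qed

text \<open>
  Near a boundary point a domain with differentiable boundary lies in a cone about the inner
  normal that is arbitrarily close to a half-space. With \<open>w\<close> the gradient of
  \<open>x \<bullet> e - \<phi> (P x)\<close>, a point \<open>x\<close> of the domain satisfies \<open>0 < (x - p) \<bullet> w + \<epsilon> * |x - p|\<close>, and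
  \<open>|w| \<ge> 1\<close> because \<open>w \<bullet> e = 1\<close>.
\<close>

lemma C1_boundary_cone:
  fixes \<Omega> :: "'a::euclidean_space set"
  assumes "open \<Omega>" "C1_holder_boundary \<gamma> \<Omega>" "p \<in> frontier \<Omega>"
  shows "\<exists>\<nu>. norm \<nu> = 1 \<and>
    (\<forall>\<epsilon>>0. \<exists>R>0. \<forall>x\<in>\<Omega>. norm (x - p) < R \<longrightarrow> - \<epsilon> * norm (x - p) < (x - p) \<bullet> \<nu>)"
proof -
  obtain r e \<phi> G where re: "0 < r" "norm e = 1" "\<phi> (p - (p \<bullet> e) *\<^sub>R e) = p \<bullet> e"
    "\<forall>x\<in>ball p r. x \<in> \<Omega> \<longleftrightarrow> \<phi> (x - (x \<bullet> e) *\<^sub>R e) < x \<bullet> e"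
    "(\<phi> has_derivative (\<lambda>h. h \<bullet> G)) (at (p - (p \<bullet> e) *\<^sub>R e) within {y. y \<bullet> e = 0})"
    using C1_boundary_graph[OF assms] by (elim exE conjE)
  define P where "P x = x - (x \<bullet> e) *\<^sub>R e" for x
  have ee: "e \<bullet> e = 1" using re(2) by (simp add: norm_eq_1)
  have P_le: "norm (P x) \<le> norm x" for x unfolding P_def using re(2) by (rule norm_perp_le)
  have P_diff: "P (x - y) = P x - P y" for x y by (simp add: P_def inner_diff_left scaleR_diff_left)
  have P_e: "P x \<bullet> e = 0" for x by (simp add: P_def inner_diff_left ee)
  define w where "w = e - P G"
  have we: "w \<bullet> e = 1" by (simp add: w_def inner_diff_left P_e ee)
  then have w1: "1 \<le> norm w" using Cauchy_Schwarz_ineq2[of w e] re(2) by simp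
  have PG: "P h \<bullet> G = h \<bullet> P G" for h
    by (simp add: P_def inner_diff_left inner_diff_right inner_commute)
  have alt: "\<forall>e'>0. \<exists>d>0. \<forall>y\<in>{y. y \<bullet> e = 0}. norm (y - P p) < d \<longrightarrow>
      norm (\<phi> y - \<phi> (P p) - (y - P p) \<bullet> G) \<le> e' * norm (y - P p)"
    using re(5) unfolding has_derivative_within_alt P_def[symmetric] by blast
  have "\<exists>R>0. \<forall>x\<in>\<Omega>. norm (x - p) < R \<longrightarrow> - \<epsilon> * norm (x - p) < (x - p) \<bullet> ((1 / norm w) *\<^sub>R w)"
    if \<epsilon>: "0 < \<epsilon>" for \<epsilon>
  proof -
    obtain d where d: "d > 0" "\<And>y. y \<bullet> e = 0 \<Longrightarrow> norm (y - P p) < d \<Longrightarrow>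
        norm (\<phi> y - \<phi> (P p) - (y - P p) \<bullet> G) \<le> \<epsilon> * norm (y - P p)"
      using alt \<epsilon> by blast
    have "- \<epsilon> * norm (x - p) < (x - p) \<bullet> ((1 / norm w) *\<^sub>R w)" if x: "x \<in> \<Omega>" "norm (x - p) < min r d" for x
    proof -
      have "\<phi> (P x) < x \<bullet> e" using bspec[OF re(4), of x] x by (simp add: P_def dist_norm norm_minus_commute)
      moreover have le: "norm (P x - P p) \<le> norm (x - p)" unfolding P_diff[symmetric] by (rule P_le)
      then have "norm (\<phi> (P x) - \<phi> (P p) - (P x - P p) \<bullet> G) \<le> \<epsilon> * norm (P x - P p)"
        using x by (intro d(2) P_e) simp
      moreover have "\<epsilon> * norm (P x - P p) \<le> \<epsilon> * norm (x - p)" using le \<epsilon> by simp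
      moreover have "(P x - P p) \<bullet> G = (x - p) \<bullet> P G" unfolding P_diff[symmetric] by (rule PG)
      moreover have "\<phi> (P p) = p \<bullet> e" using re(3) by (simp add: P_def)
      moreover have "(x - p) \<bullet> w = x \<bullet> e - p \<bullet> e - (x - p) \<bullet> P G"
        by (simp add: w_def inner_diff_left inner_diff_right)
      ultimately have "- (\<epsilon> * norm (x - p)) < (x - p) \<bullet> w" by (simp add: abs_le_iff)
      then have "- (\<epsilon> * norm (x - p)) / norm w < ((x - p) \<bullet> w) / norm w"
        using w1 by (intro divide_strict_right_mono) auto
      moreover have "\<epsilon> * norm (x - p) / norm w \<le> \<epsilon> * norm (x - p) / 1"
        using w1 \<epsilon> by (intro divide_left_mono) auto
      ultimately show ?thesis by simp
    qed
    then show ?thesis using re(1) d(1) by (intro exI[of _ "min r d"]) auto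
  qed
  moreover have "norm ((1 / norm w) *\<^sub>R w) = 1" using w1 by auto
  ultimately show ?thesis by (intro exI[of _ "(1 / norm w) *\<^sub>R w"]) blast
qed

text \<open>
  The boundary contains the graph of \<open>\<phi>\<close> over a disc of radius comparable to \<open>d\<close>, since the
  differentiability of \<open>\<phi>\<close> at one point bounds its growth from there by a constant \<open>M\<close>; the
  projection along \<open>e\<close> maps this graph onto the disc.
\<close>

lemma C1_boundary_hausdorff_lower:
  fixes \<Omega> :: "(real ^ 'n) set"
  assumes "open \<Omega>" "C1_holder_boundary \<gamma> \<Omega>" "p \<in> frontier \<Omega>"
  obtains c d0 where "0 < c" "0 < d0"
    "\<And>d. 0 < d \<Longrightarrow> d < d0 \<Longrightarrow> ennreal (c * d ^ (CARD('n) - 1)) \<le> hausdorff_outer (CARD('n) - 1) (frontier \<Omega> \<inter> ball p d)"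
proof -
  obtain r e \<phi> G where re: "0 < r" "norm e = 1" "\<phi> (p - (p \<bullet> e) *\<^sub>R e) = p \<bullet> e"
    "\<forall>x\<in>ball p r. x \<in> \<Omega> \<longleftrightarrow> \<phi> (x - (x \<bullet> e) *\<^sub>R e) < x \<bullet> e"
    "(\<phi> has_derivative (\<lambda>h. h \<bullet> G)) (at (p - (p \<bullet> e) *\<^sub>R e) within {y. y \<bullet> e = 0})"
    using C1_boundary_graph[OF assms] by (elim exE conjE)
  define P where "P x = x - (x \<bullet> e) *\<^sub>R e" for x
  have ee: "e \<bullet> e = 1" using re(2) by (simp add: norm_eq_1)
  have P_e: "P x \<bullet> e = 0" for x by (simp add: P_def inner_diff_left ee)
  have Pye: "P (y + t *\<^sub>R e) = y" "(y + t *\<^sub>R e) \<bullet> e = t" if "y \<bullet> e = 0" for y t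
    using that by (simp_all add: P_def inner_add_left ee)
  have alt: "\<forall>e'>0. \<exists>d>0. \<forall>y\<in>{y. y \<bullet> e = 0}. norm (y - P p) < d \<longrightarrow>
      norm (\<phi> y - \<phi> (P p) - (y - P p) \<bullet> G) \<le> e' * norm (y - P p)"
    using re(5) unfolding has_derivative_within_alt P_def[symmetric] by blast
  then obtain d1 where d1: "d1 > 0" "\<And>y. y \<bullet> e = 0 \<Longrightarrow> norm (y - P p) < d1 \<Longrightarrow>
        norm (\<phi> y - \<phi> (P p) - (y - P p) \<bullet> G) \<le> 1 * norm (y - P p)"
    using zero_less_one by blast
  define M where "M = norm G + 2"
  have M: "2 \<le> M" by (simp add: M_def)
  have dist_le: "norm (y + \<phi> y *\<^sub>R e - p) \<le> M * norm (y - P p)" if y: "y \<bullet> e = 0" "norm (y - P p) < d1" for y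
  proof -
    have "\<bar>(y - P p) \<bullet> G\<bar> \<le> norm (y - P p) * norm G" by (rule Cauchy_Schwarz_ineq2)
    then have "\<bar>\<phi> y - \<phi> (P p)\<bar> \<le> (norm G + 1) * norm (y - P p)"
      using d1(2)[OF y] by (simp add: algebra_simps)
    moreover have dec: "y + \<phi> y *\<^sub>R e - p = (y - P p) + (\<phi> y - \<phi> (P p)) *\<^sub>R e"
      using re(3) by (simp add: P_def algebra_simps)
    have "norm (y + \<phi> y *\<^sub>R e - p) \<le> norm (y - P p) + \<bar>\<phi> y - \<phi> (P p)\<bar>"
      unfolding dec using norm_triangle_ineq[of "y - P p" "(\<phi> y - \<phi> (P p)) *\<^sub>R e"] re(2) by simp
    ultimately show ?thesis by (simp add: M_def algebra_simps)
  qed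
  let ?\<kappa> = "unit_ball_vol (real (CARD('n) - 1))"
  define c where "c = ?\<kappa> / (4 * M) ^ (CARD('n) - 1)"
  have c0: "0 < c" using M by (simp add: c_def)
  have main: "ennreal (c * d ^ (CARD('n) - 1)) \<le> hausdorff_outer (CARD('n) - 1) (frontier \<Omega> \<inter> ball p d)"
    if d: "0 < d" "d < min r d1" for d
  proof -
    define \<rho> where "\<rho> = d / (2 * M)"
    have \<rho>: "0 < \<rho>" "M * \<rho> < d" "\<rho> < d1"
    proof -
      show "0 < \<rho>" "M * \<rho> < d" using d M by (auto simp: \<rho>_def)
      have "d / (2 * M) \<le> d / 1" using d M by (intro divide_left_mono) auto
      then show "\<rho> < d1" using d by (simp add: \<rho>_def)
    qed
    have "\<exists>x\<in>frontier \<Omega> \<inter> ball p d. x - (x \<bullet> e) *\<^sub>R e = y" if y: "y \<bullet> e = 0" "norm (y - P p) \<le> \<rho>" for y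
    proof -
      define x where "x = y + \<phi> y *\<^sub>R e"
      have "norm (x - p) \<le> M * norm (y - P p)" unfolding x_def using y \<rho> by (intro dist_le) auto
      also have "\<dots> \<le> M * \<rho>" using y M by (intro mult_left_mono) auto
      finally have xd: "norm (x - p) < d" using \<rho> by simp
      have "x \<notin> \<Omega>"
        using bspec[OF re(4), of x] xd d Pye[OF y(1), of "\<phi> y"]
        by (simp add: x_def P_def dist_norm norm_minus_commute)
      moreover have "x \<in> closure \<Omega>" unfolding closure_approachable
      proof (intro allI impI)
        fix \<eta> :: real assume "0 < \<eta>"
        define t where "t = min (\<eta> / 2) (d - norm (x - p))"
        have t: "0 < t" "t < \<eta>" "t \<le> d - norm (x - p)" using \<open>0 < \<eta>\<close> xd by (auto simp: t_def)
        define x' where "x' = y + (\<phi> y + t) *\<^sub>R e"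
        have x': "x' = x + t *\<^sub>R e" by (simp add: x'_def x_def algebra_simps)
        have "norm (x' - p) \<le> norm (x - p) + t"
          unfolding x' using norm_triangle_ineq[of "x - p" "t *\<^sub>R e"] re(2) t(1) by (simp add: algebra_simps)
        then have "x' \<in> ball p r" using t(3) d by (simp add: dist_norm norm_minus_commute)
        then have "x' \<in> \<Omega>"
          using bspec[OF re(4), of x'] Pye[OF y(1), of "\<phi> y + t"] t(1) unfolding P_def[symmetric] x'_def by simp
        moreover have "dist x' x < \<eta>" using re(2) t by (simp add: x' dist_norm)
        ultimately show "\<exists>z\<in>\<Omega>. dist z x < \<eta>" by blast
      qed
      ultimately have "x \<in> frontier \<Omega>" using assms(1) by (simp add: frontier_def interior_open)
      moreover have "x \<in> ball p d" using xd by (simp add: dist_norm norm_minus_commute)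
      moreover have "P x = y" unfolding x_def by (rule Pye(1)[OF y(1)])
      ultimately show ?thesis unfolding P_def by blast
    qed
    then have "ennreal (?\<kappa> * (\<rho> / 2) ^ (CARD('n) - 1)) \<le> hausdorff_outer (CARD('n) - 1) (frontier \<Omega> \<inter> ball p d)"
      by (intro hausdorff_outer_ge_projection[OF re(2) P_e[of p] \<rho>(1)])
    moreover have "?\<kappa> * (\<rho> / 2) ^ (CARD('n) - 1) = c * d ^ (CARD('n) - 1)"
      by (simp add: \<rho>_def c_def power_divide power_mult_distrib)
    ultimately show ?thesis by simp
  qed
  show ?thesis using re(1) d1(1) c0 main by (intro that[of c "min r d1"]) auto
qed

section \<open>Logarithmic bumps\<close>

text \<open>
  The fundamental solution \<open>- ln |x - p|\<close> of the \<open>n\<close>-Laplacian, up to a constant factor, smoothed at scale \<open>d\<close>. Adding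
  \<open>d^2\<close> inside the logarithm gives a function that is smooth on the whole space.
\<close>

definition log_bump :: "'a::real_inner \<Rightarrow> real \<Rightarrow> 'a \<Rightarrow> real" where
  "log_bump p d x = - ln ((norm (x - p))\<^sup>2 + d\<^sup>2) / 2"

definition log_bump_grad :: "'a::real_inner \<Rightarrow> real \<Rightarrow> 'a \<Rightarrow> 'a" where
  "log_bump_grad p d x = - (1 / ((norm (x - p))\<^sup>2 + d\<^sup>2)) *\<^sub>R (x - p)"

lemma log_bump_arg_pos: "0 < d \<Longrightarrow> 0 < (norm (x - p))\<^sup>2 + d\<^sup>2"
  by (intro add_nonneg_pos) auto

lemma GDERIV_log_bump:
  assumes "0 < d" shows "GDERIV (log_bump p d) x :> log_bump_grad p d x"
proof -
  note pos = log_bump_arg_pos[OF assms, of x p]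
  define E where "E = (x - p) \<bullet> (x - p) + d\<^sup>2"
  have E: "0 < E" using pos by (simp add: E_def power2_norm_eq_inner)
  have "((\<lambda>x. (x - p) \<bullet> (x - p) + d\<^sup>2) has_derivative (\<lambda>h. 2 * (h \<bullet> (x - p)))) (at x)"
    by (auto intro!: derivative_eq_intros simp: inner_commute)
  then have D: "GDERIV (\<lambda>x. (x - p) \<bullet> (x - p) + d\<^sup>2) x :> 2 *\<^sub>R (x - p)"
    unfolding gderiv_def by simp
  have "DERIV (\<lambda>y. - ln y / 2) E :> - (1 / E) / 2"
    using E by (auto intro!: derivative_eq_intros)
  from GDERIV_DERIV_compose[OF D, of "\<lambda>y. - ln y / 2", folded E_def, OF this]
  have "GDERIV (\<lambda>x. - ln ((x - p) \<bullet> (x - p) + d\<^sup>2) / 2) x :> (- (1 / E) / 2) *\<^sub>R 2 *\<^sub>R (x - p)" .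
  moreover have "(- (1 / E) / 2) *\<^sub>R 2 *\<^sub>R (x - p) = - (1 / E) *\<^sub>R (x - p)" by simp
  moreover have "- (1 / E) *\<^sub>R (x - p) = log_bump_grad p d x"
    unfolding log_bump_grad_def E_def power2_norm_eq_inner ..
  ultimately show ?thesis unfolding log_bump_def power2_norm_eq_inner by simp
qed

lemma grad_eqI: "GDERIV f x :> D \<Longrightarrow> grad f x = D"
  unfolding grad_def
proof (rule the_equality, assumption)
  fix D' assume D: "GDERIV f x :> D" "GDERIV f x :> D'"
  then have "(\<lambda>h. h \<bullet> D') = (\<lambda>h. h \<bullet> D)"
    unfolding gderiv_def using has_derivative_unique by blast
  then have "(D' - D) \<bullet> D' = (D' - D) \<bullet> D" by meson
  then have "(D' - D) \<bullet> (D' - D) = 0" by (simp add: inner_diff_right)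
  then show "D' = D" by simp
qed

lemma continuous_log_bump: "0 < d \<Longrightarrow> continuous_on S (log_bump p d)"
  unfolding log_bump_def using log_bump_arg_pos[of d _ p]
  by (intro continuous_intros) (auto simp: less_imp_neq[symmetric])

lemma continuous_log_bump_grad: "0 < d \<Longrightarrow> continuous_on S (log_bump_grad p d)"
  unfolding log_bump_grad_def using log_bump_arg_pos[of d _ p]
  by (intro continuous_intros) (auto simp: less_imp_neq[symmetric])

lemma norm_log_bump_grad:
  assumes d: "0 < d"
  shows "norm (log_bump_grad p d x) \<le> 1 / d"
    and "0 < s \<Longrightarrow> s \<le> norm (x - p) \<Longrightarrow> norm (log_bump_grad p d x) \<le> 1 / s"
proof -
  define r where "r = norm (x - p)"
  have r: "0 \<le> r" by (simp add: r_def)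
  have pos: "0 < r\<^sup>2 + d\<^sup>2" unfolding r_def by (rule log_bump_arg_pos[OF d])
  have eq: "norm (log_bump_grad p d x) = r / (r\<^sup>2 + d\<^sup>2)"
    using pos by (simp add: log_bump_grad_def r_def)
  have "0 \<le> (r - d)\<^sup>2" by simp
  then have "2 * (r * d) \<le> r\<^sup>2 + d\<^sup>2" by (simp add: power2_eq_square algebra_simps)
  moreover have "0 \<le> r * d" using r d by simp
  ultimately have "r * d \<le> r\<^sup>2 + d\<^sup>2" by linarith
  then show "norm (log_bump_grad p d x) \<le> 1 / d"
    unfolding eq using pos d by (simp add: field_simps)
  assume s: "0 < s" "s \<le> norm (x - p)"
  then have "r * s \<le> r * r" using r by (intro mult_left_mono) (auto simp: r_def)
  then have "r * s \<le> r\<^sup>2 + d\<^sup>2" using zero_le_power2[of d] unfolding power2_eq_square by linarith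
  then show "norm (log_bump_grad p d x) \<le> 1 / s"
    unfolding eq using pos s(1) by (simp add: field_simps)
qed

lemma log_bump_le: "0 < d \<Longrightarrow> log_bump p d x \<le> ln (1 / d)"
proof -
  assume d: "0 < d"
  have "ln (d\<^sup>2) \<le> ln ((norm (x - p))\<^sup>2 + d\<^sup>2)" using d log_bump_arg_pos[OF d] by (subst ln_le_cancel_iff) auto
  then show ?thesis using d by (simp add: log_bump_def ln_realpow ln_div)
qed

lemma log_bump_le_far:
  assumes "0 < d" "0 < s" "s \<le> norm (x - p)" shows "log_bump p d x \<le> ln (1 / s)"
proof -
  have "s\<^sup>2 \<le> (norm (x - p))\<^sup>2" using assms by (intro power_mono) auto
  then have "s\<^sup>2 \<le> (norm (x - p))\<^sup>2 + d\<^sup>2" using zero_le_power2[of d] by linarith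
  then have "ln (s\<^sup>2) \<le> ln ((norm (x - p))\<^sup>2 + d\<^sup>2)"
    using assms log_bump_arg_pos[OF assms(1)] by (subst ln_le_cancel_iff) auto
  then show ?thesis using assms by (simp add: log_bump_def ln_realpow ln_div)
qed

lemma log_bump_ge_near:
  assumes "0 < d" "norm (x - p) \<le> d" shows "ln (1 / d) - ln 2 / 2 \<le> log_bump p d x"
proof -
  have "(norm (x - p))\<^sup>2 \<le> d\<^sup>2" using assms by (intro power_mono) auto
  then have "ln ((norm (x - p))\<^sup>2 + d\<^sup>2) \<le> ln (2 * d\<^sup>2)"
    using assms log_bump_arg_pos[OF assms(1)] by (subst ln_le_cancel_iff) auto
  then show ?thesis using assms by (simp add: log_bump_def ln_realpow ln_div ln_mult)
qed

section \<open>The energy of logarithmic bumps\<close>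

text \<open>
  For small positive \<open>\<epsilon>\<close> a cone slightly larger than the half-space in direction \<open>\<nu>\<close>.
\<close>

definition wide_cone :: "'a::euclidean_space \<Rightarrow> real \<Rightarrow> 'a set" where
  "wide_cone \<nu> \<epsilon> = {z. - \<epsilon> * norm z < z \<bullet> \<nu>}"

lemma open_wide_cone: "open (wide_cone \<nu> \<epsilon>)"
  unfolding wide_cone_def by (intro open_Collect_less continuous_intros)

lemma lmeasurable_wide_cone_ball: "wide_cone \<nu> \<epsilon> \<inter> ball 0 r \<in> lmeasurable"
  using open_wide_cone by (intro lmeasurable_open bounded_Int open_Int) auto

lemma measure_wide_cone_ball:
  assumes "0 < r"
  shows "measure lebesgue (wide_cone \<nu> \<epsilon> \<inter> ball (0 :: 'a::euclidean_space) r)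
    = r ^ DIM('a) * measure lebesgue (wide_cone \<nu> \<epsilon> \<inter> ball 0 1)"
proof -
  have "wide_cone \<nu> \<epsilon> \<inter> ball (0 :: 'a) r = (\<lambda>x. r *\<^sub>R x + 0) ` (wide_cone \<nu> \<epsilon> \<inter> ball 0 1)"
  proof (intro set_eqI iffI)
    fix z :: 'a assume z: "z \<in> wide_cone \<nu> \<epsilon> \<inter> ball 0 r"
    then have "(- \<epsilon> * norm z) / r < (z \<bullet> \<nu>) / r"
      using assms by (intro divide_strict_right_mono) (auto simp: wide_cone_def)
    then have "(1 / r) *\<^sub>R z \<in> wide_cone \<nu> \<epsilon> \<inter> ball 0 1"
      using z assms by (simp add: wide_cone_def)
    then show "z \<in> (\<lambda>x. r *\<^sub>R x + 0) ` (wide_cone \<nu> \<epsilon> \<inter> ball 0 1)"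
      using assms by (intro image_eqI[of _ _ "(1 / r) *\<^sub>R z"]) auto
  next
    fix z assume "z \<in> (\<lambda>x. r *\<^sub>R x + 0) ` (wide_cone \<nu> \<epsilon> \<inter> ball 0 1)"
    then obtain x where x: "z = r *\<^sub>R x + 0" "x \<in> wide_cone \<nu> \<epsilon> \<inter> ball 0 1" by (rule imageE)
    then have "r * (- \<epsilon> * norm x) < r * (x \<bullet> \<nu>)"
      using assms by (intro mult_strict_left_mono) (auto simp: wide_cone_def)
    then show "z \<in> wide_cone \<nu> \<epsilon> \<inter> ball 0 r" using x assms by (simp add: wide_cone_def mult.left_commute)
  qed
  then show ?thesis using measure_lebesgue_affine[of r 0 "wide_cone \<nu> \<epsilon> \<inter> ball 0 1"] assms by simp
qed

lemma measure_wide_cone_shell: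
  fixes \<nu> :: "'a::euclidean_space"
  assumes "0 < a" "a \<le> b"
  shows "measure lebesgue (wide_cone \<nu> \<epsilon> \<inter> ball 0 b - ball 0 a)
    = measure lebesgue (wide_cone \<nu> \<epsilon> \<inter> ball 0 1) * (b ^ DIM('a) - a ^ DIM('a))"
proof -
  have "wide_cone \<nu> \<epsilon> \<inter> ball 0 b - ball 0 a = (wide_cone \<nu> \<epsilon> \<inter> ball 0 b) - (wide_cone \<nu> \<epsilon> \<inter> ball 0 a)"
    by blast
  moreover have "measure lebesgue ((wide_cone \<nu> \<epsilon> \<inter> ball 0 b) - (wide_cone \<nu> \<epsilon> \<inter> ball 0 a)) =
      measure lebesgue (wide_cone \<nu> \<epsilon> \<inter> ball 0 b) - measure lebesgue (wide_cone \<nu> \<epsilon> \<inter> ball 0 a)"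
    using assms lmeasurable_wide_cone_ball by (intro measurable_measure_Diff) auto
  ultimately show ?thesis
    using assms measure_wide_cone_ball[of a \<nu> \<epsilon>] measure_wide_cone_ball[of b \<nu> \<epsilon>] by (simp add: algebra_simps)
qed

text \<open>
  The excess over the half ball lies in a slab of height \<open>2 * \<epsilon>\<close>, and the half ball has half the
  volume because reflection exchanges the two halves.
\<close>

lemma measure_wide_cone_le:
  fixes \<nu> :: "real ^ 'n"
  assumes \<nu>: "norm \<nu> = 1" and \<epsilon>: "0 < \<epsilon>"
  shows "measure lebesgue (wide_cone \<nu> \<epsilon> \<inter> ball 0 1)
    \<le> unit_ball_vol (real CARD('n)) / 2 + 2 * unit_ball_vol (real (CARD('n) - 1)) * \<epsilon>"
proof -
  define H where "H = {z. 0 < z \<bullet> \<nu>} \<inter> ball (0 :: real ^ 'n) 1"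
  have "open H" unfolding H_def by (intro open_Int open_Collect_less continuous_intros) auto
  then have mH: "H \<in> lmeasurable" by (intro lmeasurable_open) (auto simp: H_def)
  define H' where "H' = (\<lambda>x. (-1) *\<^sub>R x + 0) ` H"
  have H': "H' = {z. z \<bullet> \<nu> < 0} \<inter> ball 0 1"
  proof (intro set_eqI iffI)
    fix z assume "z \<in> {z. z \<bullet> \<nu> < 0} \<inter> ball 0 1"
    then show "z \<in> H'" unfolding H'_def H_def by (intro image_eqI[of _ _ "- z"]) auto
  qed (auto simp: H'_def H_def)
  have "open H'" unfolding H' by (intro open_Int open_Collect_less continuous_intros) auto
  then have mH': "H' \<in> lmeasurable" by (intro lmeasurable_open) (auto simp: H')
  have "measure lebesgue H' = measure lebesgue H"
    unfolding H'_def using measure_lebesgue_affine[of "-1" 0 H] by simp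
  moreover have "measure lebesgue (H \<union> H') = measure lebesgue H + measure lebesgue H'"
    using mH mH' by (intro measure_Un_AE AE_I2) (auto simp: H_def H')
  moreover have "measure lebesgue (H \<union> H') \<le> measure lebesgue (ball (0 :: real ^ 'n) 1)"
    using mH mH' by (intro measure_mono_fmeasurable) (auto simp: H_def H')
  ultimately have half: "measure lebesgue H \<le> unit_ball_vol (real CARD('n)) / 2"
    by (simp add: content_ball)
  have "wide_cone \<nu> \<epsilon> \<inter> ball 0 1 \<subseteq> H \<union> cylinder \<nu> 1 \<epsilon>"
  proof
    fix z assume z: "z \<in> wide_cone \<nu> \<epsilon> \<inter> ball 0 1"
    show "z \<in> H \<union> cylinder \<nu> 1 \<epsilon>"
    proof (cases "0 < z \<bullet> \<nu>")
      case False
      have "\<epsilon> * norm z \<le> \<epsilon> * 1" using z \<epsilon> by (intro mult_left_mono) auto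
      then have "\<bar>z \<bullet> \<nu>\<bar> \<le> \<epsilon>" using z False by (simp add: wide_cone_def)
      moreover have "norm (z - (z \<bullet> \<nu>) *\<^sub>R \<nu>) \<le> 1" using norm_perp_le[OF \<nu>, of z] z by simp
      ultimately show ?thesis by (simp add: cylinder_def)
    qed (use z in \<open>simp add: H_def\<close>)
  qed
  then have "measure lebesgue (wide_cone \<nu> \<epsilon> \<inter> ball 0 1) \<le> measure lebesgue (H \<union> cylinder \<nu> 1 \<epsilon>)"
    using mH lmeasurable_cylinder[OF \<nu>] lmeasurable_wide_cone_ball
    by (intro measure_mono_fmeasurable fmeasurableD[OF lmeasurable_wide_cone_ball]) (auto intro: fmeasurable.Un)
  also have "\<dots> \<le> measure lebesgue H + measure lebesgue (cylinder \<nu> 1 \<epsilon>)"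
    using mH lmeasurable_cylinder[OF \<nu>] by (intro measure_Un_le) auto
  also have "measure lebesgue (cylinder \<nu> 1 \<epsilon>) = unit_ball_vol (real (CARD('n) - 1)) * (2 * \<epsilon>)"
    using measure_cylinder[OF \<nu>, of 1 \<epsilon>] \<epsilon> by simp
  finally show ?thesis using half by simp
qed

lemma geometric_shell_exists:
  fixes q R s :: real
  assumes "q ^ k * R \<le> s" "s < R"
  shows "\<exists>j<k. q ^ Suc j * R \<le> s \<and> s < q ^ j * R"
  using assms
proof (induction k)
  case (Suc k)
  then show ?case by (cases "q ^ k * R \<le> s") (auto simp: less_Suc_eq)
qed simp

text \<open>
  The ball of radius \<open>R\<close> is cut into shells with ratio \<open>q\<close> of radii. On each shell the gradient
  is bounded by the inverse of the inner radius, so by scaling every shell contributes the same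
  amount \<open>V * ((1 / q)^n - 1)\<close>. The part outside the ball and the core of radius \<open>d\<close>
  contribute bounded amounts.
\<close>

lemma log_bump_energy_le:
  fixes \<Omega> :: "'a::euclidean_space set"
  assumes \<Omega>: "open \<Omega>" "bounded \<Omega>" and R: "0 < R" and q: "0 < q" "q < 1"
    and cone: "\<And>x. x \<in> \<Omega> \<Longrightarrow> norm (x - p) < R \<Longrightarrow> x - p \<in> wide_cone \<nu> \<epsilon>"
    and V: "V = measure lebesgue (wide_cone \<nu> \<epsilon> \<inter> ball 0 1)"
    and d: "d = q ^ k * R"
  shows "(LINT x:\<Omega>|lborel. norm (log_bump_grad p d x) ^ DIM('a))
      \<le> measure lebesgue \<Omega> / R ^ DIM('a) + real k * (V * ((1 / q) ^ DIM('a) - 1)) + unit_ball_vol (real DIM('a))"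
proof -
  let ?n = "DIM('a)"
  have d0: "0 < d" using d q R by simp
  define a where "a j = q ^ j * R" for j
  have a0: "0 < a j" for j using q R by (simp add: a_def)
  have a_mono: "a (Suc j) \<le> a j" for j using q R by (simp add: a_def mult_left_le_one_le mult.assoc)
  define S where "S j = (+) p ` (wide_cone \<nu> \<epsilon> \<inter> ball 0 (a j) - ball 0 (a (Suc j)))" for j
  have S_iff: "x \<in> S j \<longleftrightarrow> x - p \<in> wide_cone \<nu> \<epsilon> \<and> norm (x - p) < a j \<and> a (Suc j) \<le> norm (x - p)" for x j
  proof -
    have "x \<in> S j \<longleftrightarrow> x - p \<in> wide_cone \<nu> \<epsilon> \<inter> ball 0 (a j) - ball 0 (a (Suc j))"
      unfolding S_def by (auto intro: image_eqI[of _ _ "x - p"])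
    then show ?thesis by auto
  qed
  have S_borel: "S j \<in> sets borel" for j
  proof -
    have "S j = {x. x - p \<in> wide_cone \<nu> \<epsilon>} \<inter> {x. norm (x - p) < a j} \<inter> {x. a (Suc j) \<le> norm (x - p)}"
      using S_iff by auto
    moreover have "open {x. x - p \<in> wide_cone \<nu> \<epsilon>}"
      unfolding wide_cone_def mem_Collect_eq by (intro open_Collect_less continuous_intros)
    moreover have "open {x. norm (x - p) < a j}" by (intro open_Collect_less continuous_intros)
    moreover have "closed {x. a (Suc j) \<le> norm (x - p)}" by (intro closed_Collect_le continuous_intros)
    ultimately show ?thesis by (auto intro: borel_open borel_closed)
  qed
  have S_bdd: "bounded (S j)" for j
    using S_iff[of _ j] by (intro bounded_subset[OF bounded_ball[of p "a j"]]) (auto simp: dist_norm norm_minus_commute)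
  have S_meas: "measure lborel (S j) = V * (a j ^ ?n - a (Suc j) ^ ?n)" for j
  proof -
    have "measure lborel (S j) = measure lebesgue (S j)" using S_borel[of j] by simp
    also have "\<dots> = measure lebesgue (wide_cone \<nu> \<epsilon> \<inter> ball 0 (a j) - ball 0 (a (Suc j)))"
      unfolding S_def by (rule measure_translation)
    finally show ?thesis unfolding measure_wide_cone_shell[OF a0 a_mono] V .
  qed
  define F where "F x = (1 / R ^ ?n) * indicator \<Omega> x + (\<Sum>j<k. (1 / a (Suc j) ^ ?n) * indicator (S j) x)
      + (1 / d ^ ?n) * indicator (ball p d) x" for x
  have int\<Omega>: "integrable lborel (indicator \<Omega> :: 'a \<Rightarrow> real)"
    using \<Omega>(1) emeasure_bounded_finite[OF \<Omega>(2)] by (intro integrable_real_indicator) auto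
  have intB: "integrable lborel (indicator (ball p d) :: 'a \<Rightarrow> real)"
    using emeasure_bounded_finite[OF bounded_ball] by (intro integrable_real_indicator) auto
  have intS: "integrable lborel (indicator (S j) :: 'a \<Rightarrow> real)" for j
    using S_borel emeasure_bounded_finite[OF S_bdd] by (intro integrable_real_indicator) auto
  have intF: "integrable lborel F"
    unfolding F_def[abs_def] using int\<Omega> intB intS
    by (intro Bochner_Integration.integrable_add Bochner_Integration.integrable_sum integrable_mult_right)
  have nonneg: "0 \<le> (\<Sum>j<k. (1 / a (Suc j) ^ ?n) * indicator (S j) x)" for x
    using a0 by (intro sum_nonneg) (simp add: less_imp_le)
  have le: "norm (log_bump_grad p d x) ^ ?n \<le> F x" if x: "x \<in> \<Omega>" for x
  proof -
    let ?g = "norm (log_bump_grad p d x)" and ?s = "norm (x - p)"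
    consider "R \<le> ?s" | "?s < d" | "d \<le> ?s" "?s < R" by linarith
    then show ?thesis
    proof cases
      case 1
      have "?g ^ ?n \<le> (1 / R) ^ ?n" using norm_log_bump_grad(2)[OF d0 R 1] by (intro power_mono) auto
      also have "\<dots> \<le> F x" using x nonneg[of x] d0 by (simp add: F_def power_one_over indicator_def)
      finally show ?thesis .
    next
      case 2
      have "?g ^ ?n \<le> (1 / d) ^ ?n" using norm_log_bump_grad(1)[OF d0] by (intro power_mono) auto
      also have "\<dots> \<le> F x"
        using 2 nonneg[of x] R by (simp add: F_def power_one_over indicator_def dist_norm norm_minus_commute)
      finally show ?thesis .
    next
      case 3
      then obtain j where j: "j < k" "q ^ Suc j * R \<le> ?s" "?s < q ^ j * R"
        using geometric_shell_exists[of q k R ?s] d by auto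
      then have "x \<in> S j" using S_iff[of x j] cone[OF x 3(2)] by (simp add: a_def)
      have "?g ^ ?n \<le> (1 / a (Suc j)) ^ ?n"
        using norm_log_bump_grad(2)[OF d0 a0[of "Suc j"], of x p] j(2)[folded a_def]
        by (intro power_mono) auto
      also have "\<dots> = (1 / a (Suc j) ^ ?n) * indicator (S j) x" using \<open>x \<in> S j\<close> by (simp add: power_one_over)
      also have "\<dots> \<le> (\<Sum>j<k. (1 / a (Suc j) ^ ?n) * indicator (S j) x)"
        using j(1) a0 by (intro member_le_sum) (auto simp: less_imp_le)
      also have "\<dots> \<le> F x" using R d0 by (simp add: F_def)
      finally show ?thesis .
    qed
  qed
  have F0: "0 \<le> F x" for x using nonneg[of x] R d0 by (simp add: F_def)
  have meas: "(\<lambda>x. indicator \<Omega> x * norm (log_bump_grad p d x) ^ ?n) \<in> borel_measurable lborel"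
  proof -
    have "log_bump_grad p d \<in> borel_measurable borel"
      using continuous_log_bump_grad[OF d0] by (intro borel_measurable_continuous_onI)
    moreover have "\<Omega> \<in> sets borel" using \<Omega>(1) by simp
    ultimately show ?thesis by measurable
  qed
  have le2: "indicator \<Omega> x * norm (log_bump_grad p d x) ^ ?n \<le> F x" for x
    using le[of x] F0[of x] by (cases "x \<in> \<Omega>") auto
  have int: "integrable lborel (\<lambda>x. indicator \<Omega> x * norm (log_bump_grad p d x) ^ ?n)"
    by (rule Bochner_Integration.integrable_bound[OF intF meas]) (use le2 F0 in auto)
  have "(LINT x:\<Omega>|lborel. norm (log_bump_grad p d x) ^ ?n) =
      (\<integral>x. indicator \<Omega> x * norm (log_bump_grad p d x) ^ ?n \<partial>lborel)"
    by (simp add: set_lebesgue_integral_def)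
  also have "\<dots> \<le> integral\<^sup>L lborel F"
    by (rule integral_mono[OF int intF le2])
  also have "\<dots> = (1 / R ^ ?n) * measure lborel \<Omega> + (\<Sum>j<k. (1 / a (Suc j) ^ ?n) * measure lborel (S j))
      + (1 / d ^ ?n) * measure lborel (ball p d)"
    unfolding F_def[abs_def] using int\<Omega> intB intS
    by (simp add: Bochner_Integration.integral_sum)
  also have "(\<Sum>j<k. (1 / a (Suc j) ^ ?n) * measure lborel (S j)) = (\<Sum>j<k. V * ((1 / q) ^ ?n - 1))"
  proof (intro sum.cong refl)
    fix j
    have "a j = a (Suc j) * (1 / q)" using q by (simp add: a_def)
    then have "a j ^ ?n = a (Suc j) ^ ?n * (1 / q) ^ ?n" by (simp only: power_mult_distrib)
    then show "(1 / a (Suc j) ^ ?n) * measure lborel (S j) = V * ((1 / q) ^ ?n - 1)"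
      using a0[of "Suc j"] by (simp add: S_meas right_diff_distrib)
  qed
  also have "\<dots> = real k * (V * ((1 / q) ^ ?n - 1))" by simp
  also have "(1 / d ^ ?n) * measure lborel (ball p d) = unit_ball_vol (real ?n)"
    using d0 by (simp add: content_ball)
  also have "measure lborel \<Omega> = measure lebesgue \<Omega>" using \<Omega>(1) by simp
  finally show "(LINT x:\<Omega>|lborel. norm (log_bump_grad p d x) ^ ?n)
      \<le> measure lebesgue \<Omega> / R ^ ?n + real k * (V * ((1 / q) ^ ?n - 1)) + unit_ball_vol (real ?n)"
    by simp
qed

text \<open>
  The contribution of a shell is compared with \<open>t = ln (1 / q)\<close>, by which \<open>ln (1 / d)\<close> grows from
  one shell to the next: as \<open>((1 / q)^n - 1) / t\<close> tends to \<open>n\<close> for \<open>q\<close> near 1, and \<open>V\<close> is close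
  to half the volume of the ball, both \<open>\<epsilon>\<close> and \<open>q\<close> can be chosen so that the slope stays below
  \<open>A\<close>.
\<close>

lemma log_bump_energy_sequence:
  fixes \<Omega> :: "(real ^ 'n) set"
  assumes \<Omega>: "open \<Omega>" "bounded \<Omega>" "C1_holder_boundary \<gamma> \<Omega>" "p \<in> frontier \<Omega>"
    and A: "real CARD('n) * unit_ball_vol (real CARD('n)) / 2 < A"
  obtains d :: "nat \<Rightarrow> real" where "\<And>k. 0 < d k" "d \<longlonglongrightarrow> 0"
    "\<forall>\<^sub>F k in sequentially. (LINT x:\<Omega>|lborel. norm (log_bump_grad p (d k) x) ^ CARD('n)) \<le> A * ln (1 / d k)"
proof -
  let ?n = "CARD('n)" and ?\<kappa> = "unit_ball_vol (real CARD('n))" and ?\<kappa>' = "unit_ball_vol (real (CARD('n) - 1))"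
  obtain \<nu> where \<nu>: "norm \<nu> = 1"
    "\<forall>\<epsilon>>0. \<exists>R>0. \<forall>x\<in>\<Omega>. norm (x - p) < R \<longrightarrow> - \<epsilon> * norm (x - p) < (x - p) \<bullet> \<nu>"
    using C1_boundary_cone[OF \<Omega>(1,3,4)] by (elim exE conjE)
  have n0: "0 < real ?n" by simp
  have "((\<lambda>\<epsilon>. real ?n * (?\<kappa> / 2 + 2 * ?\<kappa>' * \<epsilon>)) \<longlongrightarrow> real ?n * (?\<kappa> / 2 + 2 * ?\<kappa>' * 0)) (at_right 0)"
    by (intro tendsto_intros)
  then have "\<forall>\<^sub>F \<epsilon> in at_right 0. real ?n * (?\<kappa> / 2 + 2 * ?\<kappa>' * \<epsilon>) < A"
    using A by (intro order_tendstoD(2)) auto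
  then have "\<forall>\<^sub>F \<epsilon> in at_right 0. 0 < \<epsilon> \<and> real ?n * (?\<kappa> / 2 + 2 * ?\<kappa>' * \<epsilon>) < A"
    using eventually_at_right_less[of "0::real"] by eventually_elim auto
  then obtain \<epsilon> where \<epsilon>: "0 < \<epsilon>" "real ?n * (?\<kappa> / 2 + 2 * ?\<kappa>' * \<epsilon>) < A"
    using eventually_happens[of _ "at_right (0::real)"] by auto
  define V where "V = measure lebesgue (wide_cone \<nu> \<epsilon> \<inter> ball 0 1)"
  have V: "V \<le> ?\<kappa> / 2 + 2 * ?\<kappa>' * \<epsilon>" "0 \<le> V"
    unfolding V_def using measure_wide_cone_le[OF \<nu>(1) \<epsilon>(1)] by simp_all
  then have nV: "real ?n * V < A" using \<epsilon>(2) n0 by (smt (verit) mult_left_mono)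
  obtain R where R: "0 < R" "\<forall>x\<in>\<Omega>. norm (x - p) < R \<longrightarrow> - \<epsilon> * norm (x - p) < (x - p) \<bullet> \<nu>"
    using \<nu>(2)[rule_format, OF \<epsilon>(1)] by blast
  have cone: "x - p \<in> wide_cone \<nu> \<epsilon>" if "x \<in> \<Omega>" "norm (x - p) < R" for x
    using R(2) that by (simp add: wide_cone_def)
  \<comment> \<open>The gap between \<open>A'\<close> and \<open>A\<close> absorbs the bounded terms for large \<open>k\<close>.\<close>
  obtain A' where A': "real ?n * V < A'" "A' < A" using nV dense by blast
  have "((\<lambda>t. real ?n * V * exp (real ?n * t)) \<longlongrightarrow> real ?n * V * exp (real ?n * 0)) (at_right 0)"
    by (intro tendsto_intros)
  then have "\<forall>\<^sub>F t in at_right 0. real ?n * V * exp (real ?n * t) < A'"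
    using A' by (intro order_tendstoD(2)) auto
  then have "\<forall>\<^sub>F t in at_right 0. 0 < t \<and> real ?n * V * exp (real ?n * t) < A'"
    using eventually_at_right_less[of "0::real"] by eventually_elim auto
  then obtain t :: real where t: "0 < t" "real ?n * V * exp (real ?n * t) < A'"
    using eventually_happens[of _ "at_right (0::real)"] by auto
  define q where "q = exp (- t)"
  have q: "0 < q" "q < 1" using t by (auto simp: q_def)
  have shell: "V * ((1 / q) ^ ?n - 1) \<le> A' * t"
  proof -
    have "(1 / q) ^ ?n = exp (real ?n * t)" by (simp add: q_def exp_minus exp_of_nat_mult inverse_eq_divide)
    moreover have "exp (real ?n * t) - 1 \<le> exp (real ?n * t) * (real ?n * t)"
    proof -
      have "1 - real ?n * t \<le> exp (- (real ?n * t))" using exp_ge_add_one_self[of "- (real ?n * t)"] by simp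
      then have "exp (real ?n * t) * (1 - real ?n * t) \<le> exp (real ?n * t) * exp (- (real ?n * t))"
        by (intro mult_left_mono) auto
      also have "\<dots> = 1" by (simp add: exp_minus)
      finally show ?thesis by (simp add: algebra_simps)
    qed
    ultimately have "V * ((1 / q) ^ ?n - 1) \<le> V * (exp (real ?n * t) * (real ?n * t))"
      using V(2) by (intro mult_left_mono) auto
    also have "\<dots> = (real ?n * V * exp (real ?n * t)) * t" by (simp add: mult_ac)
    also have "\<dots> \<le> A' * t" using t by (intro mult_right_mono) auto
    finally show ?thesis .
  qed
  define d where "d k = q ^ k * R" for k
  have d0: "0 < d k" for k using q R by (simp add: d_def)
  have d_lim: "d \<longlonglongrightarrow> 0"
    unfolding d_def using q by (intro tendsto_mult_left_zero LIMSEQ_power_zero) auto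
  define C where "C = measure lebesgue \<Omega> / R ^ ?n + ?\<kappa>"
  have energy: "(LINT x:\<Omega>|lborel. norm (log_bump_grad p (d k) x) ^ ?n) \<le> C + real k * (A' * t)" for k
  proof -
    have "(LINT x:\<Omega>|lborel. norm (log_bump_grad p (d k) x) ^ ?n) \<le>
        measure lebesgue \<Omega> / R ^ ?n + real k * (V * ((1 / q) ^ ?n - 1)) + ?\<kappa>"
      using log_bump_energy_le[OF \<Omega>(1,2) R(1) q cone V_def d_def] by simp
    moreover have "real k * (V * ((1 / q) ^ ?n - 1)) \<le> real k * (A' * t)"
      using shell by (intro mult_left_mono) auto
    ultimately show ?thesis by (simp add: C_def)
  qed
  have L: "ln (1 / d k) = real k * t - ln R" for k
    using q R by (simp add: d_def ln_div ln_mult ln_realpow) (simp add: q_def)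
  have gap: "0 < (A - A') * t" using A' t by simp
  have "\<forall>\<^sub>F k in sequentially. C + A * ln R \<le> real k * ((A - A') * t)"
  proof -
    have "filterlim (\<lambda>k. real k * ((A - A') * t)) at_top sequentially"
      by (rule filterlim_at_top_mult_tendsto_pos[OF tendsto_const gap filterlim_real_sequentially])
    then show ?thesis by (simp add: filterlim_at_top)
  qed
  then have "\<forall>\<^sub>F k in sequentially. (LINT x:\<Omega>|lborel. norm (log_bump_grad p (d k) x) ^ ?n) \<le> A * ln (1 / d k)"
  proof eventually_elim
    case (elim k)
    then show ?case using energy[of k] unfolding L by (simp add: algebra_simps)
  qed
  then show ?thesis using that d0 d_lim by blast
qed

lemma measure_bounded_open_pos:
  fixes \<Omega> :: "'a::euclidean_space set"
  assumes "open \<Omega>" "bounded \<Omega>" "\<Omega> \<noteq> {}"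
  shows "0 < measure lborel \<Omega>"
proof -
  obtain x r where x: "x \<in> \<Omega>" "0 < r" "ball x r \<subseteq> \<Omega>" using assms(1,3) open_contains_ball by blast
  have "measure lborel (ball x r) \<le> measure lborel \<Omega>"
    using x(3) assms(1) emeasure_bounded_finite[OF assms(2)]
    by (intro measure_mono_fmeasurable) (auto intro: fmeasurableI)
  then show ?thesis using content_ball_pos[OF x(2), of x] by linarith
qed

text \<open>
  The bump exceeds \<open>ln (1 / \<rho>)\<close> only on the ball of radius \<open>\<rho>\<close>, where it is at most
  \<open>ln (1 / d)\<close>; choosing that ball of small volume makes the mean a small multiple of
  \<open>ln (1 / d)\<close>.
\<close>

lemma log_bump_mean_le:
  fixes \<Omega> :: "'a::euclidean_space set"
  assumes \<Omega>: "open \<Omega>" "bounded \<Omega>" "\<Omega> \<noteq> {}" and \<epsilon>: "0 < \<epsilon>"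
  shows "\<forall>\<^sub>F d in at_right 0. (LINT x:\<Omega>|lborel. log_bump p d x) \<le> \<epsilon> * ln (1 / d) * measure lborel \<Omega>"
proof -
  let ?n = "DIM('a)" and ?\<kappa> = "unit_ball_vol (real DIM('a))"
  define m where "m = measure lborel \<Omega>"
  have int\<Omega>: "integrable lborel (indicator \<Omega> :: 'a \<Rightarrow> real)"
    using \<Omega>(1) emeasure_bounded_finite[OF \<Omega>(2)] by (intro integrable_real_indicator) auto
  have m: "0 < m" unfolding m_def by (rule measure_bounded_open_pos[OF \<Omega>(1-3)])
  have "((\<lambda>\<rho>. ?\<kappa> * \<rho> ^ ?n) \<longlongrightarrow> ?\<kappa> * 0 ^ ?n) (at_right 0)" by (intro tendsto_intros)
  then have "\<forall>\<^sub>F \<rho> in at_right 0. ?\<kappa> * \<rho> ^ ?n < \<epsilon> / 2 * m"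
    using m \<epsilon> by (intro order_tendstoD(2)) (auto simp: zero_power)
  then have "\<forall>\<^sub>F \<rho> in at_right 0. 0 < \<rho> \<and> ?\<kappa> * \<rho> ^ ?n < \<epsilon> / 2 * m"
    using eventually_at_right_less[of "0::real"] by eventually_elim auto
  then obtain \<rho> :: real where \<rho>: "0 < \<rho>" "?\<kappa> * \<rho> ^ ?n < \<epsilon> / 2 * m"
    using eventually_happens[of _ "at_right (0::real)"] by auto
  have bound: "(LINT x:\<Omega>|lborel. log_bump p d x) \<le> \<bar>ln (1 / \<rho>)\<bar> * m + ln (1 / d) * (?\<kappa> * \<rho> ^ ?n)"
    if d: "0 < d" "d < 1" for d
  proof -
    have L0: "0 \<le> ln (1 / d)" using d by simp
    define F where "F x = \<bar>ln (1 / \<rho>)\<bar> * indicator \<Omega> x + ln (1 / d) * indicator (ball p \<rho>) x" for x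
    have intB: "integrable lborel (indicator (ball p \<rho>) :: 'a \<Rightarrow> real)"
      using emeasure_bounded_finite[OF bounded_ball] by (intro integrable_real_indicator) auto
    have intF: "integrable lborel F"
      unfolding F_def[abs_def] using int\<Omega> intB
      by (intro Bochner_Integration.integrable_add integrable_mult_right)
    have F0: "0 \<le> F x" for x using L0 by (simp add: F_def)
    have le: "indicator \<Omega> x *\<^sub>R log_bump p d x \<le> F x" for x
    proof (cases "x \<in> \<Omega>")
      case True
      show ?thesis
      proof (cases "x \<in> ball p \<rho>")
        case True
        then show ?thesis using \<open>x \<in> \<Omega>\<close> log_bump_le[OF d(1), of p x] by (simp add: F_def)
      next
        case False
        then have "log_bump p d x \<le> ln (1 / \<rho>)"
          using log_bump_le_far[OF d(1) \<rho>(1), of x p] by (simp add: dist_norm norm_minus_commute)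
        also have "\<dots> \<le> \<bar>ln (1 / \<rho>)\<bar>" by simp
        finally show ?thesis using \<open>x \<in> \<Omega>\<close> False by (simp add: F_def)
      qed
    qed (use F0 in auto)
    have "(LINT x:\<Omega>|lborel. log_bump p d x) \<le> integral\<^sup>L lborel F"
      unfolding set_lebesgue_integral_def by (intro integral_mono' intF le F0)
    also have "\<dots> = \<bar>ln (1 / \<rho>)\<bar> * m + ln (1 / d) * measure lborel (ball p \<rho>)"
      unfolding F_def[abs_def] m_def using int\<Omega> intB by simp
    finally show ?thesis using \<rho>(1) by (simp add: content_ball)
  qed
  have "filterlim (\<lambda>d::real. ln (1 / d)) at_top (at_right 0)"
    using filterlim_compose[OF ln_at_top filterlim_inverse_at_top_right] by (simp add: inverse_eq_divide)
  then have "\<forall>\<^sub>F d in at_right 0. 2 / \<epsilon> * \<bar>ln (1 / \<rho>)\<bar> \<le> ln (1 / d)"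
    by (simp add: filterlim_at_top)
  moreover have "\<forall>\<^sub>F d in at_right (0::real). 0 < d \<and> d < 1"
    by (auto simp: eventually_at_right_field intro: exI[of _ 1])
  ultimately show ?thesis
  proof eventually_elim
    case (elim d)
    then have L: "\<bar>ln (1 / \<rho>)\<bar> \<le> \<epsilon> / 2 * ln (1 / d)" "0 \<le> ln (1 / d)"
      using \<epsilon> by (auto simp: field_simps)
    have "(LINT x:\<Omega>|lborel. log_bump p d x) \<le> \<bar>ln (1 / \<rho>)\<bar> * m + ln (1 / d) * (?\<kappa> * \<rho> ^ ?n)"
      using bound elim by blast
    also have "\<dots> \<le> (\<epsilon> / 2 * ln (1 / d)) * m + ln (1 / d) * (\<epsilon> / 2 * m)"
      using L m \<rho>(2) by (intro add_mono mult_right_mono mult_left_mono) auto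
    also have "\<dots> = \<epsilon> * ln (1 / d) * measure lborel \<Omega>" by (simp add: m_def)
    finally show ?case .
  qed
qed

section \<open>The extremal sequence\<close>

text \<open>
  Here \<open>K\<close> is the classical area of the sphere and \<open>S\<close> its Hausdorff measure. The strict
  inequality for \<open>\<alpha>\<close> leaves room for an energy constant \<open>A\<close> above \<open>K / 2\<close> and for a relative loss
  \<open>\<delta>\<close> in the size of the functions.
\<close>

lemma supercritical_parameters:
  fixes n :: nat and \<alpha> S K :: real
  assumes n: "2 \<le> n" and K: "0 < K" "K \<le> S"
    and \<alpha>: "(real n - 1) * (S / 2) powr (1 / (real n - 1)) < \<alpha>"
  obtains A \<delta> where "K / 2 < A" "0 < \<delta>" "\<delta> < 1"
    "real n - 1 < \<alpha> * (1 - \<delta>) powr (real n / (real n - 1)) / A powr (1 / (real n - 1))"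
proof -
  define s where "s = real n / (real n - 1)"
  define t where "t = 1 / (real n - 1)"
  have n1: "0 < real n - 1" using n by simp
  have t0: "0 < t" using n1 by (simp add: t_def)
  have "(K / 2) powr t \<le> (S / 2) powr t" using K t0 by (intro powr_mono2) auto
  then have "(real n - 1) * (K / 2) powr t \<le> (real n - 1) * (S / 2) powr t"
    using n1 by (intro mult_left_mono) auto
  then have \<alpha>K: "(real n - 1) * (K / 2) powr t < \<alpha>" using \<alpha> by (simp add: t_def)
  have Kt: "0 < (K / 2) powr t" using K by simp
  let ?h = "\<lambda>\<delta>. \<alpha> * (1 - \<delta>) powr s / ((1 + \<delta>) * (K / 2)) powr t"
  have lim: "(?h \<longlongrightarrow> \<alpha> * (1 - 0) powr s / ((1 + 0) * (K / 2)) powr t) (at_right 0)"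
    using K by (intro tendsto_intros) auto
  have "real n - 1 < \<alpha> * (1 - 0) powr s / ((1 + 0) * (K / 2)) powr t"
    using \<alpha>K Kt by (simp add: field_simps)
  then have "\<forall>\<^sub>F \<delta> in at_right 0. real n - 1 < ?h \<delta>" by (rule order_tendstoD(1)[OF lim])
  moreover have "\<forall>\<^sub>F \<delta> in at_right (0::real). 0 < \<delta> \<and> \<delta> < 1"
    by (auto simp: eventually_at_right_field intro: exI[of _ 1])
  ultimately have "\<forall>\<^sub>F \<delta> in at_right 0. 0 < \<delta> \<and> \<delta> < 1 \<and> real n - 1 < ?h \<delta>"
    by eventually_elim auto
  then obtain \<delta> where \<delta>: "0 < \<delta>" "\<delta> < 1" "real n - 1 < ?h \<delta>"
    using eventually_happens[of _ "at_right (0::real)"] by auto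
  have "K / 2 < (1 + \<delta>) * (K / 2)" using K \<delta> by simp
  then show ?thesis using \<delta> that[of "(1 + \<delta>) * (K / 2)" \<delta>] unfolding s_def t_def by blast
qed

definition normalized_log_bump :: "'a::euclidean_space set \<Rightarrow> 'a \<Rightarrow> real \<Rightarrow> real \<Rightarrow> 'a \<Rightarrow> real" where
  "normalized_log_bump \<Omega> p c d x =
     (log_bump p d x - (LINT y:\<Omega>|lborel. log_bump p d y) / measure lborel \<Omega>) / c"

lemma GDERIV_normalized_log_bump:
  assumes "0 < d"
  shows "GDERIV (normalized_log_bump \<Omega> p c d) x :> (1 / c) *\<^sub>R log_bump_grad p d x"
proof -
  define m where "m = (LINT y:\<Omega>|lborel. log_bump p d y) / measure lborel \<Omega>"
  have "(log_bump p d has_derivative (\<lambda>h. h \<bullet> log_bump_grad p d x)) (at x)"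
    using GDERIV_log_bump[OF assms, of p x] by (simp add: gderiv_def)
  then have "((\<lambda>x. (1 / c) * (log_bump p d x - m)) has_derivative (\<lambda>h. (1 / c) * (h \<bullet> log_bump_grad p d x - 0))) (at x)"
    by (intro has_derivative_mult_right has_derivative_diff has_derivative_const)
  then show ?thesis unfolding gderiv_def normalized_log_bump_def[abs_def] m_def by simp
qed

lemma C1_on_closure_normalized_log_bump:
  assumes "0 < d"
  shows "C1_on_closure \<Omega> (normalized_log_bump \<Omega> p c d)"
    and "continuous_on S (normalized_log_bump \<Omega> p c d)"
proof -
  have cont: "continuous_on S (normalized_log_bump \<Omega> p c d)" for S
    using GDERIV_normalized_log_bump[OF assms] unfolding gderiv_def
    by (meson continuous_at_imp_continuous_on has_derivative_continuous)
  show "continuous_on S (normalized_log_bump \<Omega> p c d)" by (rule cont)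
  have "continuous_on (closure \<Omega>) (\<lambda>x. (1 / c) *\<^sub>R log_bump_grad p d x)"
    by (intro continuous_on_scaleR continuous_on_const continuous_log_bump_grad assms)
  then show "C1_on_closure \<Omega> (normalized_log_bump \<Omega> p c d)"
    unfolding C1_on_closure_def using cont[of "closure \<Omega>"] GDERIV_normalized_log_bump[OF assms] by blast
qed

lemma normalized_log_bump_mean_zero:
  fixes \<Omega> :: "'a::euclidean_space set"
  assumes \<Omega>: "open \<Omega>" "bounded \<Omega>" "\<Omega> \<noteq> {}" and d: "0 < d"
  shows "(LINT x:\<Omega>|lborel. normalized_log_bump \<Omega> p c d x) = 0"
proof -
  define m where "m = (LINT y:\<Omega>|lborel. log_bump p d y) / measure lborel \<Omega>"
  have "compact (closure \<Omega>)" using \<Omega>(2) by simp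
  then have si: "set_integrable lborel (closure \<Omega>) (log_bump p d)"
    using continuous_log_bump[OF d] by (intro borel_integrable_compact[unfolded set_integrable_def[symmetric]])
  have int: "set_integrable lborel \<Omega> (log_bump p d)"
    by (rule set_integrable_subset[OF si]) (use \<Omega>(1) closure_subset in auto)
  have intc: "set_integrable lborel \<Omega> (\<lambda>_. m)"
    using \<Omega>(1) emeasure_bounded_finite[OF \<Omega>(2)] unfolding set_integrable_def
    by (intro integrable_scaleR_left integrable_real_indicator) auto
  have "(LINT x:\<Omega>|lborel. normalized_log_bump \<Omega> p c d x) =
      (LINT x:\<Omega>|lborel. log_bump p d x - m) / c"
    unfolding normalized_log_bump_def m_def[symmetric] by simp
  also have "(LINT x:\<Omega>|lborel. log_bump p d x - m) = (LINT x:\<Omega>|lborel. log_bump p d x) - (LINT x:\<Omega>|lborel. m)"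
    by (rule set_integral_diff(2)[OF int intc])
  also have "(LINT x:\<Omega>|lborel. m) = measure lborel \<Omega> * m"
    using \<Omega>(1) emeasure_bounded_finite[OF \<Omega>(2)]
    by (simp add: set_lebesgue_integral_def)
  also have "(LINT x:\<Omega>|lborel. log_bump p d x) - measure lborel \<Omega> * m = 0"
    using measure_bounded_open_pos[OF \<Omega>] by (simp add: m_def)
  finally show ?thesis by simp
qed

lemma normalized_log_bump_energy_le_1:
  fixes \<Omega> :: "'a::euclidean_space set"
  assumes d: "0 < d" and E: "0 < E" "(LINT x:\<Omega>|lborel. norm (log_bump_grad p d x) ^ DIM('a)) \<le> E"
  shows "(LINT x:\<Omega>|lborel. norm (grad (normalized_log_bump \<Omega> p (E powr (1 / real DIM('a))) d) x) ^ DIM('a)) powr (1 / real DIM('a)) \<le> 1"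
proof -
  let ?n = "DIM('a)"
  define c where "c = E powr (1 / real ?n)"
  have c: "0 < c" "c ^ ?n = E" using E(1) by (simp_all add: c_def powr_power)
  have "norm (grad (normalized_log_bump \<Omega> p c d) x) ^ ?n = norm (log_bump_grad p d x) ^ ?n / E" for x
    unfolding grad_eqI[OF GDERIV_normalized_log_bump[OF d]] using c by (simp add: power_divide)
  then have eq: "(LINT x:\<Omega>|lborel. norm (grad (normalized_log_bump \<Omega> p c d) x) ^ ?n)
      = (LINT x:\<Omega>|lborel. norm (log_bump_grad p d x) ^ ?n) / E" by simp
  have "0 \<le> (LINT x:\<Omega>|lborel. norm (log_bump_grad p d x) ^ ?n)"
    unfolding set_lebesgue_integral_def by (intro integral_nonneg_AE AE_I2) simp
  then show ?thesis unfolding c_def[symmetric] eq using E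
    by (intro powr_le1) auto
qed

text \<open>
  The powers of \<open>L\<close> combine to \<open>L^1\<close>, as \<open>n/(n-1) - 1/(n-1) = 1\<close>. Half of the loss \<open>\<delta>\<close> pays for
  the mean and the other half for the constant \<open>ln 2 / 2\<close> by which the bump falls short of
  \<open>ln (1 / d)\<close> at distance \<open>d\<close>.
\<close>

lemma normalized_log_bump_exponent:
  fixes x p :: "'a::euclidean_space"
  assumes n: "2 \<le> n" and d: "0 < d" and x: "norm (x - p) \<le> d" and \<delta>: "0 < \<delta>" "\<delta> < 1" and A: "0 < A"
    and L: "L = ln (1 / d)" "0 < L" "ln 2 / 2 \<le> \<delta> / 2 * L" and \<alpha>: "0 \<le> \<alpha>"
    and mean: "(LINT y:\<Omega>|lborel. log_bump p d y) / measure lborel \<Omega> \<le> \<delta> / 2 * L"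
  shows "\<alpha> * (1 - \<delta>) powr (real n / (real n - 1)) / A powr (1 / (real n - 1)) * L
    \<le> \<alpha> * \<bar>normalized_log_bump \<Omega> p ((A * L) powr (1 / real n)) d x\<bar> powr (real n / (real n - 1))"
proof -
  define s where "s = real n / (real n - 1)"
  have n1: "0 < real n - 1" using n by simp
  have s: "0 < s" "s = 1 + 1 / (real n - 1)" "(1 / real n) * s = 1 / (real n - 1)"
    using n1 by (auto simp: s_def field_simps)
  let ?c = "(A * L) powr (1 / real n)"
  have c: "0 < ?c" using A L(2) by simp
  have "(1 - \<delta>) * L \<le> log_bump p d x - (LINT y:\<Omega>|lborel. log_bump p d y) / measure lborel \<Omega>"
    using log_bump_ge_near[OF d x] mean L(3) unfolding L(1)[symmetric] by (simp add: algebra_simps)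
  then have "(1 - \<delta>) * L / ?c \<le> normalized_log_bump \<Omega> p ?c d x"
    unfolding normalized_log_bump_def using c by (intro divide_right_mono) auto
  moreover have pos: "0 \<le> (1 - \<delta>) * L / ?c" using \<delta> L(2) c by simp
  ultimately have "((1 - \<delta>) * L / ?c) powr s \<le> \<bar>normalized_log_bump \<Omega> p ?c d x\<bar> powr s"
    using s(1) by (intro powr_mono2) auto
  also have "((1 - \<delta>) * L / ?c) powr s = (1 - \<delta>) powr s * L powr s / (?c powr s)"
    using \<delta> L(2) c by (simp add: powr_divide powr_mult)
  also have "?c powr s = A powr (1 / (real n - 1)) * L powr (1 / (real n - 1))"
    unfolding powr_powr s(3) using A L(2) by (simp add: powr_mult)
  also have "L powr s = L * L powr (1 / (real n - 1))"
    using L(2) by (simp add: s(2) powr_add)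
  finally have "(1 - \<delta>) powr s / A powr (1 / (real n - 1)) * L \<le> \<bar>normalized_log_bump \<Omega> p ?c d x\<bar> powr s"
    using L(2) by simp
  then have "\<alpha> * ((1 - \<delta>) powr s / A powr (1 / (real n - 1)) * L) \<le> \<alpha> * \<bar>normalized_log_bump \<Omega> p ?c d x\<bar> powr s"
    using \<alpha> by (rule mult_left_mono)
  then show ?thesis by (simp add: s_def mult.assoc)
qed

lemma filterlim_powr_neg_at_top:
  fixes e :: real assumes "0 < e" "0 < c"
  shows "filterlim (\<lambda>d. c * d powr (- e)) at_top (at_right 0)"
proof -
  have "filterlim (\<lambda>d::real. e * ln (inverse d)) at_top (at_right 0)"
    by (rule filterlim_tendsto_pos_mult_at_top[OF tendsto_const assms(1)])
      (rule filterlim_compose[OF ln_at_top filterlim_inverse_at_top_right])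
  then have lim: "filterlim (\<lambda>d::real. c * exp (e * ln (inverse d))) at_top (at_right 0)"
    by (intro filterlim_tendsto_pos_mult_at_top[OF tendsto_const assms(2)] filterlim_compose[OF exp_at_top])
  have ev: "\<forall>\<^sub>F d in at_right (0::real). c * exp (e * ln (inverse d)) = c * d powr (- e)"
    using eventually_at_right_less[of "0::real"] by eventually_elim (simp add: powr_def ln_inverse)
  show ?thesis by (rule iffD1[OF filterlim_cong[OF refl refl ev] lim])
qed

theorem theorem2p2:
  fixes \<Omega> :: "(real ^ 'n) set" and n :: nat and \<gamma> \<beta> \<alpha> :: real
  assumes n_def: "n = CARD('n)" and "n \<ge> 2"
    and "open \<Omega>" and "connected \<Omega>" and "\<Omega> \<noteq> {}" and "bounded \<Omega>"
    and "0 < \<gamma>" and "\<gamma> < 1" and "C1_holder_boundary \<gamma> \<Omega>"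
    and \<beta>_def: "\<beta> = (real n - 1) *
      (measure (hausdorff_measure (n - 1)) (sphere (0 :: real ^ 'n) 1) / 2) powr (1 / (real n - 1))"
    and "\<alpha> > \<beta>"
  shows "\<exists>u :: nat \<Rightarrow> real ^ 'n \<Rightarrow> real.
    (\<forall>k. C1_on_closure \<Omega> (u k) \<and> continuous_on (frontier \<Omega>) (u k) \<and>
         (LINT x:\<Omega>|lborel. u k x) = 0 \<and>
         (LINT x:\<Omega>|lborel. norm (grad (u k) x) ^ n) powr (1 / real n) \<le> 1) \<and>
    (\<lambda>k. \<integral>\<^sup>+x\<in>frontier \<Omega>. ennreal (exp (\<alpha> * \<bar>u k x\<bar> powr (real n / (real n - 1))))
          \<partial>hausdorff_measure (n - 1)) \<longlonglongrightarrow> \<infinity>"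
proof -
  let ?K = "real n * unit_ball_vol (real n)"
  let ?S = "measure (hausdorff_measure (n - 1)) (sphere (0 :: real ^ 'n) 1)"
  have K: "0 < ?K" using \<open>n \<ge> 2\<close> by simp
  have KS: "?K \<le> ?S" unfolding n_def by (rule measure_hausdorff_sphere_ge)
  obtain A \<delta> where A: "?K / 2 < A" and \<delta>: "0 < \<delta>" "\<delta> < 1"
      and super: "real n - 1 < \<alpha> * (1 - \<delta>) powr (real n / (real n - 1)) / A powr (1 / (real n - 1))"
    using supercritical_parameters[OF \<open>n \<ge> 2\<close> K KS] \<open>\<alpha> > \<beta>\<close> unfolding \<beta>_def by blast
  define \<theta> where "\<theta> = \<alpha> * (1 - \<delta>) powr (real n / (real n - 1)) / A powr (1 / (real n - 1))"
  have A0: "0 < A" using A K by linarith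
  have "0 \<le> \<beta>" unfolding \<beta>_def using \<open>n \<ge> 2\<close> by simp
  then have \<alpha>0: "0 \<le> \<alpha>" using \<open>\<alpha> > \<beta>\<close> by linarith
  have "\<Omega> \<noteq> UNIV" using \<open>bounded \<Omega>\<close> not_bounded_UNIV by blast
  then obtain p where p: "p \<in> frontier \<Omega>"
    using frontier_eq_empty[of \<Omega>] \<open>\<Omega> \<noteq> {}\<close> by blast
  obtain c d0 where c: "0 < c" "0 < d0"
    "\<And>d. 0 < d \<Longrightarrow> d < d0 \<Longrightarrow> ennreal (c * d ^ (n - 1)) \<le> hausdorff_outer (n - 1) (frontier \<Omega> \<inter> ball p d)"
    using C1_boundary_hausdorff_lower[OF \<open>open \<Omega>\<close> \<open>C1_holder_boundary \<gamma> \<Omega>\<close> p] unfolding n_def by blast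
  obtain d :: "nat \<Rightarrow> real" where d: "\<And>k. 0 < d k" "d \<longlonglongrightarrow> 0"
    "\<forall>\<^sub>F k in sequentially. (LINT x:\<Omega>|lborel. norm (log_bump_grad p (d k) x) ^ n) \<le> A * ln (1 / d k)"
    using log_bump_energy_sequence[OF \<open>open \<Omega>\<close> \<open>bounded \<Omega>\<close> \<open>C1_holder_boundary \<gamma> \<Omega>\<close> p, of A] A
    unfolding n_def by blast
  have d_right: "filterlim d (at_right 0) sequentially"
  proof -
    have "d k \<in> {0<..} \<and> d k \<noteq> 0" for k using d(1)[of k] by simp
    then show ?thesis unfolding filterlim_at using d(2) by (simp add: always_eventually)
  qed
  define L where "L k = ln (1 / d k)" for k
  define u where "u k = normalized_log_bump \<Omega> p ((A * L k) powr (1 / real n)) (d k)" for k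
  have "filterlim (\<lambda>d::real. ln (1 / d)) at_top (at_right 0)"
    using filterlim_compose[OF ln_at_top filterlim_inverse_at_top_right] by (simp add: inverse_eq_divide)
  from filterlim_compose[OF this d_right] have L_top: "filterlim L at_top sequentially"
    unfolding L_def .
  have "\<forall>\<^sub>F d in at_right 0. (LINT x:\<Omega>|lborel. log_bump p d x) \<le> \<delta> / 2 * ln (1 / d) * measure lborel \<Omega>"
    using \<delta>(1) by (intro log_bump_mean_le \<open>open \<Omega>\<close> \<open>bounded \<Omega>\<close> \<open>\<Omega> \<noteq> {}\<close>) simp
  from eventually_compose_filterlim[OF this d_right]
  have mean: "\<forall>\<^sub>F k in sequentially. (LINT x:\<Omega>|lborel. log_bump p (d k) x) \<le> \<delta> / 2 * L k * measure lborel \<Omega>"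
    unfolding L_def .
  have "\<forall>\<^sub>F k in sequentially. max 1 (ln 2 / \<delta>) \<le> L k"
    using L_top unfolding filterlim_at_top by blast
  moreover have "\<forall>\<^sub>F k in sequentially. d k < d0"
    using d(2) c(2) by (rule order_tendstoD(2))
  ultimately have "\<forall>\<^sub>F k in sequentially. max 1 (ln 2 / \<delta>) \<le> L k \<and> d k < d0 \<and>
      (LINT x:\<Omega>|lborel. log_bump p (d k) x) \<le> \<delta> / 2 * L k * measure lborel \<Omega> \<and>
      (LINT x:\<Omega>|lborel. norm (log_bump_grad p (d k) x) ^ n) \<le> A * L k"
    using mean d(3) unfolding L_def by eventually_elim blast
  \<comment> \<open>All bounds hold only from some index \<open>N\<close> on, so the sequence is shifted by \<open>N\<close> at the end.\<close>
  then obtain N where N: "\<And>k. N \<le> k \<Longrightarrow> max 1 (ln 2 / \<delta>) \<le> L k \<and> d k < d0 \<and>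
      (LINT x:\<Omega>|lborel. log_bump p (d k) x) \<le> \<delta> / 2 * L k * measure lborel \<Omega> \<and>
      (LINT x:\<Omega>|lborel. norm (log_bump_grad p (d k) x) ^ n) \<le> A * L k"
    unfolding eventually_sequentially by blast
  have L0: "0 < L k" "ln 2 / 2 \<le> \<delta> / 2 * L k" if "N \<le> k" for k
    using N[OF that] \<delta>(1) by (auto simp: field_simps)
  let ?I = "\<lambda>k. \<integral>\<^sup>+x\<in>frontier \<Omega>. ennreal (exp (\<alpha> * \<bar>u k x\<bar> powr (real n / (real n - 1)))) \<partial>hausdorff_measure (n - 1)"
  have lower: "ennreal (c * d k powr (- (\<theta> - (real n - 1)))) \<le> ?I k" if k: "N \<le> k" for k
  proof -
    let ?F = "frontier \<Omega> \<inter> ball p (d k)"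
    have F: "?F \<in> sets borel" by (intro sets.Int) auto
    have mean_k: "(LINT y:\<Omega>|lborel. log_bump p (d k) y) / measure lborel \<Omega> \<le> \<delta> / 2 * L k"
      using N[OF k] measure_bounded_open_pos[OF \<open>open \<Omega>\<close> \<open>bounded \<Omega>\<close> \<open>\<Omega> \<noteq> {}\<close>]
      by (simp add: divide_le_eq)
    have expo: "\<theta> * L k \<le> \<alpha> * \<bar>u k x\<bar> powr (real n / (real n - 1))" if "x \<in> ?F" for x
      unfolding \<theta>_def u_def using that
      by (intro normalized_log_bump_exponent[OF \<open>n \<ge> 2\<close> d(1) _ \<delta> A0 L_def L0[OF k] \<alpha>0 mean_k])
        (simp add: dist_norm norm_minus_commute)
    have "c * d k powr (- (\<theta> - (real n - 1))) = exp (\<theta> * L k) * (c * d k ^ (n - 1))"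
    proof -
      have "d k powr (- (\<theta> - (real n - 1))) = d k powr (- \<theta>) * d k powr (real (n - 1))"
        using \<open>n \<ge> 2\<close> by (simp add: of_nat_diff flip: powr_add)
      moreover have "d k powr (- \<theta>) = exp (\<theta> * L k)"
        using d(1)[of k] by (simp add: powr_def L_def ln_div)
      ultimately show ?thesis using d(1)[of k] by (simp add: powr_realpow)
    qed
    then have "ennreal (c * d k powr (- (\<theta> - (real n - 1)))) = ennreal (exp (\<theta> * L k)) * ennreal (c * d k ^ (n - 1))"
      using c(1) d(1)[of k] by (simp add: ennreal_mult less_imp_le mult_ac)
    also have "\<dots> \<le> ennreal (exp (\<theta> * L k)) * emeasure (hausdorff_measure (n - 1)) ?F"
      unfolding emeasure_hausdorff_measure[OF F] using c(3)[OF d(1)] N[OF k] by (intro mult_left_mono) auto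
    also have "\<dots> = (\<integral>\<^sup>+x. ennreal (exp (\<theta> * L k)) * indicator ?F x \<partial>hausdorff_measure (n - 1))"
      using F by (intro nn_integral_cmult_indicator[symmetric]) simp
    also have "\<dots> \<le> ?I k"
      using expo by (intro nn_integral_mono) (auto simp: indicator_def intro!: ennreal_leI)
    finally show ?thesis .
  qed
  have top: "(\<lambda>k. ?I k) \<longlonglongrightarrow> \<infinity>"
  proof -
    have "0 < \<theta> - (real n - 1)" using super by (simp add: \<theta>_def)
    from filterlim_compose[OF filterlim_powr_neg_at_top[OF this c(1)] d_right]
    have "(\<lambda>k. ennreal (c * d k powr (- (\<theta> - (real n - 1))))) \<longlonglongrightarrow> top"
      by (simp add: ennreal_tendsto_top_eq_at_top)
    moreover have "\<forall>\<^sub>F k in sequentially. ennreal (c * d k powr (- (\<theta> - (real n - 1)))) \<le> ?I k"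
      using lower unfolding eventually_sequentially by blast
    ultimately have "(\<lambda>k. ?I k) \<longlonglongrightarrow> top"
      by (rule tendsto_sandwich[OF _ _ _ tendsto_const, rotated 2]) (auto intro: always_eventually)
    then show ?thesis by simp
  qed
  show ?thesis
  proof (intro exI[of _ "\<lambda>k. u (k + N)"] conjI allI)
    fix k
    show "C1_on_closure \<Omega> (u (k + N))" "continuous_on (frontier \<Omega>) (u (k + N))"
      unfolding u_def by (intro C1_on_closure_normalized_log_bump d(1))+
    show "(LINT x:\<Omega>|lborel. u (k + N) x) = 0"
      unfolding u_def by (intro normalized_log_bump_mean_zero \<open>open \<Omega>\<close> \<open>bounded \<Omega>\<close> \<open>\<Omega> \<noteq> {}\<close> d(1))
    have "(LINT x:\<Omega>|lborel. norm (log_bump_grad p (d (k + N)) x) ^ n) \<le> A * L (k + N)"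
      using N[of "k + N"] by simp
    then show "(LINT x:\<Omega>|lborel. norm (grad (u (k + N)) x) ^ n) powr (1 / real n) \<le> 1"
      using normalized_log_bump_energy_le_1[of "d (k + N)" "A * L (k + N)" \<Omega> p] d(1) A0 L0(1)[of "k + N"]
      unfolding u_def n_def by simp
  next
    show "(\<lambda>k. ?I (k + N)) \<longlonglongrightarrow> \<infinity>" using top by (rule LIMSEQ_ignore_initial_segment)
  qed
qed

end
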